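(* Let $\Gamma=(N,A,\mathcal F,\Delta,u)$ be a strategic form game with countably additive strategies. Then the set of perfect equilibria of $\Gamma$ is non-empty and compact.
   Context: A directed set $(I,\le)$ is a non-empty set with a reflexive, transitive relation such that every pair has an upper bound and there is no maximal element (for every $\alpha$ there is $\beta\ge\alpha$ with $\beta\neq\alpha$). Nets are indexed by directed sets; convergence is as usual. A strategic form game with countably additive strategies $\Gamma=(N,A,\mathcal F,\Delta,u)$ consists of: $N=\{1,\dots,n\}$; $A=\prod_{i\in N}A_i$ with each $A_i$ a non-empty compact metric space with metric $d_i$; $\mathcal F_i$ the Borel sigma-field of $A_i$; $\Delta=\prod_i\Delta_i$, where $\Delta_i$ is the set of countably additive probability measures on $\mathcal F_i$; continuous functions $u_i\colon A\to\mathbb R$; payoff functions $U_i(\sigma)=\int_Au_i\,d(\sigma_1\otimes\cdots\otimes\sigma_n)$. $\Delta$ has the topology of weak convergence, metrized by the Prohorov metric: with $d(a,b)=\max_id_i(a_i,b_i)$ on $A$, and identifying a profile $\sigma$ with its product measure on the Borel sets of $A$, $d_P(\sigma,\tau)=\inf\{\varepsilon>0\mid\sigma(B)\le\tau(B_\varepsilon)+\varepsilon\text{ and }\tau(B)\le\sigma(B_\varepsilon)+\varepsilon\text{ for all Borel }B\subseteq A\}$, where $B_\varepsilon=\{a\in A\mid d(a,B)<\varepsilon\}$. $(\tau_i\mid\sigma)$ is the profile $\sigma$ with $\sigma_i$ replaced by $\tau_i$. $\tau_i\in\Delta_i$ is a best response to $\sigma\in\Delta$ if $U_i(\tau_i\mid\sigma)\ge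 U_i(\tau_i'\mid\sigma)$ for all $\tau_i'\in\Delta_i$; a profile $\tau$ is a best response to $\sigma$ if each $\tau_i$ is. $\sigma$ is a Nash equilibrium if it is a best response to itself. The carrier of $\sigma_i\in\Delta_i$ is $\mathcal C_i(\sigma_i)=\{E\in\mathcal F_i\mid\sigma_i(E)>0\}$, and $\mathcal C(\sigma)=\prod_i\mathcal C_i(\sigma_i)$. A carrier is a set of the form $\mathcal C(\sigma)$ with $\sigma\in\Delta$. A net $(\sigma_\alpha)_{\alpha\in I}$ in $\Delta$ is completely mixed if for every carrier $\mathcal C$ there is $\alpha\in I$ with $\mathcal C\subseteq\mathcal C(\sigma_\beta)$ for all $\beta\ge\alpha$. $\sigma$ is perfect if there are a completely mixed net $(\sigma_\alpha)_{\alpha\in I}$ and a net $(\kappa_\alpha)_{\alpha\in I}$ in $\Delta$, both converging to $\sigma$, such that $\kappa_\alpha$ is a best response to $\sigma_\alpha$ for each $\alpha\in I$. A perfect equilibrium is a Nash equilibrium that is perfect. *)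

theory Defs
  imports "HOL-Probability.Probability"
begin

definition borel_on :: "'a topology \<Rightarrow> 'a measure" where
  "borel_on X = sigma (topspace X) {U. openin X U}"

definition directed_set :: "'k set \<Rightarrow> ('k \<Rightarrow> 'k \<Rightarrow> bool) \<Rightarrow> bool" where
  "directed_set I le \<longleftrightarrow>
     I \<noteq> {} \<and> reflp_on I le \<and> transp_on I le \<and>
     (\<forall>x\<in>I. \<forall>y\<in>I. \<exists>z\<in>I. le x z \<and> le y z) \<and>
     (\<forall>x\<in>I. \<exists>y\<in>I. le x y \<and> y \<noteq> x)"

definition net_filter :: "'k set \<Rightarrow> ('k \<Rightarrow> 'k \<Rightarrow> bool) \<Rightarrow> 'k filter" where
  "net_filter I le = (INF a\<in>I. principal {b\<in>I. le a b})"

lemma eventually_net_filter: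
  assumes "directed_set I le"
  shows "eventually P (net_filter I le) \<longleftrightarrow> (\<exists>a\<in>I. \<forall>b\<in>I. le a b \<longrightarrow> P b)"
proof -
  have ne: "I \<noteq> {}" and tr: "transp_on I le"
    and dir: "\<And>x y. x \<in> I \<Longrightarrow> y \<in> I \<Longrightarrow> \<exists>z\<in>I. le x z \<and> le y z"
    using assms unfolding directed_set_def by blast+
  have "eventually P (net_filter I le) \<longleftrightarrow>
      (\<exists>a\<in>I. eventually P (principal {b\<in>I. le a b}))"
    unfolding net_filter_def
  proof (rule eventually_INF_base[OF ne])
    fix x y assume xy: "x \<in> I" "y \<in> I"
    then obtain z where z: "z \<in> I" "le x z" "le y z" using dir by blast
    have "{b\<in>I. le z b} \<subseteq> {b\<in>I. le x b} \<inter> {b\<in>I. le y b}"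
      using tr xy z unfolding transp_on_def by blast
    then show "\<exists>w\<in>I. principal {b\<in>I. le w b} \<le>
        inf (principal {b\<in>I. le x b}) (principal {b\<in>I. le y b})"
      using z(1) by (metis inf_principal principal_le_iff)
  qed
  then show ?thesis by (auto simp: eventually_principal)
qed

text \<open>
  Players form a non-empty finite type. The action spaces are carrier sets inside one
  common type, each with its own metric; any finite family of metric spaces can be
  presented this way, since it embeds into its disjoint union.
\<close>

locale strategic_form_game =
  fixes A :: "'p::finite \<Rightarrow> 'a set"
    and d :: "'p \<Rightarrow> 'a \<Rightarrow> 'a \<Rightarrow> real"
    and u :: "'p \<Rightarrow> ('p \<Rightarrow> 'a) \<Rightarrow> real"
  assumes actions_nonempty: "A i \<noteq> {}"
    and actions_metric: "Metric_space (A i) (d i)"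
    and actions_compact: "compact_space (Metric_space.mtopology (A i) (d i))"
    and payoff_continuous:
      "continuous_map (product_topology (\<lambda>j. Metric_space.mtopology (A j) (d j)) UNIV)
         euclideanreal (u i)"
begin

definition action_topology :: "'p \<Rightarrow> 'a topology" where
  "action_topology i = Metric_space.mtopology (A i) (d i)"

definition outcome_topology :: "('p \<Rightarrow> 'a) topology" where
  "outcome_topology = product_topology action_topology UNIV"

definition outcomes :: "('p \<Rightarrow> 'a) set" where
  "outcomes = (\<Pi>\<^sub>E i\<in>UNIV. A i)"

definition outcome_dist :: "('p \<Rightarrow> 'a) \<Rightarrow> ('p \<Rightarrow> 'a) \<Rightarrow> real" where
  "outcome_dist a b = (MAX i\<in>UNIV. d i (a i) (b i))"

definition strategies :: "'p \<Rightarrow> 'a measure set" where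
  "strategies i = {\<mu>. prob_space \<mu> \<and> space \<mu> = A i \<and> sets \<mu> = sets (borel_on (action_topology i))}"

definition profiles :: "('p \<Rightarrow> 'a measure) set" where
  "profiles = (\<Pi>\<^sub>E i\<in>UNIV. strategies i)"

definition expected_payoff :: "'p \<Rightarrow> ('p \<Rightarrow> 'a measure) \<Rightarrow> real" where
  "expected_payoff i \<sigma> = (LINT a|PiM UNIV \<sigma>. u i a)"

text \<open>
  The infimum, i.e. the distance from \<open>a\<close> to \<open>B\<close>, is taken in the extended reals, so
  that the distance to the empty set is infinite.
\<close>

definition enlargement :: "('p \<Rightarrow> 'a) set \<Rightarrow> real \<Rightarrow> ('p \<Rightarrow> 'a) set" where
  "enlargement B \<epsilon> = {a \<in> outcomes. (INF b\<in>B. ereal (outcome_dist a b)) < ereal \<epsilon>}"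

text \<open>
  \<^const>\<open>Metric_space\<close> asks for non-negativity and symmetry of the distance function even
  outside the carrier, whence the value \<open>0\<close> there.
\<close>

definition prohorov :: "('p \<Rightarrow> 'a measure) \<Rightarrow> ('p \<Rightarrow> 'a measure) \<Rightarrow> real" where
  "prohorov \<sigma> \<tau> =
     (if \<sigma> \<in> profiles \<and> \<tau> \<in> profiles
      then Inf {\<epsilon>. \<epsilon> > 0 \<and> (\<forall>B\<in>sets (borel_on outcome_topology).
        measure (PiM UNIV \<sigma>) B \<le> measure (PiM UNIV \<tau>) (enlargement B \<epsilon>) + \<epsilon> \<and>
        measure (PiM UNIV \<tau>) B \<le> measure (PiM UNIV \<sigma>) (enlargement B \<epsilon>) + \<epsilon>)}
      else 0)"

definition profile_topology :: "('p \<Rightarrow> 'a measure) topology" where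
  "profile_topology = Metric_space.mtopology profiles prohorov"

definition best_response_of :: "'p \<Rightarrow> 'a measure \<Rightarrow> ('p \<Rightarrow> 'a measure) \<Rightarrow> bool" where
  "best_response_of i \<mu> \<sigma> \<longleftrightarrow> \<mu> \<in> strategies i \<and>
     (\<forall>\<mu>'\<in>strategies i. expected_payoff i (\<sigma>(i := \<mu>)) \<ge> expected_payoff i (\<sigma>(i := \<mu>')))"

definition best_response :: "('p \<Rightarrow> 'a measure) \<Rightarrow> ('p \<Rightarrow> 'a measure) \<Rightarrow> bool" where
  "best_response \<tau> \<sigma> \<longleftrightarrow> \<tau> \<in> profiles \<and> (\<forall>i. best_response_of i (\<tau> i) \<sigma>)"

definition nash_equilibrium :: "('p \<Rightarrow> 'a measure) \<Rightarrow> bool" where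
  "nash_equilibrium \<sigma> \<longleftrightarrow> \<sigma> \<in> profiles \<and> best_response \<sigma> \<sigma>"

definition strategy_carrier :: "'p \<Rightarrow> 'a measure \<Rightarrow> 'a set set" where
  "strategy_carrier i \<mu> = {E \<in> sets (borel_on (action_topology i)). measure \<mu> E > 0}"

definition profile_carrier :: "('p \<Rightarrow> 'a measure) \<Rightarrow> ('p \<Rightarrow> 'a set) set" where
  "profile_carrier \<sigma> = (\<Pi>\<^sub>E i\<in>UNIV. strategy_carrier i (\<sigma> i))"

definition completely_mixed ::
    "'k set \<Rightarrow> ('k \<Rightarrow> 'k \<Rightarrow> bool) \<Rightarrow> ('k \<Rightarrow> 'p \<Rightarrow> 'a measure) \<Rightarrow> bool" where
  "completely_mixed I le s \<longleftrightarrow> (\<forall>a\<in>I. s a \<in> profiles) \<and>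
     (\<forall>C \<in> profile_carrier ` profiles.
        \<exists>a\<in>I. \<forall>b\<in>I. le a b \<longrightarrow> C \<subseteq> profile_carrier (s b))"

definition perfect_along :: "'k set \<Rightarrow> ('k \<Rightarrow> 'k \<Rightarrow> bool) \<Rightarrow> ('k \<Rightarrow> 'p \<Rightarrow> 'a measure) \<Rightarrow>
    ('k \<Rightarrow> 'p \<Rightarrow> 'a measure) \<Rightarrow> ('p \<Rightarrow> 'a measure) \<Rightarrow> bool" where
  "perfect_along I le s t \<sigma> \<longleftrightarrow>
     directed_set I le \<and> completely_mixed I le s \<and> (\<forall>a\<in>I. t a \<in> profiles) \<and>
     limitin profile_topology s \<sigma> (net_filter I le) \<and>
     limitin profile_topology t \<sigma> (net_filter I le) \<and>
     (\<forall>a\<in>I. best_response (t a) (s a))"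

text \<open>
  Quantification over all directed sets needs a fixed type of indices. The type below
  loses nothing: a pair of nets over an arbitrary index type can be replaced by a pair
  indexed by the tail sets of the original pair, as the lemma \<open>perfectI\<close> shows. The
  additional natural number ensures that there is no maximal index.
\<close>

definition perfect :: "('p \<Rightarrow> 'a measure) \<Rightarrow> bool" where
  "perfect \<sigma> \<longleftrightarrow> \<sigma> \<in> profiles \<and>
     (\<exists>(I :: ((('p \<Rightarrow> 'a measure) \<times> ('p \<Rightarrow> 'a measure)) set \<times> nat) set) le s t.
        perfect_along I le s t \<sigma>)"

definition perfect_equilibria :: "('p \<Rightarrow> 'a measure) set" where
  "perfect_equilibria = {\<sigma>. nash_equilibrium \<sigma> \<and> perfect \<sigma>}"

lemma perfectI:
  fixes I :: "'k set"
  assumes "\<sigma> \<in> profiles" and "perfect_along I le s t \<sigma>"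
  shows "perfect \<sigma>"
proof -
  have dirI: "directed_set I le"
    and mixed: "\<And>C. C \<in> profile_carrier ` profiles \<Longrightarrow>
      \<exists>a\<in>I. \<forall>b\<in>I. le a b \<longrightarrow> C \<subseteq> profile_carrier (s b)"
    and sp: "\<And>a. a \<in> I \<Longrightarrow> s a \<in> profiles" and tp: "\<And>a. a \<in> I \<Longrightarrow> t a \<in> profiles"
    and lims: "limitin profile_topology s \<sigma> (net_filter I le)"
    and limt: "limitin profile_topology t \<sigma> (net_filter I le)"
    and br: "\<And>a. a \<in> I \<Longrightarrow> best_response (t a) (s a)"
    using assms(2) unfolding perfect_along_def completely_mixed_def by blast+
  have ne: "I \<noteq> {}" and re: "\<And>a. a \<in> I \<Longrightarrow> le a a" and tr: "transp_on I le"
    and dir: "\<And>x y. x \<in> I \<Longrightarrow> y \<in> I \<Longrightarrow> \<exists>z\<in>I. le x z \<and> le y z"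
    using dirI unfolding directed_set_def reflp_on_def by blast+
  define T where "T a = (\<lambda>b. (s b, t b)) ` {b\<in>I. le a b}" for a
  define J where "J = T ` I \<times> (UNIV :: nat set)"
  define le' where "le' x y \<longleftrightarrow> fst y \<subseteq> fst x \<and> snd x \<le> snd y"
    for x y :: "(('p \<Rightarrow> 'a measure) \<times> ('p \<Rightarrow> 'a measure)) set \<times> nat"
  define c where "c x = (SOME z. z \<in> fst x)"
    for x :: "(('p \<Rightarrow> 'a measure) \<times> ('p \<Rightarrow> 'a measure)) set \<times> nat"
  have T_mono: "T z \<subseteq> T x" if "x \<in> I" "z \<in> I" "le x z" for x z
    using tr that unfolding transp_on_def T_def by blast
  have T_ne: "T a \<noteq> {}" if "a \<in> I" for a
    using re that unfolding T_def by blast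
  have c_in: "c x \<in> fst x" if "x \<in> J" for x
  proof -
    have "fst x \<noteq> {}" using that T_ne unfolding J_def by auto
    then show ?thesis unfolding c_def by (simp add: some_in_eq)
  qed
  have c_ex: "\<exists>b\<in>I. c x = (s b, t b)" if "x \<in> J" for x
    using c_in[OF that] that unfolding J_def T_def by auto
  have dirJ: "directed_set J le'"
    unfolding directed_set_def
  proof (intro conjI ballI)
    show "J \<noteq> {}" using ne unfolding J_def by auto
    show "reflp_on J le'" unfolding reflp_on_def le'_def by auto
    show "transp_on J le'" unfolding transp_on_def le'_def by auto
  next
    fix x y assume "x \<in> J" "y \<in> J"
    then obtain a m b k where x: "x = (T a, m)" "a \<in> I" and y: "y = (T b, k)" "b \<in> I"
      unfolding J_def by auto
    obtain e where e: "e \<in> I" "le a e" "le b e" using dir x(2) y(2) by blast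
    have "(T e, max m k) \<in> J" using e unfolding J_def by auto
    moreover have "le' x (T e, max m k)" "le' y (T e, max m k)"
      using T_mono e x y unfolding le'_def by auto
    ultimately show "\<exists>z\<in>J. le' x z \<and> le' y z" by blast
  next
    fix x assume "x \<in> J"
    then have "(fst x, Suc (snd x)) \<in> J" "le' x (fst x, Suc (snd x))"
      unfolding J_def le'_def by auto
    moreover have "(fst x, Suc (snd x)) \<noteq> x" by (cases x) simp
    ultimately show "\<exists>y\<in>J. le' x y \<and> y \<noteq> x" by blast
  qed
  have transfer: "\<exists>x\<in>J. \<forall>y\<in>J. le' x y \<longrightarrow> P (fst (c y)) (snd (c y))"
    if ev: "\<exists>a\<in>I. \<forall>b\<in>I. le a b \<longrightarrow> P (s b) (t b)" for P
  proof -
    obtain a where a: "a \<in> I" "\<And>b. b \<in> I \<Longrightarrow> le a b \<Longrightarrow> P (s b) (t b)" using ev by blast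
    have "(T a, 0) \<in> J" using a unfolding J_def by auto
    moreover have "P (fst (c y)) (snd (c y))" if "y \<in> J" "le' (T a, 0) y" for y
    proof -
      have "c y \<in> T a" using c_in[OF that(1)] that(2) unfolding le'_def by auto
      then show ?thesis using a(2) unfolding T_def by auto
    qed
    ultimately show ?thesis by blast
  qed
  have "perfect_along J le' (fst \<circ> c) (snd \<circ> c) \<sigma>"
    unfolding perfect_along_def completely_mixed_def
  proof (intro conjI ballI)
    show "directed_set J le'" by (rule dirJ)
  next
    fix x assume "x \<in> J"
    then show "(fst \<circ> c) x \<in> profiles" "(snd \<circ> c) x \<in> profiles"
      "best_response ((snd \<circ> c) x) ((fst \<circ> c) x)"
      using c_ex sp tp br by fastforce+
  next
    fix C assume "C \<in> profile_carrier ` profiles"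
    then show "\<exists>x\<in>J. \<forall>y\<in>J. le' x y \<longrightarrow> C \<subseteq> profile_carrier ((fst \<circ> c) y)"
      using transfer[of "\<lambda>p q. C \<subseteq> profile_carrier p"] mixed by simp
  next
    show "limitin profile_topology (fst \<circ> c) \<sigma> (net_filter J le')"
      using lims transfer[of "\<lambda>p q. p \<in> U" for U]
      unfolding limitin_def eventually_net_filter[OF dirI] eventually_net_filter[OF dirJ]
      by simp
    show "limitin profile_topology (snd \<circ> c) \<sigma> (net_filter J le')"
      using limt transfer[of "\<lambda>p q. q \<in> U" for U]
      unfolding limitin_def eventually_net_filter[OF dirI] eventually_net_filter[OF dirJ]
      by simp
  qed
  then show ?thesis using assms(1) unfolding perfect_def by blast
qed

end

end

theory Submission
  imports Defs
begin

text \<open>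
  A profile is perfect iff for each profile \<open>\<rho>\<close> it is a limit of pairs \<open>(s, t)\<close> in
  which \<open>s\<close> dominates the carrier of \<open>\<rho>\<close> and \<open>t\<close> is a best response to \<open>s\<close>. For fixed \<open>\<rho>\<close> these limits
  form a closed set, and the sets are directed because finitely many \<open>\<rho>\<close> are dominated by an average
  of them. It remains to see that each set is non-empty. Mixing \<open>\<tau>\<close> with a small weight of \<open>\<rho>\<close> gives a
  perturbed game; Ky Fan's argument (Kuhn's combinatorial lemma on simplices spanned by finitely many
  profiles, then the finite intersection property) yields a \<open>\<tau>\<close> that is a best response to its own
  perturbation, and one lets the weight tend to \<open>0\<close>. Compactness of the space of profiles
  follows from Helly's theorem on the line, and the product of weakly convergent marginals converges
  in the Prohorov metric.
\<close>

section \<open>Borel probability measures and weak convergence\<close>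

text \<open>No single full-support perturbation and no sequence of them can serve: if some
  \<open>A i\<close> is uncountable, countably many measures have only countably many atoms in all,
  so some singleton lies in none of their carriers although a Dirac measure charges it. Hence
  carriers are treated one at a time and joined by compactness; a net is rebuilt only at the end,
  with profiles ordered by inclusion of carriers as indices. Only the profile responded to is
  perturbed, not the response, so both have the same limit when the weight vanishes. That limit is a
  Nash equilibrium because best responding is a closed relation, so the Nash condition costs nothing
  extra. The Prohorov metric compares product measures on outcomes, while mixing and extracting
  subsequences act on the strategy of each player. Metric convergence is therefore turned into weak
  convergence of all marginals. The equilibrium argument then involves only finite mixtures and
  their coefficients, where a combinatorial lemma on a grid applies.\<close>

lemma space_borel_on [simp]: "space (borel_on X) = topspace X"
  unfolding borel_on_def by (rule space_measure_of) (auto dest: openin_subset)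

lemma sets_borel_on: "sets (borel_on X) = sigma_sets (topspace X) {U. openin X U}"
  unfolding borel_on_def by (rule sets_measure_of) (auto dest: openin_subset)

lemma openin_in_borel_on: "openin X U \<Longrightarrow> U \<in> sets (borel_on X)"
  by (auto simp: sets_borel_on)

lemma closedin_in_borel_on:
  assumes "closedin X C" shows "C \<in> sets (borel_on X)"
proof -
  have "topspace X - (topspace X - C) \<in> sets (borel_on X)"
    using assms sets.compl_sets[of "topspace X - C" "borel_on X"]
    by (auto simp: closedin_def intro: openin_in_borel_on)
  then show ?thesis using closedin_subset[OF assms] by (simp add: double_diff)
qed

lemma continuous_map_borel_measurable:
  assumes "continuous_map X euclideanreal f"
  shows "f \<in> borel_measurable (borel_on X)"
proof (rule borel_measurableI)
  fix S :: "real set" assume "open S"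
  then have "openin X {x \<in> topspace X. f x \<in> S}"
    using assms by (simp add: continuous_map_def)
  moreover have "f -` S \<inter> space (borel_on X) = {x \<in> topspace X. f x \<in> S}" by auto
  ultimately show "f -` S \<inter> space (borel_on X) \<in> sets (borel_on X)"
    by (simp add: openin_in_borel_on)
qed

lemma continuous_map_compact_bounded:
  assumes "compact_space X" "continuous_map X euclideanreal f"
  obtains b where "\<And>x. x \<in> topspace X \<Longrightarrow> \<bar>f x\<bar> \<le> b"
proof -
  have "compact (f ` topspace X)"
    using image_compactin[of X "topspace X" euclideanreal f] assms
    by (auto simp: compact_space_def)
  then have "bounded (f ` topspace X)" by (rule compact_imp_bounded)
  then show ?thesis using that unfolding bounded_iff by auto
qed

definition borel_probs :: "'a topology \<Rightarrow> 'a measure set" where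
  "borel_probs X = {\<mu>. prob_space \<mu> \<and> space \<mu> = topspace X \<and> sets \<mu> = sets (borel_on X)}"

text \<open>Test functions carry no bound because the notion is applied to compact \<open>X\<close>,
  where continuous functions are bounded. Sequences suffice because the topology on
  \<open>profiles\<close> comes from a metric.\<close>

definition weakly_tendsto :: "'a topology \<Rightarrow> (nat \<Rightarrow> 'a measure) \<Rightarrow> 'a measure \<Rightarrow> bool" where
  "weakly_tendsto X \<mu> \<nu> \<longleftrightarrow> (\<forall>f. continuous_map X euclideanreal f \<longrightarrow>
     (\<lambda>n. \<integral>x. f x \<partial>\<mu> n) \<longlonglongrightarrow> (\<integral>x. f x \<partial>\<nu>))"

lemma borel_probsD:
  assumes "\<mu> \<in> borel_probs X"
  shows "prob_space \<mu>" "space \<mu> = topspace X" "sets \<mu> = sets (borel_on X)"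
  using assms by (auto simp: borel_probs_def)

lemma weakly_tendstoD:
  "weakly_tendsto X \<mu> \<nu> \<Longrightarrow> continuous_map X euclideanreal f \<Longrightarrow>
     (\<lambda>n. \<integral>x. f x \<partial>\<mu> n) \<longlonglongrightarrow> (\<integral>x. f x \<partial>\<nu>)"
  by (simp add: weakly_tendsto_def)

lemma weakly_tendsto_subseq:
  "weakly_tendsto X \<mu> \<nu> \<Longrightarrow> strict_mono r \<Longrightarrow> weakly_tendsto X (\<mu> \<circ> r) \<nu>"
  unfolding weakly_tendsto_def
  using LIMSEQ_subseq_LIMSEQ[of "\<lambda>n. integral\<^sup>L (\<mu> n) f" _ r for f] by (auto simp: comp_def)

lemma weakly_tendsto_const: "weakly_tendsto X (\<lambda>_. \<mu>) \<mu>"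
  by (simp add: weakly_tendsto_def)

lemma borel_probs_measurable:
  assumes "\<mu> \<in> borel_probs X" "continuous_map X euclideanreal f"
  shows "f \<in> borel_measurable \<mu>"
  using continuous_map_borel_measurable[OF assms(2)]
    measurable_cong_sets[OF borel_probsD(3)[OF assms(1)] refl] by blast

lemma borel_probs_integrable:
  assumes "\<mu> \<in> borel_probs X" "compact_space X" "continuous_map X euclideanreal f"
  shows "integrable \<mu> f"
proof -
  interpret prob_space \<mu> using borel_probsD(1)[OF assms(1)] .
  obtain b where "\<And>x. x \<in> topspace X \<Longrightarrow> \<bar>f x\<bar> \<le> b"
    using continuous_map_compact_bounded[OF assms(2,3)] by blast
  then show ?thesis
    using borel_probs_measurable[OF assms(1,3)] borel_probsD(2)[OF assms(1)]
    by (intro integrable_const_bound[of _ b]) auto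
qed

text \<open>
  Digits \<open>0\<close> and \<open>1\<close> in base \<open>3\<close>: unlike in base \<open>2\<close>, closeness of the values forces agreement of
  the leading digits.
\<close>

definition ternary :: "(nat \<Rightarrow> bool) \<Rightarrow> real" where
  "ternary P = (\<Sum>j. if P j then (1/3) ^ j else 0)"

lemma ternary_summable: "summable (\<lambda>j. if P j then (1/3::real) ^ j else 0)"
  by (rule summable_comparison_test'[of "\<lambda>j. (1/3::real)^j" 0]) auto

lemma ternary_bounds: "0 \<le> ternary P" "ternary P \<le> 3/2"
proof -
  show "0 \<le> ternary P" unfolding ternary_def by (rule suminf_nonneg[OF ternary_summable]) auto
  have "ternary P \<le> (\<Sum>j. (1/3::real)^j)"
    unfolding ternary_def by (rule suminf_le[OF _ ternary_summable]) auto
  also have "\<dots> = 3/2" by (subst suminf_geometric) auto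
  finally show "ternary P \<le> 3/2" .
qed

text \<open>At the first index \<open>k\<close> where the digits differ, that digit contributes
  \<open>(1/3)^k\<close> to the difference and all later digits together at most half of this. So a
  differing digit at or before \<open>n\<close> keeps the values at least \<open>(1/3)^n / 2\<close>
  apart.\<close>

lemma ternary_prefix:
  assumes close: "\<bar>ternary P - ternary Q\<bar> < (1/3)^n / 2" and "j \<le> n"
  shows "P j = Q j"
proof (rule ccontr)
  assume "P j \<noteq> Q j"
  define k where "k = (LEAST k. P k \<noteq> Q k)"
  have k: "P k \<noteq> Q k" "k \<le> j" and below: "\<And>i. i < k \<Longrightarrow> P i = Q i"
    unfolding k_def using LeastI[of "\<lambda>k. P k \<noteq> Q k"] Least_le[of "\<lambda>k. P k \<noteq> Q k"] \<open>P j \<noteq> Q j\<close>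
      not_less_Least by blast+
  define a where "a j = (if P j then (1/3::real) ^ j else 0) - (if Q j then (1/3) ^ j else 0)" for j
  have sa: "summable a"
    unfolding a_def by (intro summable_diff ternary_summable)
  have "ternary P - ternary Q = (\<Sum>j. a j)"
    unfolding ternary_def a_def by (rule suminf_diff[OF ternary_summable ternary_summable])
  also have "\<dots> = (\<Sum>i. a (i + Suc k)) + (\<Sum>i<Suc k. a i)"
    by (rule suminf_split_initial_segment[OF sa])
  also have "(\<Sum>i<Suc k. a i) = a k"
    using below by (auto simp: a_def intro!: sum.neutral)
  finally have eq: "ternary P - ternary Q = (\<Sum>i. a (i + Suc k)) + a k" .
  have g: "summable (\<lambda>i. (1/3::real)^(i + Suc k))"
    by (subst summable_iff_shift) (simp add: summable_geometric)
  have le: "\<bar>a (i + Suc k)\<bar> \<le> (1/3)^(i + Suc k)" for i by (simp add: a_def)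
  have sabs: "summable (\<lambda>i. \<bar>a (i + Suc k)\<bar>)"
    by (rule summable_comparison_test'[OF g, of 0]) (use le in auto)
  have "\<bar>\<Sum>i. a (i + Suc k)\<bar> \<le> (\<Sum>i. \<bar>a (i + Suc k)\<bar>)"
    by (rule summable_rabs[OF sabs])
  also have "\<dots> \<le> (\<Sum>i. (1/3::real)^(i + Suc k))"
    by (rule suminf_le[OF le sabs g])
  also have "\<dots> = (1/3)^Suc k * (\<Sum>i. (1/3::real)^i)"
    by (subst suminf_mult[symmetric]) (auto simp: power_add algebra_simps)
  also have "\<dots> = (1/3)^k / 2" by (subst suminf_geometric) auto
  finally have "\<bar>\<Sum>i. a (i + Suc k)\<bar> \<le> (1/3)^k / 2" .
  moreover have "\<bar>a k\<bar> = (1/3)^k" using k by (auto simp: a_def)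
  ultimately have "\<bar>ternary P - ternary Q\<bar> \<ge> (1/3)^k / 2" using eq by linarith
  moreover have "(1/3::real)^k \<ge> (1/3)^n"
    by (rule power_decreasing) (use k \<open>j \<le> n\<close> in auto)
  ultimately show False using close by linarith
qed

section \<open>Small balls and continuous functions on a metric space\<close>

context Metric_space begin

text \<open>Finite nets of radius \<open>1 / Suc n\<close> for all \<open>n\<close> supply countably
  many balls. What matters later is that \<open>N\<close> depends on \<epsilon> only: finitely many
  yes-no digits then locate every point up to \<epsilon>.\<close>

lemma compact_countable_balls:
  assumes "compact_space mtopology" "M \<noteq> {}"
  obtains B :: "nat \<Rightarrow> 'a set"
  where "\<And>j. \<exists>x\<in>M. \<exists>r. B j = mball x r"
    and "\<And>\<epsilon>. \<epsilon> > 0 \<Longrightarrow> \<exists>N. \<forall>a\<in>M. \<exists>j<N. a \<in> B j \<and> (\<forall>x\<in>B j. \<forall>y\<in>B j. d x y < \<epsilon>)"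
proof -
  have "mtotally_bounded M"
    using assms(1) by (simp add: compact_space_eq_mcomplete_mtotally_bounded)
  then have "\<forall>n. \<exists>K. finite K \<and> K \<subseteq> M \<and> M \<subseteq> (\<Union>x\<in>K. mball x (1 / real (Suc n)))"
    unfolding mtotally_bounded_def by simp
  then obtain K where K: "\<And>n. finite (K n)" "\<And>n. K n \<subseteq> M"
      "\<And>n. M \<subseteq> (\<Union>x\<in>K n. mball x (1 / real (Suc n)))"
    by metis
  define \<B> where "\<B> n = (\<lambda>x. mball x (1 / real (Suc n))) ` K n" for n
  define \<C> where "\<C> = (\<Union>n. \<B> n)"
  have cC: "countable \<C>" unfolding \<C>_def \<B>_def using K(1) by (auto intro: countable_finite)
  have neC: "\<C> \<noteq> {}" unfolding \<C>_def \<B>_def using K(3)[of 0] assms(2) by auto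
  show ?thesis
  proof (rule that[of "from_nat_into \<C>"])
    fix j have "from_nat_into \<C> j \<in> \<C>" using neC by (rule from_nat_into)
    then show "\<exists>x\<in>M. \<exists>r. from_nat_into \<C> j = mball x r"
      unfolding \<C>_def \<B>_def using K(2) by fast
  next
    fix \<epsilon> :: real assume "\<epsilon> > 0"
    then obtain n where n: "1 / real (Suc n) < \<epsilon> / 2" using nat_approx_posE[of "\<epsilon>/2"] by auto
    have fin: "finite (\<B> n)" using K(1) by (simp add: \<B>_def)
    \<comment> \<open>Balls of all radii are enumerated together; \<open>N\<close> lies past the
      indices of all balls of the \<open>n\<close>-th net.\<close>
    define N where "N = Suc (Max (to_nat_on \<C> ` \<B> n))"
    have "\<exists>j<N. a \<in> from_nat_into \<C> j \<and> (\<forall>x\<in>from_nat_into \<C> j. \<forall>y\<in>from_nat_into \<C> j. d x y < \<epsilon>)"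
      if aM: "a \<in> M" for a
    proof -
      obtain x where x: "x \<in> K n" "a \<in> mball x (1 / real (Suc n))"
        using subsetD[OF K(3)[of n] aM] by blast
      define D where "D = mball x (1 / real (Suc n))"
      have DB: "D \<in> \<B> n" "D \<in> \<C>" using x unfolding D_def \<B>_def \<C>_def by auto
      have eq: "from_nat_into \<C> (to_nat_on \<C> D) = D" using cC DB by simp
      have lt: "to_nat_on \<C> D < N" unfolding N_def using fin DB by (auto simp: less_Suc_eq_le)
      have "d y z < \<epsilon>" if "y \<in> D" "z \<in> D" for y z
      proof -
        have "d y z \<le> d x y + d x z" using that triangle[of y x z] commute unfolding D_def by auto
        then show ?thesis using that n unfolding D_def by auto
      qed
      then show ?thesis using eq lt x(2) D_def by metis
    qed
    then show "\<exists>N. \<forall>a\<in>M. \<exists>j<N. a \<in> from_nat_into \<C> j \<and>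
        (\<forall>x\<in>from_nat_into \<C> j. \<forall>y\<in>from_nat_into \<C> j. d x y < \<epsilon>)" by blast
  qed
qed

text \<open>A member of the cover that contains \<open>a\<close> and has pairwise distances below
  \<open>r\<close> lies inside the ball of radius \<open>r\<close> about \<open>a\<close>. As there
  are countably many members, measurability on open sets reduces to the sets
  \<open>B j\<close>.\<close>

lemma openin_Union_balls:
  assumes cov: "\<And>\<epsilon>. \<epsilon> > 0 \<Longrightarrow> \<exists>N. \<forall>a\<in>M. \<exists>j<N::nat. a \<in> B j \<and> (\<forall>x\<in>B j. \<forall>y\<in>B j. d x y < \<epsilon>)"
    and sub: "\<And>j. B j \<subseteq> M" and "openin mtopology U"
  shows "U = (\<Union>j\<in>{j. B j \<subseteq> U}. B j)"
proof -
  have "\<exists>j. B j \<subseteq> U \<and> a \<in> B j" if "a \<in> U" for a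
  proof -
    obtain r where r: "r > 0" "mball a r \<subseteq> U" and aM: "a \<in> M"
      using assms(3) \<open>a \<in> U\<close> unfolding openin_mtopology by blast
    obtain j where j: "a \<in> B j" "\<forall>x\<in>B j. \<forall>y\<in>B j. d x y < r" using cov[OF r(1)] aM by blast
    then have "B j \<subseteq> mball a r" using sub[of j] aM by auto
    then show ?thesis using j r by blast
  qed
  then show ?thesis by blast
qed

lemma Lipschitz_continuous_map_real:
  assumes lip: "\<And>x y. x \<in> M \<Longrightarrow> y \<in> M \<Longrightarrow> \<bar>f x - f y\<bar> \<le> L * d x y"
  shows "continuous_map mtopology euclideanreal f"
proof -
  have "\<exists>U. openin mtopology U \<and> x \<in> U \<and> (\<forall>y\<in>U. f y \<in> Met_TC.mball (f x) \<epsilon>)"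
    if "x \<in> M" "\<epsilon> > 0" for x \<epsilon>
  proof (intro exI conjI ballI)
    \<comment> \<open>Dividing by \<open>\<bar>L\<bar> + 1\<close> keeps the radius positive for
      every real \<open>L\<close>, zero included.\<close>
    show "openin mtopology (mball x (\<epsilon> / (\<bar>L\<bar> + 1)))" by simp
    show "x \<in> mball x (\<epsilon> / (\<bar>L\<bar> + 1))" using that by simp
    fix y assume y: "y \<in> mball x (\<epsilon> / (\<bar>L\<bar> + 1))"
    then have "d x y * (\<bar>L\<bar> + 1) < \<epsilon>" by (simp add: field_simps)
    moreover have "L * d x y \<le> d x y * (\<bar>L\<bar> + 1)"
      by (subst mult.commute) (simp add: mult_left_mono)
    ultimately have "\<bar>f x - f y\<bar> < \<epsilon>" using lip[of x y] y by auto
    then show "f y \<in> Met_TC.mball (f x) \<epsilon>" by (simp add: dist_real_def)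
  qed
  then show ?thesis
    using Met_TC.continuous_map_to_metric[of mtopology f] by simp
qed

lemma continuous_map_mdist_fixed:
  assumes "x \<in> M" shows "continuous_map mtopology euclideanreal (d x)"
  using assms mdist_reverse_triangle commute
  by (intro Lipschitz_continuous_map_real[of _ 1]) (metis mult_1)

end

section \<open>Weak compactness of the probability measures on a compact metric space\<close>

context Metric_space begin

text \<open>A Lebesgue number of the cover by preimages of balls of radius
  \<open>\<epsilon>/2\<close> serves as \<delta>: two points closer than it lie in one
  preimage.\<close>

lemma compact_uniformly_continuous:
  assumes "compact_space mtopology" and f: "continuous_map mtopology euclideanreal f" and "\<epsilon> > 0"
  obtains \<delta> where "\<delta> > 0" "\<And>a b. a \<in> M \<Longrightarrow> b \<in> M \<Longrightarrow> d a b < \<delta> \<Longrightarrow> \<bar>f a - f b\<bar> < \<epsilon>"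
proof -
  define U where "U x = {y \<in> M. f y \<in> ball (f x) (\<epsilon>/2)}" for x
  have "openin mtopology V" if "V \<in> U ` M" for V
    using that openin_continuous_map_preimage[OF f, of "ball (f x) (\<epsilon>/2)" for x]
    unfolding U_def by (auto simp del: mem_ball)
  moreover have "M \<subseteq> \<Union>(U ` M)" unfolding U_def using \<open>\<epsilon> > 0\<close> by auto
  moreover have "compactin mtopology M" using assms(1) by (simp add: compact_space_def)
  ultimately obtain \<delta> where \<delta>: "\<delta> > 0" "\<And>a. a \<in> M \<Longrightarrow> \<exists>V\<in>U ` M. mball a \<delta> \<subseteq> V"
    using lebesgue_number[of M "U ` M"] by meson
  show ?thesis
  proof (rule that[OF \<delta>(1)])
    fix a b assume ab: "a \<in> M" "b \<in> M" "d a b < \<delta>"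
    then obtain x where "mball a \<delta> \<subseteq> U x" using \<delta>(2) by blast
    then have "a \<in> U x" "b \<in> U x" using ab \<delta>(1) by auto
    then have "\<bar>f x - f a\<bar> < \<epsilon> / 2" "\<bar>f x - f b\<bar> < \<epsilon> / 2"
      unfolding U_def by (auto simp: dist_real_def)
    then show "\<bar>f a - f b\<bar> < \<epsilon>" by linarith
  qed
qed

text \<open>
  A point is coded by the ternary number recording in which balls of a countable cover it lies.
  The coding \<open>s\<close> is only Borel, but its inverse is uniformly continuous, so it extends to a map
  \<open>c\<close> on the compact closure of the range, and every continuous \<open>f\<close> on \<open>M\<close> equals \<open>g \<circ> s\<close> for a
  bounded continuous \<open>g\<close> on the reals. Hence Helly's theorem on the reals transfers to \<open>M\<close>.
\<close>

theorem weak_sequential_compactness: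
  fixes \<mu> :: "nat \<Rightarrow> 'a measure"
  assumes cpt: "compact_space mtopology" and ne: "M \<noteq> {}"
    and \<mu>: "\<And>n. \<mu> n \<in> borel_probs mtopology"
  obtains r \<nu> where "strict_mono r" "\<nu> \<in> borel_probs mtopology" "weakly_tendsto mtopology (\<mu> \<circ> r) \<nu>"
proof -
  obtain B :: "nat \<Rightarrow> 'a set" where ball: "\<And>j. \<exists>x\<in>M. \<exists>r. B j = mball x r"
    and cov: "\<And>\<epsilon>. \<epsilon> > 0 \<Longrightarrow> \<exists>N. \<forall>a\<in>M. \<exists>j<N. a \<in> B j \<and> (\<forall>x\<in>B j. \<forall>y\<in>B j. d x y < \<epsilon>)"
    using compact_countable_balls[OF cpt ne] by blast
  have Bop: "openin mtopology (B j)" and BM: "B j \<subseteq> M" for j using ball[of j] by auto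
  define s where "s a = ternary (\<lambda>j. a \<in> B j)" for a
  define K where "K = closure (s ` M)"
  have s_meas: "s \<in> borel_measurable (borel_on mtopology)"
    unfolding s_def ternary_def
    by (intro borel_measurable_suminf measurable_If_set)
       (use BM Bop in \<open>auto simp: Int_absorb2 openin_in_borel_on\<close>)
  have s_meas': "s \<in> borel_measurable (\<mu> n)" for n
    using s_meas measurable_cong_sets[OF borel_probsD(3)[OF \<mu>] refl] by blast
  \<comment> \<open>Codes closer than \<open>(1/3)^N / 2\<close> agree in the first \<open>N\<close>
    digits, so both points lie in one ball with pairwise distances below \<epsilon>. This is uniform
    continuity of the inverse of \<open>s\<close>, and it also yields injectivity.\<close>
  have sep: "\<exists>\<delta>>0. \<forall>a\<in>M. \<forall>b\<in>M. \<bar>s a - s b\<bar> < \<delta> \<longrightarrow> d a b < \<epsilon>" if pos: "\<epsilon> > 0" for \<epsilon>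
  proof -
    obtain N where N: "\<forall>a\<in>M. \<exists>j<N. a \<in> B j \<and> (\<forall>x\<in>B j. \<forall>y\<in>B j. d x y < \<epsilon>)"
      using cov[OF pos] by blast
    have "d a b < \<epsilon>" if ab: "a \<in> M" "b \<in> M" "\<bar>s a - s b\<bar> < (1/3)^N / 2" for a b
    proof -
      obtain j where j: "j < N" "a \<in> B j" "\<forall>x\<in>B j. \<forall>y\<in>B j. d x y < \<epsilon>" using N ab by blast
      have "(a \<in> B j) = (b \<in> B j)"
        using ternary_prefix[OF ab(3)[unfolded s_def], of j] j by simp
      then show ?thesis using j by blast
    qed
    then show ?thesis by (intro exI[of _ "(1/3)^N / 2"]) auto
  qed
  have K_bd: "bounded (s ` M)"
    unfolding bounded_iff s_def using ternary_bounds by (intro exI[of _ "3/2"]) auto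
  then have K_cpt: "compact K" unfolding K_def by simp
  \<comment> \<open>\<open>c0 x a\<close> says that \<open>a\<close> is a limit of points whose
    codes tend to \<open>x\<close>; compactness of \<open>M\<close> provides one for each
    \<open>x\<close> in \<open>K\<close>. The map \<open>c\<close> selects such a limit on
    \<open>K\<close> and takes a fixed point \<open>a0\<close> elsewhere, so that it sends all reals
    into \<open>M\<close>.\<close>
  define c0 where "c0 x a \<longleftrightarrow> a \<in> M \<and> (\<exists>\<sigma>::nat\<Rightarrow>'a. range \<sigma> \<subseteq> M \<and> limitin mtopology \<sigma> a sequentially \<and>
      (\<lambda>n. s (\<sigma> n)) \<longlonglongrightarrow> x)" for x a
  have c0_ex: "\<exists>a. c0 x a" if xK: "x \<in> K" for x
  proof -
    obtain y where y: "\<And>n::nat. y n \<in> s ` M" "y \<longlonglongrightarrow> x"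
      using xK unfolding K_def closure_sequential by blast
    then have "\<forall>n. \<exists>a\<in>M. y n = s a" by blast
    then obtain \<sigma> where \<sigma>: "\<And>n. \<sigma> n \<in> M" "\<And>n. y n = s (\<sigma> n)" by metis
    then obtain a r where a: "a \<in> M" "strict_mono r" "limitin mtopology (\<sigma> \<circ> r) a sequentially"
      using cpt unfolding compact_space_sequentially by (metis image_subset_iff)
    moreover have "(\<lambda>n. s ((\<sigma> \<circ> r) n)) \<longlonglongrightarrow> x"
      using LIMSEQ_subseq_LIMSEQ[OF y(2) a(2)] \<sigma>(2) by (simp add: comp_def)
    moreover have "range (\<sigma> \<circ> r) \<subseteq> M" using \<sigma> by auto
    ultimately show ?thesis unfolding c0_def by blast
  qed
  obtain a0 where a0: "a0 \<in> M" using ne by blast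
  define c where "c x = (if x \<in> K then SOME a. c0 x a else a0)" for x
  have c_c0: "c0 x (c x)" if "x \<in> K" for x
    using someI_ex[OF c0_ex[OF that]] that by (simp add: c_def)
  then have cM: "c x \<in> M" for x using a0 by (cases "x \<in> K") (auto simp: c0_def c_def)
  have c_out: "c x = a0" if "x \<notin> K" for x using that by (simp add: c_def)
  \<comment> \<open>The function \<open>h\<close>, which is \<open>f\<close> after the inverse of
    \<open>s\<close>, is uniformly continuous on the codes. It extends to the closure
    \<open>K\<close>, and from there with a bound to the whole line by Tietze's theorem. Its values
    on \<open>K\<close> are forced by continuity along the sequences in \<open>c0\<close>.\<close>
  have extend: "\<exists>g b. continuous_on UNIV g \<and> (\<forall>x. \<bar>g x\<bar> \<le> b) \<and> (\<forall>a\<in>M. g (s a) = f a) \<and>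
      (\<forall>x\<in>K. g x = f (c x))"
    if f: "continuous_map mtopology euclideanreal f" for f :: "'a \<Rightarrow> real"
  proof -
    define h where "h x = f (SOME a. a \<in> M \<and> s a = x)" for x
    have inj: "a = b" if "a \<in> M" "b \<in> M" "s a = s b" for a b
    proof (rule ccontr)
      assume "a \<noteq> b"
      then have "d a b > 0" using that by simp
      from sep[OF this] show False using that by force
    qed
    have h: "h (s a) = f a" if "a \<in> M" for a
      unfolding h_def using someI[of "\<lambda>b. b \<in> M \<and> s b = s a" a] inj that by metis
    have "uniformly_continuous_on (s ` M) h"
      unfolding uniformly_continuous_on_def
    proof (intro allI impI)
      fix \<epsilon> :: real assume "\<epsilon> > 0"
      then obtain \<eta> where \<eta>: "\<eta> > 0" "\<And>a b. a \<in> M \<Longrightarrow> b \<in> M \<Longrightarrow> d a b < \<eta> \<Longrightarrow> \<bar>f a - f b\<bar> < \<epsilon>"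
        using compact_uniformly_continuous[OF cpt f] by metis
      obtain \<delta> where \<delta>: "\<delta> > 0" "\<forall>a\<in>M. \<forall>b\<in>M. \<bar>s a - s b\<bar> < \<delta> \<longrightarrow> d a b < \<eta>"
        using sep[OF \<eta>(1)] by blast
      show "\<exists>\<delta>>0. \<forall>x\<in>s ` M. \<forall>x'\<in>s ` M. dist x' x < \<delta> \<longrightarrow> dist (h x') (h x) < \<epsilon>"
        by (intro exI[of _ \<delta>]) (use \<delta> \<eta> h in \<open>auto simp: dist_real_def\<close>)
    qed
    then obtain g1 where g1: "uniformly_continuous_on K g1" "\<And>x. x \<in> s ` M \<Longrightarrow> h x = g1 x"
      using uniformly_continuous_on_extension_on_closure unfolding K_def by metis
    then have g1c: "continuous_on K g1" by (simp add: uniformly_continuous_imp_continuous)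
    then have "bounded (g1 ` K)" using K_cpt compact_continuous_image compact_imp_bounded by blast
    then obtain b0 where b0: "\<And>x. x \<in> K \<Longrightarrow> norm (g1 x) \<le> b0" unfolding bounded_iff by auto
    define b where "b = max b0 0"
    have "closedin (top_of_set UNIV) K" using K_cpt by (simp add: compact_imp_closed)
    moreover have "0 \<le> b" "\<And>x. x \<in> K \<Longrightarrow> norm (g1 x) \<le> b"
      using b0 by (auto simp: b_def le_max_iff_disj)
    ultimately obtain g where g: "continuous_on UNIV g" "\<And>x. x \<in> K \<Longrightarrow> g x = g1 x"
      "\<And>x. norm (g x) \<le> b"
      using Tietze[OF g1c] by (metis UNIV_I)
    have gs: "g (s a) = f a" if "a \<in> M" for a
      using g(2)[of "s a"] g1(2)[of "s a"] h[OF that] that subsetD[OF closure_subset[of "s ` M"], of "s a"]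
      unfolding K_def by auto
    have "g x = f (c x)" if x: "x \<in> K" for x
    proof -
      obtain \<sigma> where \<sigma>: "range \<sigma> \<subseteq> M" "limitin mtopology \<sigma> (c x) sequentially"
        "(\<lambda>n::nat. s (\<sigma> n)) \<longlonglongrightarrow> x" using c_c0[OF x] unfolding c0_def by blast
      have "(\<lambda>n. g (s (\<sigma> n))) \<longlonglongrightarrow> g x"
        using g(1) \<sigma>(3) by (metis UNIV_I continuous_on_tendsto_compose eventually_sequentiallyI)
      moreover have "g (s (\<sigma> n)) = f (\<sigma> n)" for n using gs \<sigma>(1) by auto
      moreover have "(\<lambda>n. f (\<sigma> n)) \<longlonglongrightarrow> f (c x)"
        using continuous_map_limit[OF f \<sigma>(2)] by (simp add: comp_def)
      ultimately show ?thesis using LIMSEQ_unique by auto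
    qed
    then show ?thesis using g gs by (intro exI[of _ g] exI[of _ b]) auto
  qed
  have c_meas: "c \<in> measurable borel (borel_on mtopology)"
  proof (rule measurable_sigma_sets[OF sets_borel_on])
    show "{U. openin mtopology U} \<subseteq> Pow (topspace mtopology)"
      using openin_subset[of mtopology] by blast
    show "c \<in> space borel \<rightarrow> topspace mtopology" using cM by simp
    have KB: "K \<in> sets borel" by (rule borel_closed[OF compact_imp_closed[OF K_cpt]])
    \<comment> \<open>The distance to the centre of \<open>B j\<close> has an extension
      \<open>g\<close> to the line, so for \<open>y\<close> in \<open>K\<close> membership of
      \<open>c y\<close> in the ball means \<open>g y < r\<close>; off \<open>K\<close> the map
      \<open>c\<close> is constant.\<close>
    have cball: "c -` B j \<in> sets borel" for j
    proof -
      obtain x r where x: "x \<in> M" "B j = mball x r" using ball by blast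
      obtain g where g: "continuous_on UNIV g" "\<forall>y\<in>K. g y = d x (c y)"
        using extend[OF continuous_map_mdist_fixed[OF x(1)]] by blast
      have gm: "g \<in> borel_measurable borel" using g(1) by (rule borel_measurable_continuous_onI)
      have "y \<in> c -` B j \<longleftrightarrow> y \<in> (K \<inter> {y. g y < r}) \<union> (if a0 \<in> B j then - K else {})" for y
        using g(2) x cM c_out[of y] a0 by (cases "y \<in> K") auto
      then have "c -` B j = (K \<inter> {y. g y < r}) \<union> (if a0 \<in> B j then - K else {})" by blast
      moreover have "{y. g y < r} \<in> sets borel"
        using gm by (auto simp: borel_measurable_iff_less)
      ultimately show ?thesis using KB by auto
    qed
    fix U assume "U \<in> {U. openin mtopology U}"
    then have U: "openin mtopology U" by simp
    define T where "T = {j. B j \<subseteq> U}"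
    have "U = (\<Union>j\<in>T. B j)" unfolding T_def by (rule openin_Union_balls[OF cov BM U])
    then have "c -` U = (\<Union>j\<in>T. c -` B j)" by (simp only: vimage_UN)
    also have "\<dots> \<in> sets borel" using cball by blast
    finally show "c -` U \<inter> space borel \<in> sets borel" by simp
  qed
  have s_bd: "-1 < s a" "s a \<le> 2" for a
    using ternary_bounds[of "\<lambda>j. a \<in> B j"] unfolding s_def by linarith+
  define m :: "nat \<Rightarrow> real measure" where "m n = distr (\<mu> n) borel s" for n
  have m_rd: "real_distribution (m n)" for n
    unfolding m_def
    by (rule prob_space.real_distribution_distr[OF borel_probsD(1)[OF \<mu>] s_meas'])
  have int_m: "(\<integral>x. g x \<partial>m n) = (\<integral>a. g (s a) \<partial>\<mu> n)" if "continuous_on UNIV g" for g :: "real \<Rightarrow> real" and n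
    unfolding m_def
    by (rule integral_distr[OF s_meas' borel_measurable_continuous_onI[OF that]])
  \<comment> \<open>Ternary values lie between \<open>0\<close> and \<open>3/2\<close>, so the one
    half-open interval \<open>{-1<..2}\<close> carries every \<open>m n\<close>.\<close>
  have "tight m"
    unfolding tight_def
  proof (intro conjI allI impI m_rd)
    fix \<epsilon> :: real assume "\<epsilon> > 0"
    have "measure (m n) {-1<..2} = 1" for n
    proof -
      interpret prob_space "\<mu> n" by (rule borel_probsD(1)[OF \<mu>])
      have "s -` {-1<..2} \<inter> space (\<mu> n) = space (\<mu> n)"
        using s_bd by auto
      then show ?thesis unfolding m_def using measure_distr[OF s_meas', of "{-1<..2}" n] prob_space
        by simp
    qed
    then show "\<exists>a b. a < b \<and> (\<forall>n. 1 - \<epsilon> < measure (m n) {a<..b})"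
      using \<open>\<epsilon> > 0\<close> by (intro exI[of _ "-1"] exI[of _ 2]) auto
  qed
  from tight_imp_convergent_subsubsequence[OF this strict_mono_id]
  obtain r R where r: "strict_mono r" "real_distribution R" "weak_conv_m (m \<circ> r) R"
    by (auto simp: id_def comp_def)
  interpret R: real_distribution R by (rule r(2))
  have conv: "(\<lambda>n. \<integral>a. g (s a) \<partial>\<mu> (r n)) \<longlonglongrightarrow> (\<integral>x. g x \<partial>R)"
    if g: "continuous_on UNIV g" "\<And>x. \<bar>g x\<bar> \<le> b" for g :: "real \<Rightarrow> real" and b
  proof -
    have "(\<lambda>n. \<integral>x. g x \<partial>(m \<circ> r) n) \<longlonglongrightarrow> (\<integral>x. g x \<partial>R)"
      by (rule weak_conv_imp_integral_bdd_continuous_conv[OF _ r(2,3)])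
         (use m_rd g in \<open>auto simp: continuous_on_eq_continuous_at\<close>)
    then show ?thesis using int_m[OF g(1)] by simp
  qed
  \<comment> \<open>The truncated distance to \<open>K\<close> is bounded and continuous and
    vanishes on all codes. Its integrals along the sequence are \<open>0\<close>, hence so is the
    one under \<open>R\<close>, and the limit law lives on the closed set \<open>K\<close>, where
    \<open>c\<close> inverts the coding in the limit.\<close>
  have AE_K: "AE x in R. x \<in> K"
  proof -
    define g where "g x = min 1 (infdist x K)" for x
    have gc: "continuous_on UNIV g" unfolding g_def by (intro continuous_intros)
    have gb: "\<bar>g x\<bar> \<le> 1" "0 \<le> g x" for x by (auto simp: g_def infdist_nonneg)
    have "g (s a) = 0" if "a \<in> M" for a
    proof -
      have "s a \<in> K" using that subsetD[OF closure_subset[of "s ` M"], of "s a"] unfolding K_def by auto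
      then show ?thesis by (simp add: g_def)
    qed
    then have "(\<integral>a. g (s a) \<partial>\<mu> (r n)) = 0" for n
      using borel_probsD(2)[OF \<mu>] by (intro integral_eq_zero_AE AE_I2) auto
    then have "(\<integral>x. g x \<partial>R) = 0" using LIMSEQ_unique[OF conv[OF gc gb(1)]] by simp
    moreover have "integrable R g"
      by (rule R.integrable_const_bound[of _ 1])
         (use gb borel_measurable_continuous_onI[OF gc] in auto)
    ultimately have "AE x in R. g x = 0"
      using integral_nonneg_eq_0_iff_AE gb(2) by (metis AE_I2)
    moreover have "x \<in> K" if "g x = 0" for x
    proof -
      have "K \<noteq> {}" unfolding K_def using ne by simp
      moreover have "infdist x K = 0" using that by (simp add: g_def min_def split: if_splits)
      ultimately show ?thesis using in_closed_iff_infdist_zero[of K x] K_cpt compact_imp_closed by blast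
    qed
    ultimately show ?thesis by auto
  qed
  define \<nu> where "\<nu> = distr R (borel_on mtopology) c"
  have c_meas': "c \<in> measurable R (borel_on mtopology)" using c_meas by simp
  have \<nu>: "\<nu> \<in> borel_probs mtopology"
    unfolding \<nu>_def borel_probs_def using R.prob_space_distr[OF c_meas'] by simp
  have "weakly_tendsto mtopology (\<mu> \<circ> r) \<nu>"
    unfolding weakly_tendsto_def
  proof (intro allI impI)
    fix f assume f: "continuous_map mtopology euclideanreal f"
    obtain g b where g: "continuous_on UNIV g" "\<And>x. \<bar>g x\<bar> \<le> b" "\<forall>a\<in>M. g (s a) = f a" "\<forall>x\<in>K. g x = f (c x)"
      using extend[OF f] by blast
    have "(\<integral>a. g (s a) \<partial>\<mu> n) = (\<integral>a. f a \<partial>\<mu> n)" for n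
      using borel_probsD(2)[OF \<mu>] g(3) by (intro Bochner_Integration.integral_cong) auto
    moreover have "(\<integral>x. g x \<partial>R) = (\<integral>x. f (c x) \<partial>R)"
    proof (rule integral_cong_AE)
      show "g \<in> borel_measurable R" using borel_measurable_continuous_onI[OF g(1)] by simp
      show "(\<lambda>x. f (c x)) \<in> borel_measurable R"
        using measurable_compose[OF c_meas' continuous_map_borel_measurable[OF f]] .
      show "AE x in R. g x = f (c x)" using AE_K g(4) by auto
    qed
    moreover have "(\<integral>x. f (c x) \<partial>R) = (\<integral>a. f a \<partial>\<nu>)"
      unfolding \<nu>_def using integral_distr[OF c_meas' continuous_map_borel_measurable[OF f]] by simp
    ultimately show "(\<lambda>n. \<integral>a. f a \<partial>(\<mu> \<circ> r) n) \<longlonglongrightarrow> (\<integral>a. f a \<partial>\<nu>)"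
      using conv[OF g(1,2)] by simp
  qed
  then show ?thesis using that r(1) \<nu> by blast
qed

end

section \<open>The Levy-Prokhorov metric\<close>

lemma borel_probs_eqI:
  assumes \<mu>: "\<mu> \<in> borel_probs X" and \<nu>: "\<nu> \<in> borel_probs X"
    and eq: "\<And>U. openin X U \<Longrightarrow> measure \<mu> U = measure \<nu> U"
  shows "\<mu> = \<nu>"
proof -
  interpret \<mu>: prob_space \<mu> by (rule borel_probsD[OF \<mu>])
  interpret \<nu>: prob_space \<nu> by (rule borel_probsD[OF \<nu>])
  show ?thesis
  proof (rule measure_eqI_generator_eq[where E = "{U. openin X U}" and \<Omega> = "topspace X"
        and A = "\<lambda>_. topspace X"])
    show "Int_stable {U. openin X U}" by (auto simp: Int_stable_def)
    show "{U. openin X U} \<subseteq> Pow (topspace X)" by (auto dest: openin_subset)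
    show "sets \<mu> = sigma_sets (topspace X) {U. openin X U}"
      "sets \<nu> = sigma_sets (topspace X) {U. openin X U}"
      by (simp_all only: borel_probsD(3)[OF \<mu>] borel_probsD(3)[OF \<nu>] sets_borel_on)
    show "emeasure \<mu> U = emeasure \<nu> U" if "U \<in> {U. openin X U}" for U
      using eq that by (simp add: \<mu>.emeasure_eq_measure \<nu>.emeasure_eq_measure)
  qed auto
qed

context Metric_space begin

definition enlarge :: "'a set \<Rightarrow> real \<Rightarrow> 'a set" where
  "enlarge B \<epsilon> = {a \<in> M. \<exists>b\<in>B. d a b < \<epsilon>}"

definition levy_prokhorov_bound :: "'a measure \<Rightarrow> 'a measure \<Rightarrow> real \<Rightarrow> bool" where
  "levy_prokhorov_bound \<mu> \<nu> \<epsilon> \<longleftrightarrow> \<epsilon> > 0 \<and> (\<forall>B\<in>sets (borel_on mtopology).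
     measure \<mu> B \<le> measure \<nu> (enlarge B \<epsilon>) + \<epsilon> \<and> measure \<nu> B \<le> measure \<mu> (enlarge B \<epsilon>) + \<epsilon>)"

definition levy_prokhorov :: "'a measure \<Rightarrow> 'a measure \<Rightarrow> real" where
  "levy_prokhorov \<mu> \<nu> = Inf {\<epsilon>. levy_prokhorov_bound \<mu> \<nu> \<epsilon>}"

lemma borel_on_subset: "B \<in> sets (borel_on mtopology) \<Longrightarrow> B \<subseteq> M"
  using sets.sets_into_space[of B "borel_on mtopology"] by simp

lemma enlarge_openin: "B \<subseteq> M \<Longrightarrow> openin mtopology (enlarge B \<epsilon>)"
proof -
  assume "B \<subseteq> M"
  then have "enlarge B \<epsilon> = (\<Union>b\<in>B. mball b \<epsilon>)"
    unfolding enlarge_def by (fastforce simp: commute)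
  then show ?thesis using openin_mball by (auto intro!: openin_Union)
qed

lemma enlarge_measurable:
  "B \<in> sets (borel_on mtopology) \<Longrightarrow> enlarge B \<epsilon> \<in> sets (borel_on mtopology)"
  by (rule openin_in_borel_on[OF enlarge_openin[OF borel_on_subset]])

lemma enlarge_mono: "\<epsilon> \<le> \<delta> \<Longrightarrow> enlarge B \<epsilon> \<subseteq> enlarge B \<delta>"
  by (force simp: enlarge_def)

lemma enlarge_enlarge: "B \<subseteq> M \<Longrightarrow> enlarge (enlarge B \<epsilon>) \<delta> \<subseteq> enlarge B (\<epsilon> + \<delta>)"
proof
  fix a assume "B \<subseteq> M" "a \<in> enlarge (enlarge B \<epsilon>) \<delta>"
  then obtain c b where "a \<in> M" "c \<in> M" "b \<in> B" "b \<in> M" "d a c < \<delta>" "d c b < \<epsilon>"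
    unfolding enlarge_def by blast
  then show "a \<in> enlarge B (\<epsilon> + \<delta>)"
    using triangle[of a c b] unfolding enlarge_def by force
qed

lemma borel_probs_measure_mono:
  assumes "\<mu> \<in> borel_probs mtopology" "A \<subseteq> B" "B \<in> sets (borel_on mtopology)"
  shows "measure \<mu> A \<le> measure \<mu> B"
proof -
  interpret prob_space \<mu> by (rule borel_probsD[OF assms(1)])
  show ?thesis using assms(2,3) borel_probsD(3)[OF assms(1)] by (intro finite_measure_mono) auto
qed

lemma levy_prokhorov_bound_mono:
  assumes "\<mu> \<in> borel_probs mtopology" "\<nu> \<in> borel_probs mtopology" "levy_prokhorov_bound \<mu> \<nu> \<epsilon>" "\<epsilon> \<le> \<delta>"
  shows "levy_prokhorov_bound \<mu> \<nu> \<delta>"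
  unfolding levy_prokhorov_bound_def
proof (intro conjI ballI)
  show "\<delta> > 0" using assms(3,4) by (simp add: levy_prokhorov_bound_def)
  fix B assume B: "B \<in> sets (borel_on mtopology)"
  have "measure \<mu> (enlarge B \<epsilon>) \<le> measure \<mu> (enlarge B \<delta>)"
    "measure \<nu> (enlarge B \<epsilon>) \<le> measure \<nu> (enlarge B \<delta>)"
    using assms B by (auto intro!: borel_probs_measure_mono enlarge_mono enlarge_measurable)
  moreover have "measure \<mu> B \<le> measure \<nu> (enlarge B \<epsilon>) + \<epsilon>"
    "measure \<nu> B \<le> measure \<mu> (enlarge B \<epsilon>) + \<epsilon>"
    using assms(3) B unfolding levy_prokhorov_bound_def by blast+
  ultimately show "measure \<mu> B \<le> measure \<nu> (enlarge B \<delta>) + \<delta>"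
    "measure \<nu> B \<le> measure \<mu> (enlarge B \<delta>) + \<delta>" using assms(4) by linarith+
qed

text \<open>Probabilities never exceed \<open>1\<close>. This keeps the real infimum in
  \<open>levy_prokhorov\<close> from being taken over the empty set.\<close>

lemma levy_prokhorov_bound_one:
  assumes "\<mu> \<in> borel_probs mtopology" "\<nu> \<in> borel_probs mtopology"
  shows "levy_prokhorov_bound \<mu> \<nu> 1"
  unfolding levy_prokhorov_bound_def
  by (auto intro!: add_increasing prob_space.prob_le_1 borel_probsD(1)[OF assms(1)]
      borel_probsD(1)[OF assms(2)])

lemma levy_prokhorov_bdd_below: "bdd_below {\<epsilon>. levy_prokhorov_bound \<mu> \<nu> \<epsilon>}"
  by (rule bdd_belowI[of _ 0]) (auto simp: levy_prokhorov_bound_def)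

lemma levy_prokhorov_le: "levy_prokhorov_bound \<mu> \<nu> \<epsilon> \<Longrightarrow> levy_prokhorov \<mu> \<nu> \<le> \<epsilon>"
  unfolding levy_prokhorov_def by (intro cInf_lower levy_prokhorov_bdd_below) simp

lemma levy_prokhorov_nonneg:
  assumes "\<mu> \<in> borel_probs mtopology" "\<nu> \<in> borel_probs mtopology"
  shows "0 \<le> levy_prokhorov \<mu> \<nu>"
  unfolding levy_prokhorov_def
proof (rule cInf_greatest)
  show "{\<epsilon>. levy_prokhorov_bound \<mu> \<nu> \<epsilon>} \<noteq> {}" using levy_prokhorov_bound_one[OF assms] by blast
qed (simp add: levy_prokhorov_bound_def)

lemma levy_prokhorov_less:
  assumes "\<mu> \<in> borel_probs mtopology" "\<nu> \<in> borel_probs mtopology" "levy_prokhorov \<mu> \<nu> < \<epsilon>"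
  shows "levy_prokhorov_bound \<mu> \<nu> \<epsilon>"
proof -
  have "{\<epsilon>. levy_prokhorov_bound \<mu> \<nu> \<epsilon>} \<noteq> {}" using levy_prokhorov_bound_one[OF assms(1,2)] by blast
  then obtain \<delta> where "levy_prokhorov_bound \<mu> \<nu> \<delta>" "\<delta> < \<epsilon>"
    using assms(3) cInf_lessD[of "{\<epsilon>. levy_prokhorov_bound \<mu> \<nu> \<epsilon>}" \<epsilon>] unfolding levy_prokhorov_def by blast
  then show ?thesis using levy_prokhorov_bound_mono[OF assms(1,2)] by auto
qed

lemma levy_prokhorov_bound_commute: "levy_prokhorov_bound \<mu> \<nu> \<epsilon> = levy_prokhorov_bound \<nu> \<mu> \<epsilon>"
  unfolding levy_prokhorov_bound_def by (simp add: conj_commute)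

lemma levy_prokhorov_commute: "levy_prokhorov \<mu> \<nu> = levy_prokhorov \<nu> \<mu>"
  unfolding levy_prokhorov_def
  by (rule arg_cong[where f = Inf], rule Collect_cong, rule levy_prokhorov_bound_commute)

text \<open>The first enlargement is open, hence Borel, so the second bound applies to it; enlarging
  twice stays within the enlargement by the sum.\<close>

lemma levy_prokhorov_bound_trans:
  assumes "\<mu> \<in> borel_probs mtopology" "\<nu> \<in> borel_probs mtopology" "\<rho> \<in> borel_probs mtopology"
    and 1: "levy_prokhorov_bound \<mu> \<nu> \<epsilon>" and 2: "levy_prokhorov_bound \<nu> \<rho> \<delta>"
  shows "levy_prokhorov_bound \<mu> \<rho> (\<epsilon> + \<delta>)"
  unfolding levy_prokhorov_bound_def
proof (intro conjI ballI)
  show "\<epsilon> + \<delta> > 0" using 1 2 by (simp add: levy_prokhorov_bound_def)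
  fix B assume B: "B \<in> sets (borel_on mtopology)"
  have "measure \<rho> (enlarge (enlarge B \<epsilon>) \<delta>) \<le> measure \<rho> (enlarge B (\<epsilon> + \<delta>))"
    "measure \<mu> (enlarge (enlarge B \<delta>) \<epsilon>) \<le> measure \<mu> (enlarge B (\<epsilon> + \<delta>))"
    using enlarge_enlarge[OF borel_on_subset[OF B], of \<epsilon> \<delta>]
      enlarge_enlarge[OF borel_on_subset[OF B], of \<delta> \<epsilon>] assms(1,3) B
    by (auto intro!: borel_probs_measure_mono enlarge_measurable simp: add.commute)
  moreover have "measure \<mu> B \<le> measure \<nu> (enlarge B \<epsilon>) + \<epsilon>"
    "measure \<nu> (enlarge B \<epsilon>) \<le> measure \<rho> (enlarge (enlarge B \<epsilon>) \<delta>) + \<delta>"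
    "measure \<rho> B \<le> measure \<nu> (enlarge B \<delta>) + \<delta>"
    "measure \<nu> (enlarge B \<delta>) \<le> measure \<mu> (enlarge (enlarge B \<delta>) \<epsilon>) + \<epsilon>"
    using 1 2 B enlarge_measurable[OF B] unfolding levy_prokhorov_bound_def by blast+
  ultimately show "measure \<mu> B \<le> measure \<rho> (enlarge B (\<epsilon> + \<delta>)) + (\<epsilon> + \<delta>)"
    "measure \<rho> B \<le> measure \<mu> (enlarge B (\<epsilon> + \<delta>)) + (\<epsilon> + \<delta>)" by linarith+
qed

lemma levy_prokhorov_triangle:
  assumes "\<mu> \<in> borel_probs mtopology" "\<nu> \<in> borel_probs mtopology" "\<rho> \<in> borel_probs mtopology"
  shows "levy_prokhorov \<mu> \<rho> \<le> levy_prokhorov \<mu> \<nu> + levy_prokhorov \<nu> \<rho>"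
proof (rule field_le_epsilon)
  fix e :: real assume "e > 0"
  then have "levy_prokhorov_bound \<mu> \<nu> (levy_prokhorov \<mu> \<nu> + e/2)" "levy_prokhorov_bound \<nu> \<rho> (levy_prokhorov \<nu> \<rho> + e/2)"
    using assms by (auto intro: levy_prokhorov_less)
  from levy_prokhorov_le[OF levy_prokhorov_bound_trans[OF assms this]]
  show "levy_prokhorov \<mu> \<rho> \<le> levy_prokhorov \<mu> \<nu> + levy_prokhorov \<nu> \<rho> + e" by simp
qed

lemma levy_prokhorov_refl:
  assumes "\<mu> \<in> borel_probs mtopology" shows "levy_prokhorov \<mu> \<mu> = 0"
proof (rule antisym[OF _ levy_prokhorov_nonneg[OF assms assms]], rule field_le_epsilon)
  fix e :: real assume "e > 0"
  have "measure \<mu> B \<le> measure \<mu> (enlarge B e) + e" if "B \<in> sets (borel_on mtopology)" for B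
  proof -
    have "B \<subseteq> enlarge B e" using borel_on_subset[OF that] \<open>e > 0\<close> unfolding enlarge_def by force
    from borel_probs_measure_mono[OF assms this enlarge_measurable[OF that]]
    show ?thesis using \<open>e > 0\<close> by simp
  qed
  then have "levy_prokhorov_bound \<mu> \<mu> e" using \<open>e > 0\<close> by (auto simp: levy_prokhorov_bound_def)
  then show "levy_prokhorov \<mu> \<mu> \<le> 0 + e" using levy_prokhorov_le by simp
qed

lemma closedin_Inter_enlarge:
  assumes "closedin mtopology C"
  shows "(\<Inter>n. enlarge C (1 / real (Suc n))) = C"
proof
  have CM: "C \<subseteq> M" using closedin_subset[OF assms] by simp
  then show "C \<subseteq> (\<Inter>n. enlarge C (1 / real (Suc n)))" unfolding enlarge_def by force
  show "(\<Inter>n. enlarge C (1 / real (Suc n))) \<subseteq> C"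
  proof
    fix a assume a: "a \<in> (\<Inter>n. enlarge C (1 / real (Suc n)))"
    show "a \<in> C"
    proof (rule ccontr)
      assume "a \<notin> C"
      moreover have "a \<in> M" using a by (auto simp: enlarge_def)
      moreover have "openin mtopology (M - C)" using assms by (simp add: closedin_def)
      ultimately obtain r where r: "r > 0" "mball a r \<subseteq> M - C" unfolding openin_mtopology by blast
      obtain n where "1 / real (Suc n) < r" using nat_approx_posE[OF r(1)] by blast
      moreover have "a \<in> enlarge C (1 / real (Suc n))" using a by blast
      then obtain b where "b \<in> C" "d a b < 1 / real (Suc n)" unfolding enlarge_def by blast
      ultimately have "b \<in> mball a r" using \<open>a \<in> M\<close> CM by auto
      then show False using r(2) \<open>b \<in> C\<close> by blast
    qed
  qed
qed

text \<open>A closed set is the intersection of its enlargements by \<open>1 / Suc n\<close>, and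
  \<nu> is continuous from above. Used in both directions, the inequality makes the two measures
  agree on closed sets, hence on all Borel sets.\<close>

lemma levy_prokhorov_zero_imp_closed_le:
  assumes \<mu>: "\<mu> \<in> borel_probs mtopology" and \<nu>: "\<nu> \<in> borel_probs mtopology"
    and 0: "levy_prokhorov \<mu> \<nu> = 0" and C: "closedin mtopology C"
  shows "measure \<mu> C \<le> measure \<nu> C"
proof -
  interpret \<nu>: prob_space \<nu> by (rule borel_probsD[OF \<nu>])
  define E where "E n = enlarge C (1 / real (Suc n))" for n
  have Cm: "C \<in> sets (borel_on mtopology)" by (rule closedin_in_borel_on[OF C])
  have "(\<lambda>n. measure \<nu> (E n)) \<longlonglongrightarrow> measure \<nu> (\<Inter>n. E n)"
  proof (rule \<nu>.finite_Lim_measure_decseq)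
    show "range E \<subseteq> sets \<nu>"
      unfolding E_def using enlarge_measurable[OF Cm] borel_probsD(3)[OF \<nu>] by auto
    show "decseq E" unfolding E_def decseq_def
      by (intro allI impI enlarge_mono) (simp add: frac_le)
  qed
  then have "(\<lambda>n. measure \<nu> (E n) + 1 / real (Suc n)) \<longlonglongrightarrow> measure \<nu> C + 0"
    unfolding E_def closedin_Inter_enlarge[OF C]
    by (intro tendsto_add LIMSEQ_inverse_real_of_nat[unfolded inverse_eq_divide])
  then have lim: "(\<lambda>n. measure \<nu> (E n) + 1 / real (Suc n)) \<longlonglongrightarrow> measure \<nu> C" by simp
  have "measure \<mu> C \<le> measure \<nu> (E n) + 1 / real (Suc n)" for n
    using levy_prokhorov_less[OF \<mu> \<nu>, of "1 / real (Suc n)"] 0 Cm unfolding levy_prokhorov_bound_def E_def by simp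
  then show ?thesis by (intro LIMSEQ_le_const[OF lim]) blast
qed

lemma levy_prokhorov_zero_imp_eq:
  assumes \<mu>: "\<mu> \<in> borel_probs mtopology" and \<nu>: "\<nu> \<in> borel_probs mtopology"
    and 0: "levy_prokhorov \<mu> \<nu> = 0"
  shows "\<mu> = \<nu>"
proof (rule borel_probs_eqI[OF \<mu> \<nu>])
  fix U assume U: "openin mtopology U"
  interpret \<mu>: prob_space \<mu> by (rule borel_probsD[OF \<mu>])
  interpret \<nu>: prob_space \<nu> by (rule borel_probsD[OF \<nu>])
  have C: "closedin mtopology (M - U)" using U by blast
  have "measure \<mu> (M - U) = measure \<nu> (M - U)"
    using levy_prokhorov_zero_imp_closed_le[OF \<mu> \<nu> 0 C] levy_prokhorov_zero_imp_closed_le[OF \<nu> \<mu> _ C] 0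
      levy_prokhorov_commute[of \<mu> \<nu>] by (intro antisym) auto
  moreover have "measure \<mu> (M - U) = 1 - measure \<mu> U" "measure \<nu> (M - U) = 1 - measure \<nu> U"
    using \<mu>.prob_compl[of U] \<nu>.prob_compl[of U] U borel_probsD[OF \<mu>] borel_probsD[OF \<nu>]
    by (auto simp: openin_in_borel_on)
  ultimately show "measure \<mu> U = measure \<nu> U" by simp
qed

text \<open>
  The enlargement of a Borel set is compared with the union of those members of a finite ball cover
  that meet the set. There are finitely many such unions, so finitely many test functions suffice.
\<close>

lemma weakly_tendsto_imp_levy_prokhorov:
  assumes cpt: "compact_space mtopology" and \<mu>: "\<And>n. \<mu> n \<in> borel_probs mtopology"
    and \<nu>: "\<nu> \<in> borel_probs mtopology" and w: "weakly_tendsto mtopology \<mu> \<nu>"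
  shows "(\<lambda>n. levy_prokhorov (\<mu> n) \<nu>) \<longlonglongrightarrow> 0"
proof (rule LIMSEQ_I)
  fix e :: real assume "e > 0"
  define \<epsilon> where "\<epsilon> = e / 4"
  have \<epsilon>: "\<epsilon> > 0" "3 * \<epsilon> < e" using \<open>e > 0\<close> by (auto simp: \<epsilon>_def)
  have "mtotally_bounded M" using cpt by (simp add: compact_space_eq_mcomplete_mtotally_bounded)
  then obtain K where K: "finite K" "K \<subseteq> M" "M \<subseteq> (\<Union>x\<in>K. mball x \<epsilon>)"
    unfolding mtotally_bounded_def using \<epsilon> by meson
  \<comment> \<open>\<open>\<phi> x\<close> is \<open>1\<close> on the ball of radius \<epsilon>
    about \<open>x\<close> and \<open>0\<close> from distance \<open>2 * \<epsilon>\<close> on. A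
    centre in \<open>J B\<close> is within \<epsilon> of \<open>B\<close>, so on \<open>M\<close>
    the function \<open>f (J B)\<close> lies between the indicators of \<open>B\<close> and of its
    enlargement by \<open>3 * \<epsilon>\<close>; hence the choice
    \<open>\<epsilon> = e / 4\<close>.\<close>
  define \<phi> where "\<phi> x a = max 0 (min 1 (2 - d x a / \<epsilon>))" for x a
  define f where "f J a = min 1 (\<Sum>x\<in>J. \<phi> x a)" for J a
  have \<phi>c: "continuous_map mtopology euclideanreal (\<phi> x)" if "x \<in> M" for x
    unfolding \<phi>_def
    by (intro continuous_intros continuous_map_mdist_fixed that) (use \<epsilon> in auto)
  have fc: "continuous_map mtopology euclideanreal (f J)" if "J \<subseteq> K" for J
    unfolding f_def using that K finite_subset
    by (intro continuous_intros \<phi>c) (auto simp: eta_contract_eq)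
  have \<phi>0: "0 \<le> \<phi> x a" for x a by (simp add: \<phi>_def)
  have f01: "0 \<le> f J a" "f J a \<le> 1" for J a by (auto simp: f_def intro!: sum_nonneg \<phi>0)
  have f1: "f J a = 1" if "J \<subseteq> K" "x \<in> J" "a \<in> mball x \<epsilon>" for J a x
  proof -
    have "\<phi> x a = 1" using that(3) \<epsilon> by (auto simp: \<phi>_def)
    moreover have "\<phi> x a \<le> (\<Sum>x\<in>J. \<phi> x a)"
      using that K finite_subset by (intro member_le_sum \<phi>0) auto
    ultimately show ?thesis by (simp add: f_def)
  qed
  have f0: "f J a = 0" if "\<And>x. x \<in> J \<Longrightarrow> d x a \<ge> 2 * \<epsilon>" for J a
  proof -
    have "\<phi> x a = 0" if "x \<in> J" for x
      using \<open>\<And>x. x \<in> J \<Longrightarrow> d x a \<ge> 2 * \<epsilon>\<close>[OF that] \<epsilon> by (auto simp: \<phi>_def field_simps)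
    then show ?thesis by (simp add: f_def)
  qed
  define J where "J B = {x \<in> K. mball x \<epsilon> \<inter> B \<noteq> {}}" for B
  have lower: "measure \<rho> B \<le> (\<integral>a. f (J B) a \<partial>\<rho>)"
    and upper: "(\<integral>a. f (J B) a \<partial>\<rho>) \<le> measure \<rho> (enlarge B (3 * \<epsilon>))"
    if \<rho>: "\<rho> \<in> borel_probs mtopology" and B: "B \<in> sets (borel_on mtopology)" for \<rho> B
  proof -
    interpret prob_space \<rho> by (rule borel_probsD[OF \<rho>])
    have JK: "J B \<subseteq> K" by (auto simp: J_def)
    have int: "integrable \<rho> (f (J B))" by (rule borel_probs_integrable[OF \<rho> cpt fc[OF JK]])
    have BM: "B \<subseteq> M" by (rule borel_on_subset[OF B])
    have Bs: "B \<in> sets \<rho>" "enlarge B (3 * \<epsilon>) \<in> sets \<rho>"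
      using B enlarge_measurable borel_probsD(3)[OF \<rho>] by auto
    have "measure \<rho> B = (\<integral>a. indicator B a \<partial>\<rho>)" using Bs by simp
    also have "\<dots> \<le> (\<integral>a. f (J B) a \<partial>\<rho>)"
    proof (rule integral_mono[OF _ int])
      show "integrable \<rho> (indicat_real B)" using Bs by (simp add: integrable_indicator_iff emeasure_eq_measure)
      fix a
      have "f (J B) a = 1" if a: "a \<in> B"
      proof -
        obtain x where "x \<in> K" "a \<in> mball x \<epsilon>" using K(3) BM a by blast
        moreover have "x \<in> J B" using calculation a by (auto simp: J_def)
        ultimately show ?thesis using f1[OF JK] by blast
      qed
      then show "indicator B a \<le> f (J B) a" using f01(1) by (auto simp: indicator_def)
    qed
    finally show "measure \<rho> B \<le> (\<integral>a. f (J B) a \<partial>\<rho>)" .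
    have "(\<integral>a. f (J B) a \<partial>\<rho>) \<le> (\<integral>a. indicator (enlarge B (3 * \<epsilon>)) a \<partial>\<rho>)"
    proof (rule integral_mono[OF int])
      show "integrable \<rho> (indicat_real (enlarge B (3 * \<epsilon>)))"
        using Bs by (simp add: integrable_indicator_iff emeasure_eq_measure)
      fix a assume "a \<in> space \<rho>"
      then have aM: "a \<in> M" using borel_probsD(2)[OF \<rho>] by simp
      have "f (J B) a = 0" if a: "a \<notin> enlarge B (3 * \<epsilon>)"
      proof (rule f0, rule ccontr)
        fix x assume x: "x \<in> J B" "\<not> 2 * \<epsilon> \<le> d x a"
        then obtain b where b: "b \<in> B" "b \<in> M" "x \<in> M" "d x b < \<epsilon>" using BM unfolding J_def by auto
        have "d a b \<le> d x a + d x b" using triangle[of a x b] b aM commute[of a x] by simp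
        then have "d a b < 3 * \<epsilon>" using x b by linarith
        then show False using a b aM by (auto simp: enlarge_def)
      qed
      then show "f (J B) a \<le> indicator (enlarge B (3 * \<epsilon>)) a"
        using f01(2) by (auto simp: indicator_def)
    qed
    also have "\<dots> = measure \<rho> (enlarge B (3 * \<epsilon>))" using Bs by simp
    finally show "(\<integral>a. f (J B) a \<partial>\<rho>) \<le> measure \<rho> (enlarge B (3 * \<epsilon>))" .
  qed
  have "\<forall>\<^sub>F n in sequentially. \<forall>L\<in>Pow K. \<bar>(\<integral>a. f L a \<partial>\<mu> n) - (\<integral>a. f L a \<partial>\<nu>)\<bar> < \<epsilon>"
  proof (rule eventually_ball_finite)
    show "finite (Pow K)" using K by simp
    show "\<forall>L\<in>Pow K. \<forall>\<^sub>F n in sequentially. \<bar>(\<integral>a. f L a \<partial>\<mu> n) - (\<integral>a. f L a \<partial>\<nu>)\<bar> < \<epsilon>"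
    proof
      fix L assume "L \<in> Pow K"
      then have "(\<lambda>n. \<integral>a. f L a \<partial>\<mu> n) \<longlonglongrightarrow> (\<integral>a. f L a \<partial>\<nu>)"
        by (intro weakly_tendstoD[OF w fc]) simp
      from tendstoD[OF this \<epsilon>(1)]
      show "\<forall>\<^sub>F n in sequentially. \<bar>(\<integral>a. f L a \<partial>\<mu> n) - (\<integral>a. f L a \<partial>\<nu>)\<bar> < \<epsilon>"
        by (simp add: dist_real_def)
    qed
  qed
  then obtain N where N: "\<And>n L. n \<ge> N \<Longrightarrow> L \<subseteq> K \<Longrightarrow> \<bar>(\<integral>a. f L a \<partial>\<mu> n) - (\<integral>a. f L a \<partial>\<nu>)\<bar> < \<epsilon>"
    unfolding eventually_sequentially by blast
  have "levy_prokhorov_bound (\<mu> n) \<nu> (3 * \<epsilon>)" if "n \<ge> N" for n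
    unfolding levy_prokhorov_bound_def
  proof (intro conjI ballI)
    show "3 * \<epsilon> > 0" using \<epsilon> by simp
    fix B assume B: "B \<in> sets (borel_on mtopology)"
    have "J B \<subseteq> K" by (auto simp: J_def)
    from N[OF that this] show "measure (\<mu> n) B \<le> measure \<nu> (enlarge B (3 * \<epsilon>)) + 3 * \<epsilon>"
      "measure \<nu> B \<le> measure (\<mu> n) (enlarge B (3 * \<epsilon>)) + 3 * \<epsilon>"
      using lower[OF \<mu>[of n] B] upper[OF \<nu> B] lower[OF \<nu> B] upper[OF \<mu>[of n] B] \<epsilon> by linarith+
  qed
  then have "\<bar>levy_prokhorov (\<mu> n) \<nu>\<bar> < e" if "n \<ge> N" for n
    using levy_prokhorov_le[of "\<mu> n" \<nu> "3 * \<epsilon>"] levy_prokhorov_nonneg[OF \<mu>[of n] \<nu>] that \<epsilon> by force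
  then show "\<exists>N. \<forall>n\<ge>N. norm (levy_prokhorov (\<mu> n) \<nu> - 0) < e" by auto
qed

text \<open>If integrals stayed away from their limit along a subsequence, weak compactness would
  give a further subsequence with a weak limit \<open>\<nu>'\<close>. By the preceding lemma
  \<open>\<nu>'\<close> is also a limit in the metric, so it equals \<nu>, a contradiction.\<close>

lemma levy_prokhorov_imp_weakly_tendsto:
  fixes \<mu> :: "nat \<Rightarrow> 'a measure"
  assumes cpt: "compact_space mtopology" and ne: "M \<noteq> {}" and \<mu>: "\<And>n. \<mu> n \<in> borel_probs mtopology"
    and \<nu>: "\<nu> \<in> borel_probs mtopology" and lim: "(\<lambda>n. levy_prokhorov (\<mu> n) \<nu>) \<longlonglongrightarrow> 0"
  shows "weakly_tendsto mtopology \<mu> \<nu>"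
  unfolding weakly_tendsto_def
proof (intro allI impI, rule ccontr)
  fix f assume f: "continuous_map mtopology euclideanreal f"
  assume "\<not> (\<lambda>n. \<integral>x. f x \<partial>\<mu> n) \<longlonglongrightarrow> (\<integral>x. f x \<partial>\<nu>)"
  then obtain \<epsilon> where \<epsilon>: "\<epsilon> > 0"
    "\<not> (\<forall>\<^sub>F n in sequentially. dist (\<integral>x. f x \<partial>\<mu> n) (\<integral>x. f x \<partial>\<nu>) < \<epsilon>)"
    unfolding tendsto_iff by blast
  define S where "S = {n. \<not> dist (\<integral>x. f x \<partial>\<mu> n) (\<integral>x. f x \<partial>\<nu>) < \<epsilon>}"
  have "infinite S"
    unfolding infinite_nat_iff_unbounded_le using \<epsilon>(2) unfolding eventually_sequentially S_def by auto
  then obtain r :: "nat \<Rightarrow> nat" where r: "strict_mono r" "\<And>n. r n \<in> S"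
    using infinite_enumerate by blast
  obtain q \<nu>' where q: "strict_mono q" "\<nu>' \<in> borel_probs mtopology"
    "weakly_tendsto mtopology ((\<mu> \<circ> r) \<circ> q) \<nu>'"
    using weak_sequential_compactness[OF cpt ne, of "\<mu> \<circ> r"] \<mu> by auto
  have lim': "(\<lambda>n. levy_prokhorov (\<mu> (r (q n))) \<nu>') \<longlonglongrightarrow> 0"
    using weakly_tendsto_imp_levy_prokhorov[OF cpt _ q(2,3)] \<mu> by (simp add: comp_def)
  have "strict_mono (r \<circ> q)" using r(1) q(1) by (rule strict_mono_o)
  from LIMSEQ_subseq_LIMSEQ[OF lim this]
  have "(\<lambda>n. levy_prokhorov (\<mu> (r (q n))) \<nu>) \<longlonglongrightarrow> 0" by (simp add: comp_def)
  from tendsto_add[OF lim' this]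
  have "(\<lambda>n. levy_prokhorov (\<mu> (r (q n))) \<nu>' + levy_prokhorov (\<mu> (r (q n))) \<nu>) \<longlonglongrightarrow> 0" by simp
  moreover have "levy_prokhorov \<nu>' \<nu> \<le> levy_prokhorov (\<mu> (r (q n))) \<nu>' + levy_prokhorov (\<mu> (r (q n))) \<nu>" for n
    using levy_prokhorov_triangle[OF q(2) \<mu> \<nu>, of "r (q n)"] levy_prokhorov_commute[of \<nu>'] by simp
  ultimately have "levy_prokhorov \<nu>' \<nu> \<le> 0" by (intro LIMSEQ_le_const) auto
  then have "levy_prokhorov \<nu>' \<nu> = 0" using levy_prokhorov_nonneg[OF q(2) \<nu>] by simp
  then have "\<nu>' = \<nu>" by (rule levy_prokhorov_zero_imp_eq[OF q(2) \<nu>])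
  then have "(\<lambda>n. \<integral>x. f x \<partial>\<mu> (r (q n))) \<longlonglongrightarrow> (\<integral>x. f x \<partial>\<nu>)"
    using weakly_tendstoD[OF q(3) f] by simp
  from tendstoD[OF this \<epsilon>(1)]
  obtain n where "dist (\<integral>x. f x \<partial>\<mu> (r (q n))) (\<integral>x. f x \<partial>\<nu>) < \<epsilon>"
    unfolding eventually_sequentially by blast
  then show False using r(2)[of "q n"] by (simp add: S_def)
qed

text \<open>The hat functions \<open>max 0 (\<delta> - d x a)\<close> around a finite net have a
  positive sum on \<open>M\<close>, by which they are divided.\<close>

lemma compact_partition_of_unity:
  assumes cpt: "compact_space mtopology" and "\<delta> > 0"
  obtains K \<phi> where "finite K" "K \<subseteq> M" "\<And>x. x \<in> K \<Longrightarrow> continuous_map mtopology euclideanreal (\<phi> x)"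
    "\<And>x a. x \<in> K \<Longrightarrow> a \<in> M \<Longrightarrow> 0 \<le> \<phi> x a"
    "\<And>x a. \<phi> x a \<noteq> 0 \<Longrightarrow> d x a < \<delta>"
    "\<And>a. a \<in> M \<Longrightarrow> (\<Sum>x\<in>K. \<phi> x a) = 1"
proof -
  have "mtotally_bounded M" using cpt by (simp add: compact_space_eq_mcomplete_mtotally_bounded)
  then obtain K where K: "finite K" "K \<subseteq> M" "M \<subseteq> (\<Union>x\<in>K. mball x \<delta>)"
    unfolding mtotally_bounded_def using \<open>\<delta> > 0\<close> by meson
  define \<psi> where "\<psi> x a = max 0 (\<delta> - d x a)" for x a
  define S where "S a = (\<Sum>x\<in>K. \<psi> x a)" for a
  have \<psi>0: "\<psi> x a \<ge> 0" for x a by (simp add: \<psi>_def)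
  have S: "S a > 0" if aM: "a \<in> M" for a
  proof -
    obtain x where x: "x \<in> K" "a \<in> mball x \<delta>" using subsetD[OF K(3) aM] by blast
    then have "0 < \<psi> x a" by (simp add: \<psi>_def)
    also have "\<dots> \<le> S a" unfolding S_def using K(1) x(1) \<psi>0 by (intro member_le_sum) auto
    finally show ?thesis .
  qed
  have \<psi>c: "continuous_map mtopology euclideanreal (\<psi> x)" if "x \<in> K" for x
    unfolding \<psi>_def using that K(2) by (intro continuous_intros continuous_map_mdist_fixed) auto
  have Sc: "continuous_map mtopology euclideanreal S"
    unfolding S_def using K(1) by (intro continuous_map_sum \<psi>c)
  show ?thesis
  proof (rule that[of K "\<lambda>x a. \<psi> x a / S a"])
    show "continuous_map mtopology euclideanreal (\<lambda>a. \<psi> x a / S a)" if "x \<in> K" for x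
      using S by (intro continuous_map_real_divide \<psi>c Sc that) force
    show "0 \<le> \<psi> x a / S a" if "x \<in> K" "a \<in> M" for x a
      using \<psi>0[of x a] S[OF that(2)] by simp
    show "d x a < \<delta>" if "\<psi> x a / S a \<noteq> 0" for x a
      using that by (auto simp: \<psi>_def max_def split: if_splits)
    show "(\<Sum>x\<in>K. \<psi> x a / S a) = 1" if "a \<in> M" for a
      using S[OF that] by (simp add: sum_divide_distrib[symmetric] S_def[symmetric])
  qed (use K in auto)
qed

end

lemma (in prob_space) integral_close:
  fixes f g :: "'a \<Rightarrow> real"
  assumes "integrable M f" "integrable M g" "\<And>x. x \<in> space M \<Longrightarrow> \<bar>f x - g x\<bar> \<le> e"
  shows "\<bar>(\<integral>x. f x \<partial>M) - (\<integral>x. g x \<partial>M)\<bar> \<le> e"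
proof -
  have "(\<integral>x. f x \<partial>M) - (\<integral>x. g x \<partial>M) = (\<integral>x. f x - g x \<partial>M)"
    using assms by simp
  also have "\<bar>\<dots>\<bar> \<le> (\<integral>x. \<bar>f x - g x\<bar> \<partial>M)" by (rule integral_abs_bound)
  also have "\<dots> \<le> e" using assms by (intro integral_le_const) auto
  finally show ?thesis .
qed

text \<open>A three-term estimate: the error of \<open>g\<close> is uniform in \<open>n\<close>, and
  three errors of size \<open>e/4\<close> stay below \<open>e\<close>.\<close>

lemma tendsto_of_approx:
  fixes f :: "nat \<Rightarrow> real"
  assumes "\<And>e. e > 0 \<Longrightarrow> \<exists>g m. (\<forall>n. \<bar>f n - g n\<bar> \<le> e) \<and> \<bar>l - m\<bar> \<le> e \<and> g \<longlonglongrightarrow> m"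
  shows "f \<longlonglongrightarrow> l"
proof (rule tendstoI)
  fix e :: real assume "e > 0"
  then obtain g m where g: "\<And>n. \<bar>f n - g n\<bar> \<le> e/4" "\<bar>l - m\<bar> \<le> e/4" "g \<longlonglongrightarrow> m"
    using assms[of "e/4"] by auto
  have "\<forall>\<^sub>F n in sequentially. dist (g n) m < e/4" using g(3) \<open>e > 0\<close> by (intro tendstoD) auto
  then show "\<forall>\<^sub>F n in sequentially. dist (f n) l < e"
  proof eventually_elim
    case (elim n)
    then show ?case using g(1)[of n] g(2) \<open>e > 0\<close> unfolding dist_real_def by linarith
  qed
qed

section \<open>Outcomes and profiles of a strategic form game\<close>

context strategic_form_game begin

lemma topspace_action [simp]: "topspace (action_topology i) = A i"
  unfolding action_topology_def by (rule Metric_space.topspace_mtopology[OF actions_metric])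

lemma compact_action: "compact_space (action_topology i)"
  unfolding action_topology_def by (rule actions_compact)

lemma outcomes_iff: "a \<in> outcomes \<longleftrightarrow> (\<forall>i. a i \<in> A i)"
  by (simp add: outcomes_def PiE_UNIV_domain Pi_iff)

lemma outcomes_nonempty: "outcomes \<noteq> {}"
  using actions_nonempty unfolding outcomes_def by (simp add: PiE_eq_empty_iff)

lemma outcome_dist_less: "outcome_dist a b < r \<longleftrightarrow> (\<forall>i. d i (a i) (b i) < r)"
  unfolding outcome_dist_def by (subst Max_less_iff) auto

lemma outcome_dist_ge: "d i (a i) (b i) \<le> outcome_dist a b"
  unfolding outcome_dist_def by (intro Max_ge) auto

lemma outcome_dist_le: "(\<And>i. d i (a i) (b i) \<le> r) \<Longrightarrow> outcome_dist a b \<le> r"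
  unfolding outcome_dist_def by (subst Max_le_iff) auto

lemma outcome_metric: "Metric_space outcomes outcome_dist"
proof
  fix a b c
  show "0 \<le> outcome_dist a b"
    using outcome_dist_ge Metric_space.nonneg[OF actions_metric] by (rule order_trans[rotated])
  show "outcome_dist a b = outcome_dist b a"
    unfolding outcome_dist_def by (simp add: Metric_space.commute[OF actions_metric])
  show "outcome_dist a b = 0 \<longleftrightarrow> a = b" if "a \<in> outcomes" "b \<in> outcomes"
  proof
    assume 0: "outcome_dist a b = 0"
    have "d i (a i) (b i) = 0" for i
      using outcome_dist_ge[of i a b] Metric_space.nonneg[OF actions_metric[of i], of "a i" "b i"] 0 by simp
    then show "a = b" using that Metric_space.zero[OF actions_metric] by (auto simp: outcomes_iff)
  next
    assume "a = b"
    moreover have "d i (b i) (b i) = 0" for i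
      using that Metric_space.mdist_zero[OF actions_metric] by (simp add: outcomes_iff)
    ultimately show "outcome_dist a b = 0" by (simp add: outcome_dist_def)
  qed
  show "outcome_dist a c \<le> outcome_dist a b + outcome_dist b c"
    if "a \<in> outcomes" "b \<in> outcomes" "c \<in> outcomes"
  proof (rule outcome_dist_le)
    fix i
    have "d i (a i) (c i) \<le> d i (a i) (b i) + d i (b i) (c i)"
      using that by (intro Metric_space.triangle[OF actions_metric]) (auto simp: outcomes_iff)
    then show "d i (a i) (c i) \<le> outcome_dist a b + outcome_dist b c"
      using outcome_dist_ge[of i a b] outcome_dist_ge[of i b c] by linarith
  qed
qed

sublocale outcome: Metric_space outcomes outcome_dist by (rule outcome_metric)

lemma outcome_ball_eq:
  "a \<in> outcomes \<Longrightarrow> outcome.mball a r = (\<Pi>\<^sub>E i\<in>UNIV. Metric_space.mball (A i) (d i) (a i) r)"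
  by (auto simp: outcome_dist_less outcomes_iff PiE_iff Metric_space.in_mball[OF actions_metric])

text \<open>Balls of the maximum metric are boxes of balls of equal radius. Conversely, as there are
  finitely many players, the minimum of the radii is positive and puts such a ball inside any open
  box around a given point.\<close>

lemma outcome_mtopology: "outcome.mtopology = outcome_topology"
proof (rule topology_eq[THEN iffD2], intro allI iffI)
  fix S assume S: "openin outcome.mtopology S"
  show "openin outcome_topology S"
    unfolding outcome_topology_def openin_product_topology_alt
  proof (intro ballI)
    fix x assume "x \<in> S"
    then obtain r where r: "r > 0" "outcome.mball x r \<subseteq> S" and x: "x \<in> outcomes"
      using S unfolding outcome.openin_mtopology by blast
    define U where "U i = Metric_space.mball (A i) (d i) (x i) r" for i
    have eq: "Pi\<^sub>E UNIV U = outcome.mball x r" unfolding U_def by (rule outcome_ball_eq[OF x, symmetric])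
    have "x \<in> outcome.mball x r" using r x by simp
    moreover have "openin (action_topology i) (U i)" for i
      unfolding action_topology_def U_def by (rule Metric_space.openin_mball[OF actions_metric])
    ultimately show "\<exists>U. finite {i \<in> UNIV. U i \<noteq> topspace (action_topology i)} \<and>
        (\<forall>i\<in>UNIV. openin (action_topology i) (U i)) \<and> x \<in> Pi\<^sub>E UNIV U \<and> Pi\<^sub>E UNIV U \<subseteq> S"
      using r eq by (intro exI[of _ U] conjI) simp_all
  qed
next
  fix S assume S: "openin outcome_topology S"
  show "openin outcome.mtopology S"
    unfolding outcome.openin_mtopology
  proof (intro conjI allI impI)
    show "S \<subseteq> outcomes"
      using openin_subset[OF S] by (simp add: outcome_topology_def outcomes_def)
    fix x assume xS: "x \<in> S"
    then obtain U where U: "\<And>i. openin (action_topology i) (U i)" "x \<in> Pi\<^sub>E UNIV U" "Pi\<^sub>E UNIV U \<subseteq> S"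
      using S[unfolded outcome_topology_def openin_product_topology_alt, rule_format, OF xS] by blast
    have "\<exists>r>0. Metric_space.mball (A i) (d i) (x i) r \<subseteq> U i" for i
      using U(1)[of i] U(2) unfolding action_topology_def Metric_space.openin_mtopology[OF actions_metric]
      by (auto simp: PiE_iff)
    then obtain r where r: "\<And>i. r i > 0" "\<And>i. Metric_space.mball (A i) (d i) (x i) (r i) \<subseteq> U i"
      by metis
    define r0 where "r0 = Min (range r)"
    have r0: "r0 > 0" "\<And>i. r0 \<le> r i" using r(1) by (auto simp: r0_def)
    have x: "x \<in> outcomes" using xS \<open>S \<subseteq> outcomes\<close> by blast
    have "Metric_space.mball (A i) (d i) (x i) r0 \<subseteq> U i" for i
      using Metric_space.mball_subset_concentric[OF actions_metric r0(2)] r(2) by blast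
    then have "outcome.mball x r0 \<subseteq> Pi\<^sub>E UNIV U"
      unfolding outcome_ball_eq[OF x] by (intro PiE_mono) auto
    then show "\<exists>r>0. outcome.mball x r \<subseteq> S" using r0(1) U(3) by blast
  qed
qed

lemma compact_outcome: "compact_space outcome.mtopology"
  unfolding outcome_mtopology outcome_topology_def
  by (simp add: compact_space_product_topology compact_action)

lemma continuous_map_outcome_component: "continuous_map outcome.mtopology (action_topology i) (\<lambda>a. a i)"
  unfolding outcome_mtopology outcome_topology_def
  by (rule continuous_map_product_projection) simp

lemma continuous_payoff: "continuous_map outcome.mtopology euclideanreal (u j)"
  unfolding outcome_mtopology outcome_topology_def action_topology_def by (rule payoff_continuous)

lemma strategies_eq: "strategies i = borel_probs (action_topology i)"
  unfolding strategies_def borel_probs_def by simp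

lemma profiles_iff: "\<sigma> \<in> profiles \<longleftrightarrow> (\<forall>i. \<sigma> i \<in> strategies i)"
  by (simp add: profiles_def PiE_UNIV_domain Pi_iff)

lemma profile_strategy: "\<sigma> \<in> profiles \<Longrightarrow> \<sigma> i \<in> strategies i"
  by (simp add: profiles_iff)

lemma strategies_prob: "\<mu> \<in> strategies i \<Longrightarrow> prob_space \<mu>"
  by (simp add: strategies_def)

lemma profile_prob: "\<sigma> \<in> profiles \<Longrightarrow> prob_space (\<sigma> i)"
  by (simp add: profiles_iff strategies_def)

lemma profile_product: "\<sigma> \<in> profiles \<Longrightarrow> product_prob_space \<sigma>"
  by (intro product_prob_spaceI profile_prob)

lemma action_ball_sets:
  "Metric_space.mball (A i) (d i) x r \<in> sets (borel_on (action_topology i))"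
  unfolding action_topology_def by (intro openin_in_borel_on Metric_space.openin_mball[OF actions_metric])

lemma space_PiM_profile: "\<sigma> \<in> profiles \<Longrightarrow> space (PiM UNIV \<sigma>) = outcomes"
  by (simp add: space_PiM profiles_iff strategies_def outcomes_def)

text \<open>Continuity of the projections gives one inclusion. The other rests on a countable base:
  an open set of outcomes is a countable union of balls of the maximum metric, and these are
  measurable boxes.\<close>

lemma sets_PiM_profile:
  assumes \<sigma>: "\<sigma> \<in> profiles"
  shows "sets (PiM UNIV \<sigma>) = sets (borel_on outcome.mtopology)"
proof
  have sp: "space (\<sigma> i) = A i" and se: "sets (\<sigma> i) = sets (borel_on (action_topology i))" for i
    using \<sigma> by (auto simp: profiles_iff strategies_def)
  have space: "space (PiM UNIV \<sigma>) = outcomes" by (rule space_PiM_profile[OF \<sigma>])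
  have "(\<lambda>a i. a i) \<in> measurable (borel_on outcome.mtopology) (PiM UNIV \<sigma>)"
  proof (rule measurable_PiM_single')
    show "(\<lambda>a i. a i) \<in> space (borel_on outcome.mtopology) \<rightarrow> (\<Pi>\<^sub>E i\<in>UNIV. space (\<sigma> i))"
      by (simp add: sp outcomes_def[symmetric])
    fix i
    have "(\<lambda>a. a i) \<in> measurable (borel_on outcome.mtopology) (borel_on (action_topology i))"
    proof (rule measurable_sigma_sets[OF sets_borel_on])
      show "{U. openin (action_topology i) U} \<subseteq> Pow (topspace (action_topology i))"
        using openin_subset by blast
      show "(\<lambda>a. a i) \<in> space (borel_on outcome.mtopology) \<rightarrow> topspace (action_topology i)"
        by (auto simp: outcomes_iff)
      fix U assume "U \<in> {U. openin (action_topology i) U}"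
      then have "openin outcome.mtopology {a \<in> topspace outcome.mtopology. a i \<in> U}"
        using openin_continuous_map_preimage[OF continuous_map_outcome_component] by simp
      then have "{a \<in> topspace outcome.mtopology. a i \<in> U} \<in> sets (borel_on outcome.mtopology)"
        by (rule openin_in_borel_on)
      also have "{a \<in> topspace outcome.mtopology. a i \<in> U} = (\<lambda>a. a i) -` U \<inter> space (borel_on outcome.mtopology)"
        by auto
      finally show "(\<lambda>a. a i) -` U \<inter> space (borel_on outcome.mtopology) \<in> sets (borel_on outcome.mtopology)" .
    qed
    then show "(\<lambda>a. a i) \<in> measurable (borel_on outcome.mtopology) (\<sigma> i)"
      using measurable_cong_sets[OF refl se] by blast
  qed
  then have id: "(\<lambda>a. a) \<in> measurable (borel_on outcome.mtopology) (PiM UNIV \<sigma>)" by simp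
  show "sets (PiM UNIV \<sigma>) \<subseteq> sets (borel_on outcome.mtopology)"
  proof
    fix E assume E: "E \<in> sets (PiM UNIV \<sigma>)"
    then have "E \<subseteq> outcomes" using sets.sets_into_space space by blast
    then show "E \<in> sets (borel_on outcome.mtopology)"
      using measurable_sets[OF id E] by (simp add: Int_absorb2)
  qed
  obtain B :: "nat \<Rightarrow> _" where ball: "\<And>j. \<exists>x\<in>outcomes. \<exists>r. B j = outcome.mball x r"
    and cov: "\<And>\<epsilon>. \<epsilon> > 0 \<Longrightarrow> \<exists>N. \<forall>a\<in>outcomes. \<exists>j<N. a \<in> B j \<and>
      (\<forall>x\<in>B j. \<forall>y\<in>B j. outcome_dist x y < \<epsilon>)"
    using outcome.compact_countable_balls[OF compact_outcome outcomes_nonempty] by blast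
  have BM: "B j \<subseteq> outcomes" for j using ball[of j] by auto
  have Bs: "B j \<in> sets (PiM UNIV \<sigma>)" for j
  proof -
    obtain x r where x: "x \<in> outcomes" "B j = outcome.mball x r" using ball by blast
    show ?thesis unfolding x(2) outcome_ball_eq[OF x(1)]
      by (rule sets_PiM_I_finite) (auto simp: se action_ball_sets)
  qed
  have "U \<in> sets (PiM UNIV \<sigma>)" if U: "openin outcome.mtopology U" for U
  proof -
    define T where "T = {j. B j \<subseteq> U}"
    have eq: "U = (\<Union>j\<in>T. B j)" unfolding T_def by (rule outcome.openin_Union_balls[OF cov BM U])
    show ?thesis by (subst eq) (use Bs in blast)
  qed
  then show "sets (borel_on outcome.mtopology) \<subseteq> sets (PiM UNIV \<sigma>)"
    unfolding sets_borel_on using sets.sigma_sets_subset[of "{U. openin outcome.mtopology U}" "PiM UNIV \<sigma>"]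
    by (auto simp: space)
qed

lemma PiM_borel_probs: "\<sigma> \<in> profiles \<Longrightarrow> PiM UNIV \<sigma> \<in> borel_probs outcome.mtopology"
  unfolding borel_probs_def
  by (auto intro!: prob_space_PiM profile_prob sets_PiM_profile space_PiM_profile)

text \<open>An infimum in the extended reals is below \<epsilon> iff some member is, also over the
  empty set, so the two notions of enlargement coincide.\<close>

lemma prohorov_eq_levy_prokhorov:
  assumes "\<sigma> \<in> profiles" "\<tau> \<in> profiles"
  shows "prohorov \<sigma> \<tau> = outcome.levy_prokhorov (PiM UNIV \<sigma>) (PiM UNIV \<tau>)"
proof -
  have "enlargement B \<epsilon> = outcome.enlarge B \<epsilon>" for B \<epsilon>
    unfolding enlargement_def outcome.enlarge_def by (auto simp: INF_less_iff)
  then show ?thesis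
    unfolding prohorov_def outcome.levy_prokhorov_def outcome.levy_prokhorov_bound_def using assms
    by (simp add: outcome_mtopology)
qed

section \<open>Weak convergence of products and the Prohorov topology on profiles\<close>

lemma profileD: "\<sigma> \<in> profiles \<Longrightarrow> \<sigma> i \<in> borel_probs (action_topology i)"
  by (simp add: profiles_iff strategies_eq)

lemma integrable_action:
  "\<mu> \<in> strategies i \<Longrightarrow> continuous_map (action_topology i) euclideanreal f \<Longrightarrow> integrable \<mu> f"
  unfolding strategies_eq by (rule borel_probs_integrable[OF _ compact_action])

text \<open>\<open>F\<close> is uniformly within \<open>e\<close> of a finite sum \<open>G\<close>
  of products of functions of one coordinate each. Under a product measure the integral of such a
  product factorizes, so it converges together with the marginals.\<close>

lemma weakly_tendsto_product:
  assumes \<sigma>: "\<And>n. \<sigma> n \<in> profiles" and \<tau>: "\<tau> \<in> profiles"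
    and w: "\<And>i. weakly_tendsto (action_topology i) (\<lambda>n. \<sigma> n i) (\<tau> i)"
  shows "weakly_tendsto outcome.mtopology (\<lambda>n. PiM UNIV (\<sigma> n)) (PiM UNIV \<tau>)"
  unfolding weakly_tendsto_def
proof (intro allI impI, rule tendsto_of_approx)
  fix F and e :: real
  assume F: "continuous_map outcome.mtopology euclideanreal F" and e: "e > 0"
  obtain \<delta> where \<delta>: "\<delta> > 0"
    "\<And>a b. a \<in> outcomes \<Longrightarrow> b \<in> outcomes \<Longrightarrow> outcome_dist a b < \<delta> \<Longrightarrow> \<bar>F a - F b\<bar> < e"
    using outcome.compact_uniformly_continuous[OF compact_outcome F e] by blast
  have "\<exists>K \<phi>. finite K \<and> K \<subseteq> A i \<and> (\<forall>x\<in>K. continuous_map (action_topology i) euclideanreal (\<phi> x)) \<and>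
      (\<forall>x\<in>K. \<forall>a\<in>A i. 0 \<le> \<phi> x a) \<and> (\<forall>x a. \<phi> x a \<noteq> 0 \<longrightarrow> d i x a < \<delta>) \<and>
      (\<forall>a\<in>A i. (\<Sum>x\<in>K. \<phi> x a) = 1)" for i
    using Metric_space.compact_partition_of_unity[OF actions_metric actions_compact \<delta>(1), of i]
    unfolding action_topology_def by metis
  then obtain K \<phi> where K: "\<And>i. finite (K i)" "\<And>i. K i \<subseteq> A i"
    and \<phi>c: "\<And>i x. x \<in> K i \<Longrightarrow> continuous_map (action_topology i) euclideanreal (\<phi> i x)"
    and \<phi>0: "\<And>i x a. x \<in> K i \<Longrightarrow> a \<in> A i \<Longrightarrow> 0 \<le> \<phi> i x a"
    and \<phi>d: "\<And>i x a. \<phi> i x a \<noteq> 0 \<Longrightarrow> d i x a < \<delta>"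
    and \<phi>1: "\<And>i a. a \<in> A i \<Longrightarrow> (\<Sum>x\<in>K i. \<phi> i x a) = 1"
    by metis
  define P where "P = Pi\<^sub>E UNIV K"
  have PK: "finite P" "\<And>g i. g \<in> P \<Longrightarrow> g i \<in> K i" "P \<subseteq> outcomes"
    unfolding P_def using K(1) subsetD[OF K(2)] by (auto intro!: finite_PiE simp: PiE_iff outcomes_iff)
  \<comment> \<open>\<open>G\<close> interpolates \<open>F\<close> from its values at the grid
    points \<open>g\<close>. The products are weights with sum \<open>1\<close>, and a nonzero
    weight forces every coordinate of \<open>g\<close> to be within \<delta> of that of
    \<open>a\<close>, hence \<open>\<bar>F g - F a\<bar> < e\<close>.\<close>
  define G where "G a = (\<Sum>g\<in>P. F g * (\<Prod>i\<in>UNIV. \<phi> i (g i) (a i)))" for a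
  have close: "\<bar>F a - G a\<bar> \<le> e" if a: "a \<in> outcomes" for a
  proof -
    define p where "p g = (\<Prod>i\<in>UNIV. \<phi> i (g i) (a i))" for g
    have aA: "a i \<in> A i" for i using a by (simp add: outcomes_iff)
    have p0: "0 \<le> p g" if "g \<in> P" for g
      unfolding p_def using PK(2)[OF that] by (intro prod_nonneg \<phi>0 aA) auto
    have "(\<Sum>g\<in>P. p g) = (\<Prod>i\<in>UNIV. \<Sum>x\<in>K i. \<phi> i x (a i))"
      unfolding P_def p_def using K(1) by (subst prod_sum_PiE) auto
    also have "\<dots> = 1" using \<phi>1[OF aA] by simp
    finally have p1: "(\<Sum>g\<in>P. p g) = 1" .
    have "F a - G a = (\<Sum>g\<in>P. (F a - F g) * p g)"
      unfolding G_def p_def[symmetric]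
      by (simp add: left_diff_distrib sum_subtractf sum_distrib_left[symmetric] p1)
    also have "\<bar>\<dots>\<bar> \<le> (\<Sum>g\<in>P. e * p g)"
    proof (rule order_trans[OF sum_abs sum_mono])
      fix g assume g: "g \<in> P"
      show "\<bar>(F a - F g) * p g\<bar> \<le> e * p g"
      proof (cases "p g = 0")
        case False
        then have "\<phi> i (g i) (a i) \<noteq> 0" for i unfolding p_def by auto
        then have "outcome_dist g a < \<delta>" using \<phi>d by (simp add: outcome_dist_less)
        then have "\<bar>F g - F a\<bar> < e" using \<delta>(2) a g PK(3) by blast
        then show ?thesis using p0[OF g] by (simp add: abs_mult mult_right_mono)
      qed simp
    qed
    also have "\<dots> = e" using p1 by (simp add: sum_distrib_left[symmetric])
    finally show ?thesis .
  qed
  have intG: "integrable (PiM UNIV \<rho>) G \<and>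
      (\<integral>a. G a \<partial>PiM UNIV \<rho>) = (\<Sum>g\<in>P. F g * (\<Prod>i\<in>UNIV. \<integral>x. \<phi> i (g i) x \<partial>\<rho> i))"
    if \<rho>: "\<rho> \<in> profiles" for \<rho>
  proof -
    interpret product_prob_space \<rho> by (rule profile_product[OF \<rho>])
    have i: "integrable (\<rho> i) (\<phi> i (g i))" if "g \<in> P" for g i
      using \<rho> by (intro integrable_action[OF _ \<phi>c[OF PK(2)[OF that]]]) (simp add: profiles_iff)
    have ip: "integrable (PiM UNIV \<rho>) (\<lambda>a. F g * (\<Prod>i\<in>UNIV. \<phi> i (g i) (a i)))" if "g \<in> P" for g
      by (intro integrable_mult_right product_integrable_prod i that finite)
    have "(\<integral>a. G a \<partial>PiM UNIV \<rho>) = (\<Sum>g\<in>P. \<integral>a. F g * (\<Prod>i\<in>UNIV. \<phi> i (g i) (a i)) \<partial>PiM UNIV \<rho>)"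
      unfolding G_def by (intro Bochner_Integration.integral_sum ip)
    also have "\<dots> = (\<Sum>g\<in>P. F g * (\<Prod>i\<in>UNIV. \<integral>x. \<phi> i (g i) x \<partial>\<rho> i))"
    proof (intro sum.cong refl)
      fix g assume "g \<in> P"
      then have "(\<integral>a. (\<Prod>i\<in>UNIV. \<phi> i (g i) (a i)) \<partial>PiM UNIV \<rho>) = (\<Prod>i\<in>UNIV. \<integral>x. \<phi> i (g i) x \<partial>\<rho> i)"
        by (intro product_integral_prod finite i)
      then show "(\<integral>a. F g * (\<Prod>i\<in>UNIV. \<phi> i (g i) (a i)) \<partial>PiM UNIV \<rho>) =
          F g * (\<Prod>i\<in>UNIV. \<integral>x. \<phi> i (g i) x \<partial>\<rho> i)" by simp
    qed
    finally show ?thesis unfolding G_def using ip by auto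
  qed
  have diff: "\<bar>(\<integral>a. F a \<partial>PiM UNIV \<rho>) - (\<integral>a. G a \<partial>PiM UNIV \<rho>)\<bar> \<le> e" if \<rho>: "\<rho> \<in> profiles" for \<rho>
    using intG[OF \<rho>] PiM_borel_probs[OF \<rho>] close
    by (intro prob_space.integral_close borel_probs_integrable[OF _ compact_outcome F])
      (auto simp: borel_probs_def)
  show "\<exists>g m. (\<forall>n. \<bar>(\<integral>a. F a \<partial>PiM UNIV (\<sigma> n)) - g n\<bar> \<le> e) \<and>
      \<bar>(\<integral>a. F a \<partial>PiM UNIV \<tau>) - m\<bar> \<le> e \<and> g \<longlonglongrightarrow> m"
  proof (intro exI conjI allI)
    show "\<bar>(\<integral>a. F a \<partial>PiM UNIV (\<sigma> n)) - (\<integral>a. G a \<partial>PiM UNIV (\<sigma> n))\<bar> \<le> e" for n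
      by (rule diff[OF \<sigma>])
    show "\<bar>(\<integral>a. F a \<partial>PiM UNIV \<tau>) - (\<integral>a. G a \<partial>PiM UNIV \<tau>)\<bar> \<le> e" by (rule diff[OF \<tau>])
    show "(\<lambda>n. \<integral>a. G a \<partial>PiM UNIV (\<sigma> n)) \<longlonglongrightarrow> (\<integral>a. G a \<partial>PiM UNIV \<tau>)"
      unfolding conjunct2[OF intG[OF \<sigma>]] conjunct2[OF intG[OF \<tau>]]
      by (intro tendsto_intros weakly_tendstoD[OF w] \<phi>c PK(2))
  qed
qed

lemma PiM_marginal:
  assumes "\<sigma> \<in> profiles"
  shows "distr (PiM UNIV \<sigma>) (borel_on (action_topology i)) (\<lambda>a. a i) = \<sigma> i"
proof -
  interpret product_prob_space \<sigma> UNIV by (rule profile_product[OF assms])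
  have "distr (PiM UNIV \<sigma>) (borel_on (action_topology i)) (\<lambda>a. a i) = distr (PiM UNIV \<sigma>) (\<sigma> i) (\<lambda>a. a i)"
    using borel_probsD(3)[OF profileD[OF assms]] by (intro distr_cong) auto
  then show ?thesis using PiM_component[of i] by simp
qed

text \<open>The marginals of the product recover the profile. Since \<open>prohorov\<close> sees
  only product measures, this is what makes it separate profiles.\<close>

lemma PiM_inj:
  assumes "\<sigma> \<in> profiles" "\<tau> \<in> profiles" "PiM UNIV \<sigma> = PiM UNIV \<tau>"
  shows "\<sigma> = \<tau>"
  using PiM_marginal[OF assms(1)] PiM_marginal[OF assms(2)] assms(3) by auto

lemma prohorov_metric: "Metric_space profiles prohorov"
proof
  fix \<sigma> \<tau> \<rho> :: "'p \<Rightarrow> 'a measure"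
  show "0 \<le> prohorov \<sigma> \<tau>"
  proof (cases "\<sigma> \<in> profiles \<and> \<tau> \<in> profiles")
    case True
    then show ?thesis by (simp add: prohorov_eq_levy_prokhorov outcome.levy_prokhorov_nonneg PiM_borel_probs)
  qed (auto simp: prohorov_def)
  show "prohorov \<sigma> \<tau> = prohorov \<tau> \<sigma>"
  proof (cases "\<sigma> \<in> profiles \<and> \<tau> \<in> profiles")
    case True
    then show ?thesis
      using outcome.levy_prokhorov_commute[of "PiM UNIV \<sigma>"] by (simp add: prohorov_eq_levy_prokhorov)
  qed (auto simp: prohorov_def)
  show "prohorov \<sigma> \<tau> = 0 \<longleftrightarrow> \<sigma> = \<tau>" if \<sigma>: "\<sigma> \<in> profiles" and \<tau>: "\<tau> \<in> profiles"
  proof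
    assume "prohorov \<sigma> \<tau> = 0"
    then have "outcome.levy_prokhorov (PiM UNIV \<sigma>) (PiM UNIV \<tau>) = 0"
      using that by (simp add: prohorov_eq_levy_prokhorov)
    from outcome.levy_prokhorov_zero_imp_eq[OF PiM_borel_probs[OF \<sigma>] PiM_borel_probs[OF \<tau>] this]
    show "\<sigma> = \<tau>" by (rule PiM_inj[OF \<sigma> \<tau>])
  next
    assume "\<sigma> = \<tau>"
    then show "prohorov \<sigma> \<tau> = 0"
      using that by (simp add: prohorov_eq_levy_prokhorov outcome.levy_prokhorov_refl PiM_borel_probs)
  qed
  show "prohorov \<sigma> \<rho> \<le> prohorov \<sigma> \<tau> + prohorov \<tau> \<rho>"
    if "\<sigma> \<in> profiles" "\<tau> \<in> profiles" "\<rho> \<in> profiles"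
    using that by (simp add: prohorov_eq_levy_prokhorov outcome.levy_prokhorov_triangle PiM_borel_probs)
qed

sublocale profile: Metric_space profiles prohorov by (rule prohorov_metric)

lemma prohorov_tendsto_iff_outcome:
  assumes \<sigma>: "\<And>n. \<sigma> n \<in> profiles" and \<tau>: "\<tau> \<in> profiles"
  shows "(\<lambda>n. prohorov (\<sigma> n) \<tau>) \<longlonglongrightarrow> 0 \<longleftrightarrow>
    weakly_tendsto outcome.mtopology (\<lambda>n. PiM UNIV (\<sigma> n)) (PiM UNIV \<tau>)"
  unfolding prohorov_eq_levy_prokhorov[OF \<sigma> \<tau>]
  using outcome.weakly_tendsto_imp_levy_prokhorov[OF compact_outcome, of "\<lambda>n. PiM UNIV (\<sigma> n)" "PiM UNIV \<tau>"]
    outcome.levy_prokhorov_imp_weakly_tendsto[OF compact_outcome outcomes_nonempty, of "\<lambda>n. PiM UNIV (\<sigma> n)" "PiM UNIV \<tau>"]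
    PiM_borel_probs \<sigma> \<tau> by blast

lemma integral_marginal:
  assumes "\<sigma> \<in> profiles" "continuous_map (action_topology i) euclideanreal f"
  shows "(\<integral>a. f (a i) \<partial>PiM UNIV \<sigma>) = (\<integral>x. f x \<partial>\<sigma> i)"
proof -
  have "(\<lambda>a. a i) \<in> measurable (PiM UNIV \<sigma>) (\<sigma> i)" by simp
  then have "(\<lambda>a. a i) \<in> measurable (PiM UNIV \<sigma>) (borel_on (action_topology i))"
    using measurable_cong_sets[OF refl borel_probsD(3)[OF profileD[OF assms(1)]]] by blast
  from integral_distr[OF this continuous_map_borel_measurable[OF assms(2)]]
  show ?thesis using PiM_marginal[OF assms(1)] by simp
qed

text \<open>Functions of one coordinate are test functions on outcomes, which gives convergence of
  the marginals; the converse is weak convergence of products. Through this equivalence limits can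
  be taken player by player.\<close>

lemma prohorov_tendsto_iff:
  assumes \<sigma>: "\<And>n. \<sigma> n \<in> profiles" and \<tau>: "\<tau> \<in> profiles"
  shows "(\<lambda>n. prohorov (\<sigma> n) \<tau>) \<longlonglongrightarrow> 0 \<longleftrightarrow>
    (\<forall>i. weakly_tendsto (action_topology i) (\<lambda>n. \<sigma> n i) (\<tau> i))"
proof
  assume "(\<lambda>n. prohorov (\<sigma> n) \<tau>) \<longlonglongrightarrow> 0"
  then have w: "weakly_tendsto outcome.mtopology (\<lambda>n. PiM UNIV (\<sigma> n)) (PiM UNIV \<tau>)"
    using prohorov_tendsto_iff_outcome[of \<sigma>] \<sigma> \<tau> by blast
  show "\<forall>i. weakly_tendsto (action_topology i) (\<lambda>n. \<sigma> n i) (\<tau> i)"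
    unfolding weakly_tendsto_def
  proof (intro allI impI)
    fix i f assume f: "continuous_map (action_topology i) euclideanreal f"
    have "continuous_map outcome.mtopology euclideanreal (\<lambda>a. f (a i))"
      using continuous_map_compose[OF continuous_map_outcome_component f] by (simp add: comp_def)
    from weakly_tendstoD[OF w this]
    show "(\<lambda>n. \<integral>x. f x \<partial>\<sigma> n i) \<longlonglongrightarrow> (\<integral>x. f x \<partial>\<tau> i)"
      by (simp add: integral_marginal[OF \<sigma> f] integral_marginal[OF \<tau> f])
  qed
next
  assume "\<forall>i. weakly_tendsto (action_topology i) (\<lambda>n. \<sigma> n i) (\<tau> i)"
  then show "(\<lambda>n. prohorov (\<sigma> n) \<tau>) \<longlonglongrightarrow> 0"
    using prohorov_tendsto_iff_outcome[of \<sigma>] weakly_tendsto_product[of \<sigma>] \<sigma> \<tau> by blast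
qed

lemma expected_payoff_tendsto:
  assumes \<sigma>: "\<And>n. \<sigma> n \<in> profiles" and \<tau>: "\<tau> \<in> profiles"
    and w: "\<And>i. weakly_tendsto (action_topology i) (\<lambda>n. \<sigma> n i) (\<tau> i)"
  shows "(\<lambda>n. expected_payoff j (\<sigma> n)) \<longlonglongrightarrow> expected_payoff j \<tau>"
  unfolding expected_payoff_def
  by (rule weakly_tendstoD[OF weakly_tendsto_product[OF \<sigma> \<tau> w] continuous_payoff])

text \<open>Subsequences are extracted for one player after another; a further subsequence keeps the
  limits already obtained.\<close>

lemma profiles_seq_compact:
  fixes \<sigma> :: "nat \<Rightarrow> 'p \<Rightarrow> 'a measure"
  assumes \<sigma>: "\<And>n. \<sigma> n \<in> profiles"
  obtains r \<tau> where "strict_mono r" "\<tau> \<in> profiles"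
    "\<And>i. weakly_tendsto (action_topology i) (\<lambda>n. \<sigma> (r n) i) (\<tau> i)"
proof -
  have "\<exists>r \<tau>. strict_mono r \<and> \<tau> \<in> profiles \<and>
      (\<forall>i\<in>I. weakly_tendsto (action_topology i) (\<lambda>n. \<sigma> (r n) i) (\<tau> i))" if "finite I" for I
    using that
  proof induction
    case empty
    show ?case by (intro exI[of _ id] exI[of _ "\<sigma> 0"]) (simp add: \<sigma> strict_mono_id)
  next
    case (insert j I)
    then obtain r \<tau> where r: "strict_mono r" "\<tau> \<in> profiles"
      "\<And>i. i \<in> I \<Longrightarrow> weakly_tendsto (action_topology i) (\<lambda>n. \<sigma> (r n) i) (\<tau> i)" by auto
    obtain q \<nu> where q: "strict_mono q" "\<nu> \<in> borel_probs (action_topology j)"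
      "weakly_tendsto (action_topology j) ((\<lambda>n. \<sigma> (r n) j) \<circ> q) \<nu>"
      by (rule Metric_space.weak_sequential_compactness[OF actions_metric actions_compact actions_nonempty,
            folded action_topology_def, OF profileD[OF \<sigma>]])
    show ?case
    proof (intro exI conjI ballI)
      show "strict_mono (r \<circ> q)" using r(1) q(1) by (rule strict_mono_o)
      show "\<tau>(j := \<nu>) \<in> profiles" using r(2) q(2) by (auto simp: profiles_iff strategies_eq)
      fix i assume i: "i \<in> insert j I"
      show "weakly_tendsto (action_topology i) (\<lambda>n. \<sigma> ((r \<circ> q) n) i) ((\<tau>(j := \<nu>)) i)"
      proof (cases "i = j")
        case True then show ?thesis using q(3) by (simp add: comp_def)
      next
        case False
        then have "weakly_tendsto (action_topology i) (\<lambda>n. \<sigma> (r n) i) (\<tau> i)" using i r(3) by blast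
        from weakly_tendsto_subseq[OF this q(1)] show ?thesis using False by (simp add: comp_def)
      qed
    qed
  qed
  from this[OF finite[of UNIV]] obtain r \<tau> where "strict_mono r" "\<tau> \<in> profiles"
    "\<And>i. weakly_tendsto (action_topology i) (\<lambda>n. \<sigma> (r n) i) (\<tau> i)" by auto
  then show ?thesis by (rule that)
qed

lemma limitin_profile_iff:
  assumes "\<And>n. \<sigma> n \<in> profiles" "\<tau> \<in> profiles"
  shows "limitin profile.mtopology \<sigma> \<tau> sequentially \<longleftrightarrow> (\<lambda>n. prohorov (\<sigma> n) \<tau>) \<longlonglongrightarrow> 0"
  using assms by (simp add: profile.limitin_metric_dist_null)

lemma compact_profiles: "compact_space profile.mtopology"
  unfolding profile.compact_space_sequentially
proof (intro allI impI)
  fix \<sigma> :: "nat \<Rightarrow> 'p \<Rightarrow> 'a measure" assume "range \<sigma> \<subseteq> profiles"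
  then have \<sigma>: "\<sigma> n \<in> profiles" for n by blast
  obtain r \<tau> where r: "strict_mono r" "\<tau> \<in> profiles"
    "\<And>i. weakly_tendsto (action_topology i) (\<lambda>n. \<sigma> (r n) i) (\<tau> i)"
    by (rule profiles_seq_compact[of \<sigma>, OF \<sigma>]) (rule that)
  have "(\<lambda>n. prohorov (\<sigma> (r n)) \<tau>) \<longlonglongrightarrow> 0"
    by (intro prohorov_tendsto_iff[THEN iffD2] allI r \<sigma>)
  then have "limitin profile.mtopology (\<sigma> \<circ> r) \<tau> sequentially"
    using limitin_profile_iff[of "\<sigma> \<circ> r" \<tau>] \<sigma> r(2) by (simp add: comp_def)
  then show "\<exists>l r. l \<in> profiles \<and> strict_mono r \<and> limitin profile.mtopology (\<sigma> \<circ> r) l sequentially"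
    using r(1,2) by (intro exI conjI)
qed

end

section \<open>A variational inequality on the simplex\<close>

lemma cube_seq_compact:
  fixes X :: "nat \<Rightarrow> nat \<Rightarrow> real"
  assumes "\<And>n k. 0 \<le> X n k \<and> X n k \<le> 1"
  obtains r x where "strict_mono r" "\<And>k. 0 \<le> x k \<and> x k \<le> 1" "\<And>k. (\<lambda>n. X (r n) k) \<longlonglongrightarrow> x k"
proof -
  define C where "C = Pi\<^sub>E UNIV (\<lambda>_::nat. {0..1::real})"
  have "compactin (product_topology (\<lambda>_. euclideanreal) UNIV) C"
    unfolding C_def by (simp add: compactin_PiE)
  then have "compact C" by (simp add: euclidean_product_topology)
  then have "seq_compact C" by (rule compact_imp_seq_compact)
  moreover have "\<forall>n. X n \<in> C" using assms by (simp add: C_def PiE_UNIV_domain)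
  ultimately obtain x r where x: "x \<in> C" "strict_mono r" "(X \<circ> r) \<longlonglongrightarrow> x"
    by (rule seq_compactE)
  have "(\<lambda>n. X (r n) k) \<longlonglongrightarrow> x k" for k
  proof -
    have "continuous_on UNIV (\<lambda>x. x k :: real)" by (rule continuous_on_product_coordinates)
    from continuous_on_tendsto_compose[OF this x(3)] show ?thesis by simp
  qed
  moreover have "0 \<le> x k \<and> x k \<le> 1" for k using x(1) by (auto simp: C_def PiE_UNIV_domain Pi_iff)
  ultimately show ?thesis using that x(2) by blast
qed

text \<open>Labels on ever finer grids record the sign of \<open>F i\<close>, and Kuhn's lemma finds
  a cell where both labels occur in every coordinate. No sign condition is imposed on the faces of
  the cube; the labels forced there reappear in the conclusion as the alternatives
  \<open>x i = 0\<close> and \<open>x i = 1\<close>.\<close>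

theorem poincare_miranda_cube:
  fixes F :: "nat \<Rightarrow> (nat \<Rightarrow> real) \<Rightarrow> real"
  assumes cont: "\<And>i X x. i < m \<Longrightarrow> (\<And>n k. k < m \<Longrightarrow> 0 \<le> X n k \<and> X n k \<le> 1) \<Longrightarrow>
      (\<And>k. k < m \<Longrightarrow> 0 \<le> x k \<and> x k \<le> 1) \<Longrightarrow> (\<And>k. k < m \<Longrightarrow> (\<lambda>n. X n k) \<longlonglongrightarrow> x k) \<Longrightarrow>
      (\<lambda>n. F i (X n)) \<longlonglongrightarrow> F i x"
  obtains x where "\<And>k. 0 \<le> x k \<and> x k \<le> 1"
    "\<And>i. i < m \<Longrightarrow> x i = 0 \<or> 0 \<le> F i x" "\<And>i. i < m \<Longrightarrow> x i = 1 \<or> F i x \<le> 0"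
proof -
  define N :: "nat \<Rightarrow> real" where "N p = real (Suc p)" for p
  define near where "near q a \<longleftrightarrow> (\<forall>j<m. q j \<le> a j \<and> a j \<le> q j + 1)" for q a :: "nat \<Rightarrow> nat"
  \<comment> \<open>\<open>RA\<close> is what a vertex with label \<open>0\<close> in coordinate
    \<open>i\<close> provides, and \<open>RB\<close> what one with label \<open>1\<close> provides;
    each allows for the face on which its label is forced.\<close>
  define RA where "RA p q i a \<longleftrightarrow> near q a \<and> (a i = 0 \<or> F i (\<lambda>k. real (a k) / N p) > 0)" for p q i a
  define RB where "RB p q i b \<longleftrightarrow> near q b \<and> (b i = Suc p \<or> F i (\<lambda>k. real (b k) / N p) \<le> 0)" for p q i b
  have "\<exists>q. (\<forall>i<m. q i < Suc p) \<and> (\<forall>i<m. (\<exists>a. RA p q i a) \<and> (\<exists>b. RB p q i b))" for p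
  proof -
    \<comment> \<open>Kuhn's lemma demands label \<open>0\<close> at coordinate \<open>0\<close> and
      label \<open>1\<close> at the maximal coordinate \<open>Suc p\<close>; in between the sign of
      \<open>F i\<close> decides.\<close>
    define label where "label y i = (if y i = Suc p \<or> (y i \<noteq> 0 \<and> F i (\<lambda>k. real (y k) / N p) \<le> 0) then 1 else 0::nat)"
      for y :: "nat \<Rightarrow> nat" and i
    obtain q where q: "\<forall>i<m. q i < Suc p"
      "\<forall>i<m. \<exists>r s. (\<forall>j<m. q j \<le> r j \<and> r j \<le> q j + 1) \<and> (\<forall>j<m. q j \<le> s j \<and> s j \<le> q j + 1) \<and> label r i \<noteq> label s i"
      by (rule kuhn_lemma[of "Suc p" m label]) (auto simp: label_def)
    have "(\<exists>a. RA p q i a) \<and> (\<exists>b. RB p q i b)" if "i < m" for i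
    proof -
      obtain r s where rs: "near q r" "near q s" "label r i \<noteq> label s i"
        using q(2) \<open>i < m\<close> unfolding near_def by blast
      have 0: "RA p q i y" if "near q y" "label y i = 0" for y
        using that by (auto simp: label_def RA_def split: if_splits)
      have 1: "RB p q i y" if "near q y" "label y i \<noteq> 0" for y
        using that by (auto simp: label_def RB_def split: if_splits)
      show ?thesis
      proof (cases "label r i = 0")
        case True
        then show ?thesis using 0[OF rs(1)] 1[OF rs(2)] rs(3) by auto
      next
        case False
        moreover from this have "label s i = 0" using rs(3) by (auto simp: label_def split: if_splits)
        ultimately show ?thesis using 0[OF rs(2)] 1[OF rs(1)] by auto
      qed
    qed
    then show ?thesis using q(1) by blast
  qed
  then have "\<forall>p. \<exists>q. (\<forall>i<m. q i < Suc p) \<and> (\<forall>i<m. (\<exists>a. RA p q i a) \<and> (\<exists>b. RB p q i b))" by blast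
  from choice[OF this] obtain q
    where "\<forall>p. (\<forall>i<m. q p i < Suc p) \<and> (\<forall>i<m. (\<exists>a. RA p (q p) i a) \<and> (\<exists>b. RB p (q p) i b))" ..
  then have q: "\<And>p i. i < m \<Longrightarrow> q p i < Suc p"
    "\<And>p i. i < m \<Longrightarrow> \<exists>a. RA p (q p) i a" "\<And>p i. i < m \<Longrightarrow> \<exists>b. RB p (q p) i b"
    by simp_all
  define a where "a p i = (SOME a. RA p (q p) i a)" for p i
  define b where "b p i = (SOME b. RB p (q p) i b)" for p i
  have RA: "RA p (q p) i (a p i)" and RB: "RB p (q p) i (b p i)" if "i < m" for p i
    unfolding a_def b_def by (rule someI_ex[OF q(2)[OF that]], rule someI_ex[OF q(3)[OF that]])
  have ab: "near (q p) (a p i)" "near (q p) (b p i)"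
    "a p i i = 0 \<or> F i (\<lambda>k. real (a p i k) / N p) > 0"
    "b p i i = Suc p \<or> F i (\<lambda>k. real (b p i k) / N p) \<le> 0" if "i < m" for p i
    using RA[OF that] RB[OF that] by (auto simp: RA_def RB_def)
  \<comment> \<open>Setting the coordinates from \<open>m\<close> on to \<open>0\<close> puts the
    whole sequence into the cube, as \<open>cube_seq_compact\<close> requires.\<close>
  define X where "X p k = (if k < m then real (q p k) / N p else 0)" for p k
  have X01: "0 \<le> X p k \<and> X p k \<le> 1" for p k
    using q(1)[of k p] by (auto simp: X_def N_def field_simps)
  obtain r x where r: "strict_mono r" and x: "\<And>k. 0 \<le> x k \<and> x k \<le> 1" "\<And>k. (\<lambda>n. X (r n) k) \<longlonglongrightarrow> x k"
    by (rule cube_seq_compact[of X, OF X01]) (rule that)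
  have N_inv: "(\<lambda>n. 1 / N (r n)) \<longlonglongrightarrow> 0"
    using LIMSEQ_subseq_LIMSEQ[OF LIMSEQ_inverse_real_of_nat r]
    by (simp add: comp_def N_def inverse_eq_divide)
  \<comment> \<open>Vertices of the cell at \<open>q p\<close> exceed its corner by at most
    \<open>1 / N p\<close> in each coordinate, so every choice of vertices has the same limit
    \<open>x\<close> along \<open>r\<close>.\<close>
  have lim: "(\<lambda>n. real (c (r n) k) / N (r n)) \<longlonglongrightarrow> x k"
    and in01: "0 \<le> real (c p k) / N p \<and> real (c p k) / N p \<le> 1"
    if c: "\<And>p. near (q p) (c p)" and k: "k < m" for c :: "nat \<Rightarrow> nat \<Rightarrow> nat" and k p
  proof -
    have bd: "q p k \<le> c p k \<and> c p k \<le> q p k + 1" for p using c[of p] k by (auto simp: near_def)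
    have "c p k \<le> Suc p" using bd[of p] q(1)[OF k, of p] by linarith
    then show "0 \<le> real (c p k) / N p \<and> real (c p k) / N p \<le> 1" by (auto simp: N_def)
    show "(\<lambda>n. real (c (r n) k) / N (r n)) \<longlonglongrightarrow> x k"
    proof (rule tendsto_sandwich)
      show "(\<lambda>n. X (r n) k) \<longlonglongrightarrow> x k" by (rule x(2))
      show "(\<lambda>n. X (r n) k + 1 / N (r n)) \<longlonglongrightarrow> x k" using tendsto_add[OF x(2)[of k] N_inv] by simp
      show "\<forall>\<^sub>F n in sequentially. X (r n) k \<le> real (c (r n) k) / N (r n)"
        using bd k by (auto simp: X_def N_def divide_right_mono)
      show "\<forall>\<^sub>F n in sequentially. real (c (r n) k) / N (r n) \<le> X (r n) k + 1 / N (r n)"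
      proof (rule always_eventually, rule allI)
        fix n
        have "real (c (r n) k) \<le> real (q (r n) k) + 1" using bd[of "r n"] by linarith
        then show "real (c (r n) k) / N (r n) \<le> X (r n) k + 1 / N (r n)"
          using k by (simp add: X_def N_def add_divide_distrib[symmetric] divide_right_mono)
      qed
    qed
  qed
  have Flim: "(\<lambda>n. F i (\<lambda>k. real (c (r n) k) / N (r n))) \<longlonglongrightarrow> F i x"
    if "\<And>p. near (q p) (c p)" "i < m" for c :: "nat \<Rightarrow> nat \<Rightarrow> nat" and i
    by (rule cont[OF that(2)]) (use lim[OF that(1)] in01[OF that(1)] x(1) in auto)
  show ?thesis
  proof (rule that[OF x(1)])
    fix i assume i: "i < m"
    \<comment> \<open>If \<open>F i x < 0\<close>, then \<open>F i\<close> is eventually negative at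
      the vertices of \<open>RA\<close>, so these lie on the face with \<open>i\<close>-th
      coordinate \<open>0\<close>, and so does their limit. The other alternative is
      symmetric.\<close>
    show "x i = 0 \<or> 0 \<le> F i x"
    proof (rule disjCI)
      assume "\<not> 0 \<le> F i x"
      then have "\<forall>\<^sub>F n in sequentially. F i (\<lambda>k. real (a (r n) i k) / N (r n)) < 0"
        using Flim[of "\<lambda>p. a p i"] ab(1)[OF i] i by (intro order_tendstoD) auto
      then have "\<forall>\<^sub>F n in sequentially. real (a (r n) i i) / N (r n) = 0"
        by eventually_elim (use ab(3)[OF i] in force)
      then have "(\<lambda>n. real (a (r n) i i) / N (r n)) \<longlonglongrightarrow> 0" by (rule tendsto_eventually)
      then show "x i = 0" using lim[of "\<lambda>p. a p i" i] ab(1)[OF i] i LIMSEQ_unique by blast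
    qed
    show "x i = 1 \<or> F i x \<le> 0"
    proof (rule disjCI)
      assume "\<not> F i x \<le> 0"
      then have "\<forall>\<^sub>F n in sequentially. F i (\<lambda>k. real (b (r n) i k) / N (r n)) > 0"
        using Flim[of "\<lambda>p. b p i"] ab(2)[OF i] i by (intro order_tendstoD) auto
      then have "\<forall>\<^sub>F n in sequentially. real (b (r n) i i) / N (r n) = 1"
      proof eventually_elim
        case (elim n)
        then have "b (r n) i i = Suc (r n)" using ab(4)[OF i, of "r n"] by linarith
        then show ?case by (simp add: N_def)
      qed
      then have "(\<lambda>n. real (b (r n) i i) / N (r n)) \<longlonglongrightarrow> 1" by (rule tendsto_eventually)
      then show "x i = 1" using lim[of "\<lambda>p. b p i" i] ab(2)[OF i] i LIMSEQ_unique by blast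
    qed
  qed
qed

definition simplex_weights :: "nat \<Rightarrow> (nat \<Rightarrow> real) set" where
  "simplex_weights m = {w. (\<forall>k<m. 0 \<le> w k) \<and> (\<Sum>k<m. w k) = 1}"

text \<open>
  The finite-dimensional core of Ky Fan's inequality. The shift by \<open>\<eta>\<close> in the normalization keeps
  the map from the cube to the simplex continuous at the origin; it costs the error \<open>\<delta>\<close>.
\<close>

lemma simplex_variational:
  fixes f :: "nat \<Rightarrow> (nat \<Rightarrow> real) \<Rightarrow> real"
  assumes m: "0 < m" and \<delta>: "0 < \<delta>"
    and bd: "\<And>j w. j < m \<Longrightarrow> w \<in> simplex_weights m \<Longrightarrow> \<bar>f j w\<bar> \<le> b"
    and avg: "\<And>w. w \<in> simplex_weights m \<Longrightarrow> (\<Sum>j<m. w j * f j w) \<le> 0"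
    and cont: "\<And>j W w. j < m \<Longrightarrow> (\<And>n. W n \<in> simplex_weights m) \<Longrightarrow> w \<in> simplex_weights m \<Longrightarrow>
      (\<And>k. k < m \<Longrightarrow> (\<lambda>n. W n k) \<longlonglongrightarrow> w k) \<Longrightarrow> (\<lambda>n. f j (W n)) \<longlonglongrightarrow> f j w"
  obtains w where "w \<in> simplex_weights m" "\<And>j. j < m \<Longrightarrow> f j w \<le> \<delta>"
proof -
  define c where "c = \<bar>b\<bar> + 1"
  have c: "c > 0" "\<And>j w. j < m \<Longrightarrow> w \<in> simplex_weights m \<Longrightarrow> \<bar>f j w\<bar> \<le> c"
    using bd by (fastforce simp: c_def)+
  \<comment> \<open>With \<open>c\<close> a positive bound for all \<open>f j\<close>, the shift
    lowers the weighted sum by at most \<open>m * \<eta> * c = \<delta>\<close>.\<close>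
  define \<eta> where "\<eta> = \<delta> / (real m * c)"
  have \<eta>: "\<eta> > 0" using m \<delta> c by (simp add: \<eta>_def)
  define S where "S x = (\<Sum>k<m. x k + \<eta>)" for x :: "nat \<Rightarrow> real"
  define W where "W x k = (x k + \<eta>) / S x" for x k
  have S: "S x > 0" if "\<And>k. k < m \<Longrightarrow> 0 \<le> x k \<and> x k \<le> 1" for x
    unfolding S_def using m \<eta> that by (intro sum_pos) (auto simp: add_nonneg_pos)
  have W: "W x \<in> simplex_weights m" if "\<And>k. k < m \<Longrightarrow> 0 \<le> x k \<and> x k \<le> 1" for x
  proof -
    have pos: "S x > 0" by (rule S[OF that])
    then have "(\<Sum>k<m. W x k) = 1"
      unfolding W_def by (simp add: sum_divide_distrib[symmetric] S_def[symmetric])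
    moreover have "0 \<le> W x k" if "k < m" for k
      unfolding W_def using pos \<eta> \<open>\<And>k. k < m \<Longrightarrow> 0 \<le> x k \<and> x k \<le> 1\<close>[OF that] by simp
    ultimately show ?thesis by (simp add: simplex_weights_def)
  qed
  obtain x where x: "\<And>k. 0 \<le> x k \<and> x k \<le> 1" "\<And>i. i < m \<Longrightarrow> x i = 0 \<or> 0 \<le> f i (W x)"
    "\<And>i. i < m \<Longrightarrow> x i = 1 \<or> f i (W x) \<le> 0"
  proof (rule poincare_miranda_cube[of m "\<lambda>i x. f i (W x)"])
    fix i and X :: "nat \<Rightarrow> nat \<Rightarrow> real" and x assume i: "i < m" and X: "\<And>n k. k < m \<Longrightarrow> 0 \<le> X n k \<and> X n k \<le> 1"
      and x: "\<And>k. k < m \<Longrightarrow> 0 \<le> x k \<and> x k \<le> 1" and lim: "\<And>k. k < m \<Longrightarrow> (\<lambda>n. X n k) \<longlonglongrightarrow> x k"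
    show "(\<lambda>n. f i (W (X n))) \<longlonglongrightarrow> f i (W x)"
    proof (rule cont[OF i])
      show "W (X n) \<in> simplex_weights m" for n by (rule W[of "X n", OF X])
      show "W x \<in> simplex_weights m" by (rule W[of x, OF x])
      fix k assume k: "k < m"
      have "S x \<noteq> 0" using S[of x, OF x] by simp
      then show "(\<lambda>n. W (X n) k) \<longlonglongrightarrow> W x k"
        unfolding W_def S_def by (intro tendsto_intros lim k) auto
    qed
  qed (rule that)
  show ?thesis
  proof (rule that[OF W])
    fix i assume i: "i < m"
    show "f i (W x) \<le> \<delta>"
    proof (cases "f i (W x) \<le> 0")
      case False
      then have xi: "x i = 1" using x(3)[OF i] by blast
      \<comment> \<open>\<open>f j (W x)\<close> can be negative only where \<open>x j = 0\<close>,
        so no term is negative. The term with \<open>x i = 1\<close>, which is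
        \<open>f i (W x)\<close>, is therefore at most the whole sum, and \<open>avg\<close> bounds
        that sum by \<delta>.\<close>
      have nn: "0 \<le> x j * f j (W x)" if "j < m" for j using x(1)[of j] x(2)[OF that] by auto
      have Wx: "W x \<in> simplex_weights m" by (rule W) (use x in auto)
      have "(\<Sum>j<m. (x j + \<eta>) * f j (W x)) = S x * (\<Sum>j<m. W x j * f j (W x))"
        using S[of x] x(1) by (simp add: sum_distrib_left W_def)
      also have "\<dots> \<le> 0" using avg[OF Wx] S[of x] x(1) by (simp add: mult_nonneg_nonpos less_imp_le)
      finally have 1: "(\<Sum>j<m. x j * f j (W x)) + (\<Sum>j<m. \<eta> * f j (W x)) \<le> 0"
        by (simp add: distrib_right sum.distrib)
      have "x i * f i (W x) \<le> (\<Sum>j<m. x j * f j (W x))"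
        using i nn by (intro member_le_sum) auto
      moreover have "(\<Sum>j<m. \<eta> * (- c)) \<le> (\<Sum>j<m. \<eta> * f j (W x))"
        using c(2)[OF _ Wx] \<eta> by (intro sum_mono mult_left_mono) (auto simp: abs_le_iff minus_le_iff)
      moreover have "(\<Sum>j<m. \<eta> * (- c)) = - \<delta>" using m c by (simp add: \<eta>_def)
      ultimately show ?thesis using 1 xi by simp
    qed (use \<delta> in simp)
  qed (use x in auto)
qed

section \<open>Finite mixtures of probability measures\<close>

text \<open>The convex combination is a two-stage draw: first an index according to
  \<open>w\<close>, then a point according to \<open>\<mu> k\<close>. Written as a bind, it comes
  with the iterated integral.\<close>

definition mixture :: "nat \<Rightarrow> (nat \<Rightarrow> real) \<Rightarrow> (nat \<Rightarrow> 'a measure) \<Rightarrow> 'a measure" where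
  "mixture m w \<mu> = point_measure {..<m} w \<bind> \<mu>"

lemma simplex_weights_point_measure:
  assumes "w \<in> simplex_weights m"
  shows "prob_space (point_measure {..<m} w)" "{..<m} \<noteq> {}"
proof -
  have "emeasure (point_measure {..<m} w) {..<m} = (\<Sum>k<m. ennreal (w k))"
    by (rule emeasure_point_measure_finite) auto
  also have "\<dots> = ennreal (\<Sum>k<m. w k)" using assms by (intro sum_ennreal) (simp add: simplex_weights_def)
  finally show "prob_space (point_measure {..<m} w)"
    using assms by (intro prob_spaceI) (simp add: space_point_measure simplex_weights_def)
  show "{..<m} \<noteq> {}" using assms by (auto simp: simplex_weights_def)
qed

lemma mixture_kernel:
  assumes "\<And>k. k < m \<Longrightarrow> \<mu> k \<in> borel_probs X"
  shows "\<mu> \<in> measurable (point_measure {..<m} w) (subprob_algebra (borel_on X))"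
  using assms by (auto simp: space_subprob_algebra borel_probs_def prob_space_imp_subprob_space)

lemma mixture_borel_probs:
  assumes w: "w \<in> simplex_weights m" and \<mu>: "\<And>k. k < m \<Longrightarrow> \<mu> k \<in> borel_probs X"
  shows "mixture m w \<mu> \<in> borel_probs X"
proof -
  note P = simplex_weights_point_measure[OF w]
  have s: "sets (\<mu> k) = sets (borel_on X)" if "k \<in> space (point_measure {..<m} w)" for k
    using borel_probsD(3)[OF \<mu>] that by (simp add: space_point_measure)
  have "prob_space (mixture m w \<mu>)"
    unfolding mixture_def
    by (rule prob_space.prob_space_bind[OF P(1) AE_I2 mixture_kernel[OF \<mu>]])
      (use \<mu> in \<open>auto simp: space_point_measure borel_probs_def\<close>)
  moreover have sets: "sets (mixture m w \<mu>) = sets (borel_on X)"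
    unfolding mixture_def by (rule sets_bind[OF s]) (use P(2) in \<open>auto simp: space_point_measure\<close>)
  ultimately show ?thesis using sets_eq_imp_space_eq[OF sets] by (simp add: borel_probs_def)
qed

lemma integral_mixture:
  fixes f :: "'a \<Rightarrow> real"
  assumes w: "w \<in> simplex_weights m" and \<mu>: "\<And>k. k < m \<Longrightarrow> \<mu> k \<in> borel_probs X"
    and f: "f \<in> borel_measurable (borel_on X)" "\<And>x. x \<in> topspace X \<Longrightarrow> \<bar>f x\<bar> \<le> b"
  shows "(\<integral>x. f x \<partial>mixture m w \<mu>) = (\<Sum>k<m. w k * (\<integral>x. f x \<partial>\<mu> k))"
proof -
  have "(\<integral>x. f x \<partial>mixture m w \<mu>) = (\<integral>k. (\<integral>x. f x \<partial>\<mu> k) \<partial>point_measure {..<m} w)"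
    unfolding mixture_def
  proof (rule integral_bind[OF f(1) _ mixture_kernel[OF \<mu>]])
    show "finite_measure (point_measure {..<m} w)"
      using simplex_weights_point_measure(1)[OF w] by (simp add: prob_space_def)
    show "AE k in point_measure {..<m} w. emeasure (\<mu> k) (space (\<mu> k)) \<le> ennreal 1"
      using prob_space.emeasure_space_1[OF borel_probsD(1)[OF \<mu>]]
      by (intro AE_I2) (simp add: space_point_measure)
  qed (use f(2) in auto)
  also have "\<dots> = (\<Sum>k<m. w k * (\<integral>x. f x \<partial>\<mu> k))"
    using w by (subst lebesgue_integral_point_measure_finite) (auto simp: simplex_weights_def)
  finally show ?thesis .
qed

lemma integral_mixture_continuous:
  assumes "w \<in> simplex_weights m" "\<And>k. k < m \<Longrightarrow> \<mu> k \<in> borel_probs X"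
    and "compact_space X" "continuous_map X euclideanreal f"
  shows "(\<integral>x. f x \<partial>mixture m w \<mu>) = (\<Sum>k<m. w k * (\<integral>x. f x \<partial>\<mu> k))"
proof -
  obtain b where "\<And>x. x \<in> topspace X \<Longrightarrow> \<bar>f x\<bar> \<le> b"
    using continuous_map_compact_bounded[OF assms(3,4)] by blast
  then show ?thesis
    by (intro integral_mixture[OF assms(1,2)] continuous_map_borel_measurable assms)
qed

lemma measure_mixture:
  assumes w: "w \<in> simplex_weights m" and \<mu>: "\<And>k. k < m \<Longrightarrow> \<mu> k \<in> borel_probs X"
    and E: "E \<in> sets (borel_on X)"
  shows "measure (mixture m w \<mu>) E = (\<Sum>k<m. w k * measure (\<mu> k) E)"
proof -
  have "(\<integral>x. indicator E x \<partial>mixture m w \<mu>) = (\<Sum>k<m. w k * (\<integral>x. indicator E x \<partial>\<mu> k))"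
    using E by (intro integral_mixture[OF w \<mu>, where b = 1]) auto
  moreover have "(\<integral>x. indicator E x \<partial>\<mu> k) = measure (\<mu> k) E" if "k < m" for k
    using E borel_probsD(3)[OF \<mu>[OF that]] by simp
  moreover have "(\<integral>x. indicator E x \<partial>mixture m w \<mu>) = measure (mixture m w \<mu>) E"
    using E borel_probsD(3)[OF mixture_borel_probs[OF w \<mu>]] by simp
  ultimately show ?thesis by simp
qed

definition mix2 :: "real \<Rightarrow> 'a measure \<Rightarrow> 'a measure \<Rightarrow> 'a measure" where
  "mix2 e \<mu> \<nu> = mixture 2 (\<lambda>k. if k = 0 then 1 - e else e) (\<lambda>k. if k = 0 then \<mu> else \<nu>)"

lemma mix2_weights: "0 \<le> e \<Longrightarrow> e \<le> 1 \<Longrightarrow> (\<lambda>k. if k = 0 then 1 - e else e) \<in> simplex_weights 2"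
  by (auto simp: simplex_weights_def numeral_2_eq_2)

lemma mix2_borel_probs:
  "0 \<le> e \<Longrightarrow> e \<le> 1 \<Longrightarrow> \<mu> \<in> borel_probs X \<Longrightarrow> \<nu> \<in> borel_probs X \<Longrightarrow> mix2 e \<mu> \<nu> \<in> borel_probs X"
  unfolding mix2_def by (rule mixture_borel_probs[OF mix2_weights]) auto

lemma integral_mix2:
  assumes "0 \<le> e" "e \<le> 1" "\<mu> \<in> borel_probs X" "\<nu> \<in> borel_probs X"
    "compact_space X" "continuous_map X euclideanreal f"
  shows "(\<integral>x. f x \<partial>mix2 e \<mu> \<nu>) = (1 - e) * (\<integral>x. f x \<partial>\<mu>) + e * (\<integral>x. f x \<partial>\<nu>)"
  unfolding mix2_def
  by (subst integral_mixture_continuous[OF mix2_weights]) (use assms in \<open>auto simp: numeral_2_eq_2\<close>)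

lemma measure_mix2:
  assumes "0 \<le> e" "e \<le> 1" "\<mu> \<in> borel_probs X" "\<nu> \<in> borel_probs X" "E \<in> sets (borel_on X)"
  shows "measure (mix2 e \<mu> \<nu>) E = (1 - e) * measure \<mu> E + e * measure \<nu> E"
  unfolding mix2_def
  by (subst measure_mixture[OF mix2_weights]) (use assms in \<open>auto simp: numeral_2_eq_2\<close>)

lemma weakly_tendsto_mixture:
  assumes "\<And>n. W n \<in> simplex_weights m" "w \<in> simplex_weights m"
    and "\<And>k. k < m \<Longrightarrow> (\<lambda>n. W n k) \<longlonglongrightarrow> w k"
    and "\<And>k. k < m \<Longrightarrow> \<mu> k \<in> borel_probs X" "compact_space X"
  shows "weakly_tendsto X (\<lambda>n. mixture m (W n) \<mu>) (mixture m w \<mu>)"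
  unfolding weakly_tendsto_def
proof (intro allI impI)
  fix f assume f: "continuous_map X euclideanreal f"
  show "(\<lambda>n. \<integral>x. f x \<partial>mixture m (W n) \<mu>) \<longlonglongrightarrow> (\<integral>x. f x \<partial>mixture m w \<mu>)"
  proof -
    have eq: "(\<integral>x. f x \<partial>mixture m v \<mu>) = (\<Sum>k<m. v k * (\<integral>x. f x \<partial>\<mu> k))"
      if "v \<in> simplex_weights m" for v
      by (rule integral_mixture_continuous[OF that _ assms(5) f]) (rule assms(4))
    show ?thesis
      unfolding eq[OF assms(1)] eq[OF assms(2)] by (intro tendsto_intros assms(3)) auto
  qed
qed

lemma weakly_tendsto_mix2:
  assumes e: "0 \<le> e" "e \<le> 1" and "\<And>n. \<mu> n \<in> borel_probs X" "\<mu>' \<in> borel_probs X" "\<nu> \<in> borel_probs X"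
    and "compact_space X" and w: "weakly_tendsto X \<mu> \<mu>'"
  shows "weakly_tendsto X (\<lambda>n. mix2 e (\<mu> n) \<nu>) (mix2 e \<mu>' \<nu>)"
  unfolding weakly_tendsto_def
proof (intro allI impI)
  fix f assume f: "continuous_map X euclideanreal f"
  show "(\<lambda>n. \<integral>x. f x \<partial>mix2 e (\<mu> n) \<nu>) \<longlonglongrightarrow> (\<integral>x. f x \<partial>mix2 e \<mu>' \<nu>)"
    unfolding integral_mix2[OF e assms(3,5,6) f] integral_mix2[OF e assms(4,5,6) f]
    by (intro tendsto_intros weakly_tendstoD[OF w f])
qed

lemma weakly_tendsto_mix2_vanishing:
  assumes e: "\<And>n. 0 \<le> e n" "\<And>n. e n \<le> 1" "e \<longlonglongrightarrow> 0"
    and "\<And>n. \<mu> n \<in> borel_probs X" "\<mu>' \<in> borel_probs X" "\<nu> \<in> borel_probs X"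
    and "compact_space X" and w: "weakly_tendsto X \<mu> \<mu>'"
  shows "weakly_tendsto X (\<lambda>n. mix2 (e n) (\<mu> n) \<nu>) \<mu>'"
  unfolding weakly_tendsto_def
proof (intro allI impI)
  fix f assume f: "continuous_map X euclideanreal f"
  have "(\<lambda>n. (1 - e n) * (\<integral>x. f x \<partial>\<mu> n) + e n * (\<integral>x. f x \<partial>\<nu>)) \<longlonglongrightarrow>
      (1 - 0) * (\<integral>x. f x \<partial>\<mu>') + 0 * (\<integral>x. f x \<partial>\<nu>)"
    by (intro tendsto_intros weakly_tendstoD[OF w f] e(3))
  then show "(\<lambda>n. \<integral>x. f x \<partial>mix2 (e n) (\<mu> n) \<nu>) \<longlonglongrightarrow> (\<integral>x. f x \<partial>\<mu>')"
    unfolding integral_mix2[OF e(1,2) assms(4,6,7) f] by simp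
qed

section \<open>Expected payoffs are affine in the strategy of each player\<close>

context strategic_form_game begin

lemma expected_payoff_bounded:
  obtains b where "\<And>\<sigma>. \<sigma> \<in> profiles \<Longrightarrow> \<bar>expected_payoff j \<sigma>\<bar> \<le> b"
proof -
  obtain b where b: "\<And>a. a \<in> outcomes \<Longrightarrow> \<bar>u j a\<bar> \<le> b"
    using continuous_map_compact_bounded[OF compact_outcome continuous_payoff] by auto
  show ?thesis
  proof (rule that)
    fix \<sigma> assume \<sigma>: "\<sigma> \<in> profiles"
    interpret prob_space "PiM UNIV \<sigma>" by (rule borel_probsD(1)[OF PiM_borel_probs[OF \<sigma>]])
    have "\<bar>(\<integral>a. u j a \<partial>PiM UNIV \<sigma>) - (\<integral>a. 0 \<partial>PiM UNIV \<sigma>)\<bar> \<le> b"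
      using b space_PiM_profile[OF \<sigma>]
      by (intro integral_close borel_probs_integrable[OF PiM_borel_probs[OF \<sigma>] compact_outcome continuous_payoff]) auto
    then show "\<bar>expected_payoff j \<sigma>\<bar> \<le> b" by (simp add: expected_payoff_def)
  qed
qed

lemma profile_update: "\<sigma> \<in> profiles \<Longrightarrow> \<mu> \<in> strategies i \<Longrightarrow> \<sigma>(i := \<mu>) \<in> profiles"
  by (simp add: profiles_iff)

text \<open>Fubini's theorem puts the integral over the action of player \<open>i\<close> innermost,
  with the other coordinates drawn from the fixed product \<open>R\<close>; there the formula for
  integrals under a mixture applies pointwise.\<close>

lemma expected_payoff_mixture:
  assumes \<sigma>: "\<sigma> \<in> profiles" and w: "w \<in> simplex_weights m" and \<mu>: "\<And>k. k < m \<Longrightarrow> \<mu> k \<in> strategies i"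
  shows "expected_payoff j (\<sigma>(i := mixture m w \<mu>)) = (\<Sum>k<m. w k * expected_payoff j (\<sigma>(i := \<mu> k)))"
proof -
  define R where "R = PiM (UNIV - {i}) \<sigma>"
  obtain b where b: "\<And>a. a \<in> outcomes \<Longrightarrow> \<bar>u j a\<bar> \<le> b"
    using continuous_map_compact_bounded[OF compact_outcome continuous_payoff] by auto
  have R_prob: "prob_space R" unfolding R_def by (intro prob_space_PiM profile_prob \<sigma>)
  have space_R: "space R = (\<Pi>\<^sub>E j\<in>UNIV - {i}. A j)"
    unfolding R_def space_PiM using \<sigma> by (intro PiE_cong) (simp add: profiles_iff strategies_def)
  have upd: "a(i := x) \<in> outcomes" if "a \<in> space R" "x \<in> A i" for a x
    using that by (auto simp: space_R outcomes_iff PiE_iff)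
  have fubini: "expected_payoff j (\<sigma>(i := \<nu>)) = (\<integral>a. (\<integral>x. u j (a(i := x)) \<partial>\<nu>) \<partial>R)"
    and intg: "integrable R (\<lambda>a. \<integral>x. u j (a(i := x)) \<partial>\<nu>)"
    if \<nu>: "\<nu> \<in> strategies i" for \<nu>
  proof -
    define \<sigma>' where "\<sigma>' = \<sigma>(i := \<nu>)"
    have \<sigma>': "\<sigma>' \<in> profiles" unfolding \<sigma>'_def using \<sigma> \<nu> by (rule profile_update)
    have si: "\<sigma>' i = \<nu>" by (simp add: \<sigma>'_def)
    interpret product_prob_space \<sigma>' UNIV by (rule profile_product[OF \<sigma>'])
    have R': "PiM (UNIV - {i}) \<sigma>' = R" unfolding R_def \<sigma>'_def by (intro PiM_cong) auto
    have ins: "insert i (UNIV - {i}) = UNIV" by auto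
    have int: "integrable (PiM (insert i (UNIV - {i})) \<sigma>') (u j)"
      unfolding ins by (rule borel_probs_integrable[OF PiM_borel_probs[OF \<sigma>'] compact_outcome continuous_payoff])
    have "(\<integral>a. u j a \<partial>PiM (insert i (UNIV - {i})) \<sigma>') = (\<integral>a. (\<integral>x. u j (a(i := x)) \<partial>\<sigma>' i) \<partial>PiM (UNIV - {i}) \<sigma>')"
      by (rule product_integral_insert[OF _ _ int]) auto
    then show "expected_payoff j (\<sigma>(i := \<nu>)) = (\<integral>a. (\<integral>x. u j (a(i := x)) \<partial>\<nu>) \<partial>R)"
      by (simp only: expected_payoff_def ins si R' \<sigma>'_def[symmetric])
    interpret \<nu>: prob_space \<nu> by (rule strategies_prob[OF \<nu>])
    interpret R: prob_space R by (rule R_prob)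
    have meas: "(\<lambda>(a, x). a(i := x)) \<in> measurable (R \<Otimes>\<^sub>M \<nu>) (PiM UNIV \<sigma>')"
      using measurable_add_dim[of i "UNIV - {i}" \<sigma>'] unfolding ins R' si .
    have "u j \<in> borel_measurable (PiM UNIV \<sigma>')"
      by (rule borel_probs_measurable[OF PiM_borel_probs[OF \<sigma>'] continuous_payoff])
    from measurable_compose[OF meas this]
    have "(\<lambda>(a, x). u j (a(i := x))) \<in> borel_measurable (R \<Otimes>\<^sub>M \<nu>)" by (simp add: case_prod_beta)
    then have m: "(\<lambda>a. \<integral>x. u j (a(i := x)) \<partial>\<nu>) \<in> borel_measurable R"
      by (rule \<nu>.borel_measurable_lebesgue_integral)
    show "integrable R (\<lambda>a. \<integral>x. u j (a(i := x)) \<partial>\<nu>)"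
    proof (rule R.integrable_const_bound[OF AE_I2 m])
      fix a assume a: "a \<in> space R"
      have "space \<nu> = A i" using \<nu> by (simp add: strategies_def)
      then have "norm (u j (a(i := x))) \<le> b" if "x \<in> space \<nu>" for x
        using b upd[OF a] that by simp
      then show "norm (\<integral>x. u j (a(i := x)) \<partial>\<nu>) \<le> b"
      proof (cases "integrable \<nu> (\<lambda>x. u j (a(i := x)))")
        case True
        have "norm (\<integral>x. u j (a(i := x)) \<partial>\<nu>) \<le> (\<integral>x. norm (u j (a(i := x))) \<partial>\<nu>)"
          by (rule integral_norm_bound)
        also have "\<dots> \<le> b"
          using True \<open>\<And>x. x \<in> space \<nu> \<Longrightarrow> norm (u j (a(i := x))) \<le> b\<close>
          by (intro \<nu>.integral_le_const integrable_norm AE_I2)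
        finally show ?thesis .
      next
        case False
        \<comment> \<open>The integral of a non-integrable function is \<open>0\<close> by
          convention, so \<open>0 \<le> b\<close> remains to be seen, and any point of the space
          gives it.\<close>
        obtain x where "x \<in> space \<nu>" using \<nu>.not_empty by blast
        from \<open>\<And>x. x \<in> space \<nu> \<Longrightarrow> norm (u j (a(i := x))) \<le> b\<close>[OF this]
        have "0 \<le> b" using norm_ge_zero order_trans by blast
        then show ?thesis using False by (simp add: not_integrable_integral_eq)
      qed
    qed
  qed
  have mix: "mixture m w \<mu> \<in> strategies i"
    using \<mu> unfolding strategies_eq by (intro mixture_borel_probs[OF w])
  have "(\<integral>x. u j (a(i := x)) \<partial>mixture m w \<mu>) = (\<Sum>k<m. w k * (\<integral>x. u j (a(i := x)) \<partial>\<mu> k))"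
    if a: "a \<in> space R" for a
  proof (rule integral_mixture_continuous[OF w _ compact_action])
    show "k < m \<Longrightarrow> \<mu> k \<in> borel_probs (action_topology i)" for k using \<mu> by (simp add: strategies_eq)
    have "continuous_map (action_topology i) (action_topology k) (\<lambda>x. (a(i := x)) k)" for k
      using a by (cases "k = i") (auto simp: space_R PiE_iff)
    then have "continuous_map (action_topology i) outcome.mtopology (\<lambda>x. a(i := x))"
      unfolding outcome_mtopology outcome_topology_def by (simp add: continuous_map_componentwise_UNIV)
    from continuous_map_compose[OF this continuous_payoff]
    show "continuous_map (action_topology i) euclideanreal (\<lambda>x. u j (a(i := x)))" by (simp add: comp_def)
  qed
  then have "(\<integral>a. (\<integral>x. u j (a(i := x)) \<partial>mixture m w \<mu>) \<partial>R) =
      (\<integral>a. (\<Sum>k<m. w k * (\<integral>x. u j (a(i := x)) \<partial>\<mu> k)) \<partial>R)"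
    by (intro Bochner_Integration.integral_cong) auto
  also have "\<dots> = (\<Sum>k<m. w k * (\<integral>a. (\<integral>x. u j (a(i := x)) \<partial>\<mu> k) \<partial>R))"
    using intg[OF \<mu>] by (subst Bochner_Integration.integral_sum) auto
  finally show ?thesis using fubini[OF mix] fubini[OF \<mu>] by simp
qed

end

section \<open>Equilibria of perturbed games\<close>

context strategic_form_game begin

lemma profiles_nonempty: "profiles \<noteq> {}"
proof -
  define \<mu> where "\<mu> i = return (borel_on (action_topology i)) (SOME x. x \<in> A i)" for i
  have "(SOME x. x \<in> A i) \<in> A i" for i using actions_nonempty by (simp add: some_in_eq)
  then have "\<mu> \<in> profiles"
    by (auto simp: profiles_iff strategies_def \<mu>_def intro!: prob_space_return)
  then show ?thesis by blast
qed

lemma closedin_profilesI: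
  assumes "S \<subseteq> profiles"
    and cl: "\<And>\<sigma> \<tau>. (\<And>n. \<sigma> n \<in> S) \<Longrightarrow> \<tau> \<in> profiles \<Longrightarrow>
      (\<And>i. weakly_tendsto (action_topology i) (\<lambda>n. \<sigma> n i) (\<tau> i)) \<Longrightarrow> \<tau> \<in> S"
  shows "closedin profile.mtopology S"
  unfolding profile.metric_closedin_iff_sequentially_closed
proof (intro conjI allI impI, rule assms(1))
  fix \<sigma> \<tau> assume *: "range \<sigma> \<subseteq> S \<and> limitin profile.mtopology \<sigma> \<tau> sequentially"
  then have S: "\<sigma> n \<in> S" and \<sigma>: "\<sigma> n \<in> profiles" for n using assms(1) by auto
  have \<tau>: "\<tau> \<in> profiles" using * profile.limitin_mspace by blast
  have "(\<lambda>n. prohorov (\<sigma> n) \<tau>) \<longlonglongrightarrow> 0" using * limitin_profile_iff[of \<sigma> \<tau>, OF \<sigma> \<tau>] by simp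
  then have "weakly_tendsto (action_topology i) (\<lambda>n. \<sigma> n i) (\<tau> i)" for i
    using prohorov_tendsto_iff[of \<sigma> \<tau>, OF \<sigma> \<tau>] by simp
  then show "\<tau> \<in> S" by (rule cl[OF S \<tau>])
qed

lemma expected_payoff_update_tendsto:
  assumes \<sigma>: "\<And>n. \<sigma> n \<in> profiles" "\<sigma>' \<in> profiles"
    and \<mu>: "\<And>n. \<mu> n \<in> strategies i" "\<mu>' \<in> strategies i"
    and w: "\<And>k. weakly_tendsto (action_topology k) (\<lambda>n. \<sigma> n k) (\<sigma>' k)"
    and w': "weakly_tendsto (action_topology i) \<mu> \<mu>'"
  shows "(\<lambda>n. expected_payoff j ((\<sigma> n)(i := \<mu> n))) \<longlonglongrightarrow> expected_payoff j (\<sigma>'(i := \<mu>'))"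
proof (rule expected_payoff_tendsto)
  show "(\<sigma> n)(i := \<mu> n) \<in> profiles" for n using \<sigma>(1) \<mu>(1) by (rule profile_update)
  show "\<sigma>'(i := \<mu>') \<in> profiles" using \<sigma>(2) \<mu>(2) by (rule profile_update)
  show "weakly_tendsto (action_topology k) (\<lambda>n. ((\<sigma> n)(i := \<mu> n)) k) ((\<sigma>'(i := \<mu>')) k)" for k
    using w[of k] w' by (cases "k = i") auto
qed

text \<open>For each fixed deviation the payoff inequality passes to the limit, because payoffs are
  jointly continuous in all strategies.\<close>

lemma best_response_limit:
  assumes s: "\<And>n. s n \<in> profiles" and \<sigma>: "\<sigma> \<in> profiles" and \<tau>: "\<tau> \<in> profiles"
    and br: "\<And>n. best_response (t n) (s n)"
    and ws: "\<And>k. weakly_tendsto (action_topology k) (\<lambda>n. s n k) (\<sigma> k)"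
    and wt: "\<And>k. weakly_tendsto (action_topology k) (\<lambda>n. t n k) (\<tau> k)"
  shows "best_response \<tau> \<sigma>"
  unfolding best_response_def best_response_of_def
proof (intro conjI allI ballI \<tau>)
  fix i show ti: "\<tau> i \<in> strategies i" using \<tau> by (simp add: profiles_iff)
  fix \<mu> assume \<mu>: "\<mu> \<in> strategies i"
  have t: "t n i \<in> strategies i" for n using br[of n] by (simp add: best_response_def profiles_iff)
  show "expected_payoff i (\<sigma>(i := \<mu>)) \<le> expected_payoff i (\<sigma>(i := \<tau> i))"
  proof (rule LIMSEQ_le)
    show "(\<lambda>n. expected_payoff i ((s n)(i := \<mu>))) \<longlonglongrightarrow> expected_payoff i (\<sigma>(i := \<mu>))"
      by (rule expected_payoff_update_tendsto[OF s \<sigma> \<mu> \<mu> ws weakly_tendsto_const])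
    show "(\<lambda>n. expected_payoff i ((s n)(i := t n i))) \<longlonglongrightarrow> expected_payoff i (\<sigma>(i := \<tau> i))"
      by (rule expected_payoff_update_tendsto[OF s \<sigma> t ti ws wt])
    show "\<exists>N. \<forall>n\<ge>N. expected_payoff i ((s n)(i := \<mu>)) \<le> expected_payoff i ((s n)(i := t n i))"
      using br \<mu> by (auto simp: best_response_def best_response_of_def)
  qed
qed

definition perturb :: "real \<Rightarrow> ('p \<Rightarrow> 'a measure) \<Rightarrow> ('p \<Rightarrow> 'a measure) \<Rightarrow> 'p \<Rightarrow> 'a measure" where
  "perturb e \<rho> \<tau> = (\<lambda>i. mix2 e (\<tau> i) (\<rho> i))"

text \<open>
  The Nikaido-Isoda function of the perturbed game; \<open>\<tau>\<close> is a best response to its own perturbation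
  iff no \<open>y\<close> has a positive gain.
\<close>

definition gain :: "real \<Rightarrow> ('p \<Rightarrow> 'a measure) \<Rightarrow> ('p \<Rightarrow> 'a measure) \<Rightarrow> ('p \<Rightarrow> 'a measure) \<Rightarrow> real" where
  "gain e \<rho> \<tau> y = (\<Sum>i\<in>UNIV. expected_payoff i ((perturb e \<rho> \<tau>)(i := y i)) -
     expected_payoff i ((perturb e \<rho> \<tau>)(i := \<tau> i)))"

lemma perturb_profile:
  "0 \<le> e \<Longrightarrow> e \<le> 1 \<Longrightarrow> \<rho> \<in> profiles \<Longrightarrow> \<tau> \<in> profiles \<Longrightarrow> perturb e \<rho> \<tau> \<in> profiles"
  unfolding perturb_def by (auto simp: profiles_iff strategies_eq intro: mix2_borel_probs)

lemma gain_tendsto: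
  assumes e: "0 \<le> e" "e \<le> 1" and \<rho>: "\<rho> \<in> profiles" and y: "y \<in> profiles"
    and \<tau>: "\<And>n. \<tau> n \<in> profiles" "\<tau>' \<in> profiles"
    and w: "\<And>k. weakly_tendsto (action_topology k) (\<lambda>n. \<tau> n k) (\<tau>' k)"
  shows "(\<lambda>n. gain e \<rho> (\<tau> n) y) \<longlonglongrightarrow> gain e \<rho> \<tau>' y"
proof -
  have p: "perturb e \<rho> (\<tau> n) \<in> profiles" "perturb e \<rho> \<tau>' \<in> profiles" for n
    by (intro perturb_profile e \<rho> \<tau>)+
  have wp: "weakly_tendsto (action_topology k) (\<lambda>n. perturb e \<rho> (\<tau> n) k) (perturb e \<rho> \<tau>' k)" for k
    unfolding perturb_def
    by (rule weakly_tendsto_mix2[OF e _ _ _ compact_action w]) (auto intro: profileD \<rho> \<tau>)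
  show ?thesis
    unfolding gain_def
  proof (intro tendsto_sum tendsto_diff)
    fix i
    show "(\<lambda>n. expected_payoff i ((perturb e \<rho> (\<tau> n))(i := y i))) \<longlonglongrightarrow>
        expected_payoff i ((perturb e \<rho> \<tau>')(i := y i))"
      by (rule expected_payoff_update_tendsto[OF p profile_strategy[OF y] profile_strategy[OF y] wp weakly_tendsto_const])
    show "(\<lambda>n. expected_payoff i ((perturb e \<rho> (\<tau> n))(i := \<tau> n i))) \<longlonglongrightarrow>
        expected_payoff i ((perturb e \<rho> \<tau>')(i := \<tau>' i))"
      by (rule expected_payoff_update_tendsto[OF p profile_strategy[OF \<tau>(1)] profile_strategy[OF \<tau>(2)] wp w])
  qed
qed

lemma gain_bounded:
  assumes e: "0 \<le> e" "e \<le> 1" and \<rho>: "\<rho> \<in> profiles"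
  obtains b where "\<And>\<tau> y. \<tau> \<in> profiles \<Longrightarrow> y \<in> profiles \<Longrightarrow> \<bar>gain e \<rho> \<tau> y\<bar> \<le> b"
proof -
  have "\<exists>b. \<forall>\<sigma>\<in>profiles. \<bar>expected_payoff i \<sigma>\<bar> \<le> b" for i
    using expected_payoff_bounded[of i] by metis
  then obtain b where b: "\<And>i \<sigma>. \<sigma> \<in> profiles \<Longrightarrow> \<bar>expected_payoff i \<sigma>\<bar> \<le> b i" by metis
  show ?thesis
  proof (rule that)
    fix \<tau> y assume \<tau>: "\<tau> \<in> profiles" and y: "y \<in> profiles"
    have "(perturb e \<rho> \<tau>)(i := x i) \<in> profiles" if "x \<in> profiles" for x i
      by (intro profile_update perturb_profile e \<rho> \<tau> profile_strategy that)
    then have "\<bar>expected_payoff i ((perturb e \<rho> \<tau>)(i := y i)) -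
        expected_payoff i ((perturb e \<rho> \<tau>)(i := \<tau> i))\<bar> \<le> 2 * b i" for i
      using b[of "(perturb e \<rho> \<tau>)(i := y i)" i] b[of "(perturb e \<rho> \<tau>)(i := \<tau> i)" i] \<tau> y by fastforce
    then show "\<bar>gain e \<rho> \<tau> y\<bar> \<le> (\<Sum>i\<in>UNIV. 2 * b i)"
      unfolding gain_def by (intro order_trans[OF sum_abs sum_mono])
  qed
qed

text \<open>The candidates are mixtures of the members of \<open>T\<close>. Against the fixed
  profile \<open>perturb e \<rho> (mixp w)\<close> payoffs are affine in a player's own strategy, so
  the gains averaged with the weights \<open>w\<close> cancel exactly. This is the averaging
  hypothesis of \<open>simplex_variational\<close>.\<close>

lemma finite_approx_equilibrium:
  assumes e: "0 \<le> e" "e \<le> 1" and \<rho>: "\<rho> \<in> profiles"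
    and T: "finite T" "T \<subseteq> profiles" and \<delta>: "\<delta> > 0"
  obtains \<tau> where "\<tau> \<in> profiles" "\<And>y. y \<in> T \<Longrightarrow> gain e \<rho> \<tau> y \<le> \<delta>"
proof (cases "T = {}")
  case True
  then show ?thesis using that \<rho> by blast
next
  case False
  define m where "m = card T"
  have m: "0 < m" using T False by (simp add: m_def card_gt_0_iff)
  obtain h where h: "bij_betw h {0..<m} T" unfolding m_def using ex_bij_betw_nat_finite[OF T(1)] by blast
  have hT: "h k \<in> profiles" if "k < m" for k using bij_betwE[OF h] T(2) that by auto
  define mixp where "mixp w = (\<lambda>i. mixture m w (\<lambda>k. h k i))" for w
  have hb: "h k i \<in> borel_probs (action_topology i)" if "k < m" for k i using profileD[OF hT[OF that]] .
  have mixp: "mixp w \<in> profiles" if "w \<in> simplex_weights m" for w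
    unfolding mixp_def using hb by (auto simp: profiles_iff strategies_eq intro!: mixture_borel_probs[OF that])
  obtain b where b: "\<And>\<tau> y. \<tau> \<in> profiles \<Longrightarrow> y \<in> profiles \<Longrightarrow> \<bar>gain e \<rho> \<tau> y\<bar> \<le> b"
    by (rule gain_bounded[OF e \<rho>]) (rule that)
  obtain w where w: "w \<in> simplex_weights m" "\<And>j. j < m \<Longrightarrow> gain e \<rho> (mixp w) (h j) \<le> \<delta>"
  proof (rule simplex_variational[OF m \<delta>, of "\<lambda>j w. gain e \<rho> (mixp w) (h j)" b])
    show "\<bar>gain e \<rho> (mixp w) (h j)\<bar> \<le> b" if "j < m" "w \<in> simplex_weights m" for j w
      by (rule b[OF mixp[OF that(2)] hT[OF that(1)]])
    show "(\<Sum>j<m. w j * gain e \<rho> (mixp w) (h j)) \<le> 0" if w: "w \<in> simplex_weights m" for w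
    proof -
      define s where "s = perturb e \<rho> (mixp w)"
      have s: "s \<in> profiles" unfolding s_def by (rule perturb_profile[OF e \<rho> mixp[OF w]])
      have w1: "(\<Sum>j<m. w j) = 1" using w by (simp add: simplex_weights_def)
      have lin: "(\<Sum>j<m. w j * expected_payoff i (s(i := h j i))) = expected_payoff i (s(i := mixp w i))" for i
        unfolding mixp_def
        by (rule expected_payoff_mixture[OF s w, symmetric]) (rule profile_strategy[OF hT])
      have "(\<Sum>j<m. w j * gain e \<rho> (mixp w) (h j)) =
          (\<Sum>j<m. \<Sum>i\<in>UNIV. w j * (expected_payoff i (s(i := h j i)) - expected_payoff i (s(i := mixp w i))))"
        unfolding gain_def s_def by (simp add: sum_distrib_left)
      also have "\<dots> = (\<Sum>i\<in>UNIV. \<Sum>j<m. w j * (expected_payoff i (s(i := h j i)) - expected_payoff i (s(i := mixp w i))))"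
        by (rule sum.swap)
      also have "\<dots> = 0"
        by (simp add: right_diff_distrib sum_subtractf lin sum_distrib_right[symmetric] w1)
      finally show ?thesis by simp
    qed
    fix j and W :: "nat \<Rightarrow> nat \<Rightarrow> real" and w
    assume j: "j < m" and W: "\<And>n. W n \<in> simplex_weights m" and w: "w \<in> simplex_weights m"
      and lim: "\<And>k. k < m \<Longrightarrow> (\<lambda>n. W n k) \<longlonglongrightarrow> w k"
    show "(\<lambda>n. gain e \<rho> (mixp (W n)) (h j)) \<longlonglongrightarrow> gain e \<rho> (mixp w) (h j)"
    proof (rule gain_tendsto[OF e \<rho> hT[OF j] mixp[OF W] mixp[OF w]])
      fix i
      show "weakly_tendsto (action_topology i) (\<lambda>n. mixp (W n) i) (mixp w i)"
        unfolding mixp_def by (rule weakly_tendsto_mixture[OF W w lim hb compact_action])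
    qed
  qed (rule that)
  have "gain e \<rho> (mixp w) y \<le> \<delta>" if yT: "y \<in> T" for y
  proof -
    obtain j where "j < m" "y = h j" using h yT unfolding bij_betw_def by auto
    then show ?thesis using w(2) by simp
  qed
  then show ?thesis using that mixp[OF w(1)] by blast
qed

lemma perturbed_equilibrium:
  assumes e: "0 \<le> e" "e \<le> 1" and \<rho>: "\<rho> \<in> profiles"
  obtains \<tau> where "\<tau> \<in> profiles" "best_response \<tau> (perturb e \<rho> \<tau>)"
proof -
  \<comment> \<open>The tolerance \<delta> is part of the index because finitely many deviations are
    controlled only up to a positive error; intersecting over all \<delta> removes it.\<close>
  define C where "C = (\<lambda>(y, \<delta>::real). {\<tau> \<in> profiles. gain e \<rho> \<tau> y \<le> \<delta>})"
  define P where "P = profiles \<times> {0::real<..}"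
  have "closedin profile.mtopology (C p)" if pP: "p \<in> P" for p
  proof -
    obtain y \<delta> where p: "p = (y, \<delta>)" "y \<in> profiles" using pP unfolding P_def by blast
    show ?thesis
      unfolding p C_def split
    proof (rule closedin_profilesI)
      fix \<sigma> \<tau> assume \<sigma>: "\<And>n. \<sigma> n \<in> {\<tau> \<in> profiles. gain e \<rho> \<tau> y \<le> \<delta>}" and \<tau>: "\<tau> \<in> profiles"
        and w: "\<And>i. weakly_tendsto (action_topology i) (\<lambda>n. \<sigma> n i) (\<tau> i)"
      have "\<sigma> n \<in> profiles" for n using \<sigma> by blast
      from gain_tendsto[OF e \<rho> p(2) this \<tau> w] have "gain e \<rho> \<tau> y \<le> \<delta>"
        by (rule LIMSEQ_le_const2) (use \<sigma> in blast)
      then show "\<tau> \<in> {\<tau> \<in> profiles. gain e \<rho> \<tau> y \<le> \<delta>}" using \<tau> by blast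
    qed blast
  qed
  moreover have "\<Inter>F \<noteq> {}" if F: "finite F" "F \<subseteq> C ` P" for F
  proof -
    obtain T where T: "T \<subseteq> P" "finite T" "F = C ` T" using finite_subset_image[OF F] by blast
    show ?thesis
    proof (cases "T = {}")
      case False
      define \<delta> where "\<delta> = Min (snd ` T)"
      have \<delta>: "\<delta> > 0" "\<And>p. p \<in> T \<Longrightarrow> \<delta> \<le> snd p" using T False by (auto simp: \<delta>_def P_def)
      have "finite (fst ` T)" "fst ` T \<subseteq> profiles" using T by (auto simp: P_def)
      from finite_approx_equilibrium[OF e \<rho> this \<delta>(1)]
      obtain \<tau> where \<tau>: "\<tau> \<in> profiles" "\<And>y. y \<in> fst ` T \<Longrightarrow> gain e \<rho> \<tau> y \<le> \<delta>" by blast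
      have "\<tau> \<in> C p" if "p \<in> T" for p
        using \<tau>(1) \<tau>(2)[of "fst p"] \<delta>(2)[OF that] that by (auto simp: C_def split: prod.split)
      then show ?thesis using T(3) by blast
    qed (use T(3) in simp)
  qed
  ultimately have "\<Inter>(C ` P) \<noteq> {}"
    using compact_profiles unfolding compact_space_fip by (auto dest!: spec[of _ "C ` P"])
  then obtain \<tau> where \<tau>: "\<And>p. p \<in> P \<Longrightarrow> \<tau> \<in> C p" by blast
  have \<tau>p: "\<tau> \<in> profiles" using \<tau>[of "(\<rho>, 1)"] \<rho> by (simp add: C_def P_def)
  have g: "gain e \<rho> \<tau> y \<le> 0" if "y \<in> profiles" for y
  proof (rule field_le_epsilon)
    fix \<delta> :: real assume "\<delta> > 0"
    then show "gain e \<rho> \<tau> y \<le> 0 + \<delta>" using \<tau>[of "(y, \<delta>)"] that by (simp add: C_def P_def)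
  qed
  have "best_response \<tau> (perturb e \<rho> \<tau>)"
    unfolding best_response_def best_response_of_def
  proof (intro conjI allI ballI \<tau>p profile_strategy)
    fix i \<mu> assume \<mu>: "\<mu> \<in> strategies i"
    \<comment> \<open>When only player \<open>i\<close> deviates, the other summands of
      \<open>gain\<close> vanish, so the bound on the sum becomes the inequality for this
      player.\<close>
    have "gain e \<rho> \<tau> (\<tau>(i := \<mu>)) = (\<Sum>k\<in>{i}. expected_payoff k ((perturb e \<rho> \<tau>)(k := (\<tau>(i := \<mu>)) k)) -
        expected_payoff k ((perturb e \<rho> \<tau>)(k := \<tau> k)))"
      unfolding gain_def by (rule sum.mono_neutral_right) auto
    then show "expected_payoff i ((perturb e \<rho> \<tau>)(i := \<mu>)) \<le> expected_payoff i ((perturb e \<rho> \<tau>)(i := \<tau> i))"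
      using g[OF profile_update[OF \<tau>p \<mu>]] by simp
  qed
  then show ?thesis using that \<tau>p by blast
qed

section \<open>Perfect equilibria\<close>

text \<open>With both weights positive, a mixture charges every set that either component
  charges.\<close>

lemma profile_carrier_perturb:
  assumes e: "0 < e" "e < 1" and \<rho>: "\<rho> \<in> profiles" and \<tau>: "\<tau> \<in> profiles"
  shows "profile_carrier \<rho> \<subseteq> profile_carrier (perturb e \<rho> \<tau>)"
    "profile_carrier \<tau> \<subseteq> profile_carrier (perturb e \<rho> \<tau>)"
proof -
  have "measure (mix2 e (\<tau> i) (\<rho> i)) E = (1 - e) * measure (\<tau> i) E + e * measure (\<rho> i) E"
    if "E \<in> sets (borel_on (action_topology i))" for i E
    by (rule measure_mix2[OF _ _ profileD[OF \<tau>] profileD[OF \<rho>] that]) (use e in auto)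
  moreover have "0 < (1 - e) * x + e * y" if "0 \<le> x" "0 \<le> y" "0 < x \<or> 0 < y" for x y
    using e that by (auto intro: add_nonneg_pos add_pos_nonneg)
  ultimately have "strategy_carrier i (\<rho> i) \<subseteq> strategy_carrier i (perturb e \<rho> \<tau> i)"
    "strategy_carrier i (\<tau> i) \<subseteq> strategy_carrier i (perturb e \<rho> \<tau> i)" for i
    by (auto simp: strategy_carrier_def perturb_def)
  then show "profile_carrier \<rho> \<subseteq> profile_carrier (perturb e \<rho> \<tau>)"
    "profile_carrier \<tau> \<subseteq> profile_carrier (perturb e \<rho> \<tau>)"
    unfolding profile_carrier_def by (auto intro!: PiE_mono)
qed

text \<open>
  Completely mixed nets enter perfection only through this neighbourhood condition for each single
  carrier, because any finite set of carriers is contained in a common one.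
\<close>

definition trembling :: "('p \<Rightarrow> 'a measure) \<Rightarrow> ('p \<Rightarrow> 'a measure) set" where
  "trembling \<rho> = {\<sigma> \<in> profiles. \<forall>\<epsilon>>0. \<exists>s t. s \<in> profiles \<and> profile_carrier \<rho> \<subseteq> profile_carrier s \<and>
     best_response t s \<and> prohorov s \<sigma> < \<epsilon> \<and> prohorov t \<sigma> < \<epsilon>}"

lemma trembling_antimono:
  "profile_carrier \<rho> \<subseteq> profile_carrier \<rho>' \<Longrightarrow> trembling \<rho>' \<subseteq> trembling \<rho>"
  unfolding trembling_def by blast

lemma trembling_nonempty:
  assumes \<rho>: "\<rho> \<in> profiles"
  shows "trembling \<rho> \<noteq> {}"
proof -
  \<comment> \<open>The denominator starts at \<open>2\<close> so that the weight is below
    \<open>1\<close> already at \<open>n = 0\<close>.\<close>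
  define e where "e n = 1 / real (Suc (Suc n))" for n
  have e: "0 < e n" "e n < 1" for n by (auto simp: e_def)
  have e0: "e \<longlonglongrightarrow> 0"
    unfolding e_def using LIMSEQ_Suc[OF LIMSEQ_inverse_real_of_nat] by (simp add: inverse_eq_divide)
  have "\<exists>\<tau>. \<tau> \<in> profiles \<and> best_response \<tau> (perturb (e n) \<rho> \<tau>)" for n
    by (rule perturbed_equilibrium[OF less_imp_le[OF e(1)] less_imp_le[OF e(2)] \<rho>]) blast
  then obtain \<tau> where \<tau>: "\<And>n. \<tau> n \<in> profiles" "\<And>n. best_response (\<tau> n) (perturb (e n) \<rho> (\<tau> n))"
    by metis
  obtain r \<sigma> where r: "strict_mono r" and \<sigma>: "\<sigma> \<in> profiles"
    and w: "\<And>i. weakly_tendsto (action_topology i) (\<lambda>n. \<tau> (r n) i) (\<sigma> i)"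
    by (rule profiles_seq_compact[of \<tau>, OF \<tau>(1)]) (rule that)
  \<comment> \<open>\<open>s n\<close> differs from the response \<open>\<tau> (r n)\<close> only by
    the vanishing weight \<open>e (r n)\<close> on \<rho>, so both sequences tend to
    \<sigma>.\<close>
  define s where "s n = perturb (e (r n)) \<rho> (\<tau> (r n))" for n
  have s: "s n \<in> profiles" for n
    unfolding s_def by (intro perturb_profile less_imp_le e \<rho> \<tau>)
  have er: "(\<lambda>n. e (r n)) \<longlonglongrightarrow> 0" using LIMSEQ_subseq_LIMSEQ[OF e0 r] by (simp add: comp_def)
  have "weakly_tendsto (action_topology i) (\<lambda>n. s n i) (\<sigma> i)" for i
    unfolding s_def perturb_def
    by (rule weakly_tendsto_mix2_vanishing[OF _ _ er _ _ _ compact_action w])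
      (auto intro: less_imp_le e profileD \<rho> \<sigma> \<tau>)
  then have ls: "(\<lambda>n. prohorov (s n) \<sigma>) \<longlonglongrightarrow> 0"
    using prohorov_tendsto_iff[of s \<sigma>, OF s \<sigma>] by simp
  have lt: "(\<lambda>n. prohorov (\<tau> (r n)) \<sigma>) \<longlonglongrightarrow> 0"
    using prohorov_tendsto_iff[of "\<lambda>n. \<tau> (r n)" \<sigma>, OF \<tau>(1) \<sigma>] w by simp
  have "\<sigma> \<in> trembling \<rho>"
    unfolding trembling_def
  proof (intro CollectI conjI allI impI \<sigma>)
    fix \<epsilon> :: real assume "\<epsilon> > 0"
    then have "\<forall>\<^sub>F n in sequentially. prohorov (s n) \<sigma> < \<epsilon> \<and> prohorov (\<tau> (r n)) \<sigma> < \<epsilon>"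
      using order_tendstoD(2)[OF ls] order_tendstoD(2)[OF lt] by (simp add: eventually_conj_iff)
    then obtain n where n: "prohorov (s n) \<sigma> < \<epsilon>" "prohorov (\<tau> (r n)) \<sigma> < \<epsilon>"
      unfolding eventually_sequentially by blast
    moreover have "profile_carrier \<rho> \<subseteq> profile_carrier (s n)"
      unfolding s_def by (rule profile_carrier_perturb(1)[OF e \<rho> \<tau>(1)])
    moreover have "best_response (\<tau> (r n)) (s n)" unfolding s_def by (rule \<tau>(2))
    ultimately show "\<exists>s t. s \<in> profiles \<and> profile_carrier \<rho> \<subseteq> profile_carrier s \<and>
        best_response t s \<and> prohorov s \<sigma> < \<epsilon> \<and> prohorov t \<sigma> < \<epsilon>"
      using s by blast
  qed
  then show ?thesis by blast
qed

text \<open>A pair close to \<open>\<sigma> n\<close> is close to the limit by the triangle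
  inequality; the remaining conditions concern \<open>s\<close> and \<open>t\<close> alone.\<close>

lemma trembling_closed: "closedin profile.mtopology (trembling \<rho>)"
proof (rule closedin_profilesI)
  show "trembling \<rho> \<subseteq> profiles" by (auto simp: trembling_def)
  fix \<sigma> \<tau> assume \<sigma>: "\<And>n. \<sigma> n \<in> trembling \<rho>" and \<tau>: "\<tau> \<in> profiles"
    and w: "\<And>i. weakly_tendsto (action_topology i) (\<lambda>n. \<sigma> n i) (\<tau> i)"
  have \<sigma>p: "\<sigma> n \<in> profiles" for n using \<sigma>[of n] by (simp add: trembling_def)
  have lim: "(\<lambda>n. prohorov (\<sigma> n) \<tau>) \<longlonglongrightarrow> 0"
    using prohorov_tendsto_iff[of \<sigma> \<tau>, OF \<sigma>p \<tau>] w by simp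
  show "\<tau> \<in> trembling \<rho>"
    unfolding trembling_def
  proof (intro CollectI conjI allI impI \<tau>)
    fix \<epsilon> :: real assume \<epsilon>: "\<epsilon> > 0"
    then have "\<forall>\<^sub>F n in sequentially. prohorov (\<sigma> n) \<tau> < \<epsilon> / 2"
      by (intro order_tendstoD(2)[OF lim]) simp
    then obtain n where n: "prohorov (\<sigma> n) \<tau> < \<epsilon> / 2" unfolding eventually_sequentially by blast
    have "\<epsilon> / 2 > 0" using \<epsilon> by simp
    then obtain s t where st: "s \<in> profiles" "profile_carrier \<rho> \<subseteq> profile_carrier s"
      "best_response t s" "prohorov s (\<sigma> n) < \<epsilon> / 2" "prohorov t (\<sigma> n) < \<epsilon> / 2"
      using \<sigma>[of n] unfolding trembling_def by blast
    have t: "t \<in> profiles" using st(3) by (simp add: best_response_def)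
    have "prohorov s \<tau> < \<epsilon>" "prohorov t \<tau> < \<epsilon>"
      using profile.triangle[OF st(1) \<sigma>p \<tau>, of n] profile.triangle[OF t \<sigma>p \<tau>, of n] n st(4,5) by linarith+
    then show "\<exists>s t. s \<in> profiles \<and> profile_carrier \<rho> \<subseteq> profile_carrier s \<and>
        best_response t s \<and> prohorov s \<tau> < \<epsilon> \<and> prohorov t \<tau> < \<epsilon>"
      using st by blast
  qed
qed

lemma dominating_profile:
  assumes "finite T" "T \<subseteq> profiles"
  obtains \<rho> where "\<rho> \<in> profiles" "\<And>\<tau>. \<tau> \<in> T \<Longrightarrow> profile_carrier \<tau> \<subseteq> profile_carrier \<rho>"
proof -
  have "\<exists>\<rho>\<in>profiles. \<forall>\<tau>\<in>T. profile_carrier \<tau> \<subseteq> profile_carrier \<rho>"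
    using assms
  proof induction
    case empty
    then show ?case using profiles_nonempty by blast
  next
    case (insert \<tau> T)
    then obtain \<rho> where \<rho>: "\<rho> \<in> profiles" "\<forall>\<tau>\<in>T. profile_carrier \<tau> \<subseteq> profile_carrier \<rho>" by auto
    have \<tau>: "\<tau> \<in> profiles" using insert by simp
    have "perturb (1/2) \<rho> \<tau> \<in> profiles" by (rule perturb_profile[OF _ _ \<rho>(1) \<tau>]) auto
    moreover have "profile_carrier \<rho> \<subseteq> profile_carrier (perturb (1/2) \<rho> \<tau>)"
      "profile_carrier \<tau> \<subseteq> profile_carrier (perturb (1/2) \<rho> \<tau>)"
      by (rule profile_carrier_perturb[OF _ _ \<rho>(1) \<tau>]; simp)+
    ultimately show ?case using \<rho>(2) by blast
  qed
  then show ?thesis using that by blast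
qed

lemma Inter_trembling_nonempty: "\<Inter>(trembling ` profiles) \<noteq> {}"
proof -
  have "\<Inter>F \<noteq> {}" if F: "finite F" "F \<subseteq> trembling ` profiles" for F
  proof -
    obtain T where T: "T \<subseteq> profiles" "finite T" "F = trembling ` T" using finite_subset_image[OF F] by blast
    obtain \<rho> where \<rho>: "\<rho> \<in> profiles" "\<And>\<tau>. \<tau> \<in> T \<Longrightarrow> profile_carrier \<tau> \<subseteq> profile_carrier \<rho>"
      using dominating_profile[OF T(2,1)] by blast
    then have "trembling \<rho> \<subseteq> \<Inter>F" using T(3) trembling_antimono by blast
    then show ?thesis using trembling_nonempty[OF \<rho>(1)] by blast
  qed
  then show ?thesis
    using compact_profiles trembling_closed unfolding compact_space_fip
    by (auto dest!: spec[of _ "trembling ` profiles"])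
qed

lemma perfect_imp_trembling:
  assumes "perfect \<sigma>" and \<rho>: "\<rho> \<in> profiles"
  shows "\<sigma> \<in> trembling \<rho>"
proof -
  obtain I :: "((('p \<Rightarrow> 'a measure) \<times> ('p \<Rightarrow> 'a measure)) set \<times> nat) set" and le s t
    where \<sigma>: "\<sigma> \<in> profiles" and pa: "perfect_along I le s t \<sigma>"
    using assms(1) unfolding perfect_def by blast
  have dir: "directed_set I le" and sp: "\<And>a. a \<in> I \<Longrightarrow> s a \<in> profiles"
    and br: "\<And>a. a \<in> I \<Longrightarrow> best_response (t a) (s a)"
    and mixed: "\<exists>a\<in>I. \<forall>b\<in>I. le a b \<longrightarrow> profile_carrier \<rho> \<subseteq> profile_carrier (s b)"
    and ls: "limitin profile.mtopology s \<sigma> (net_filter I le)"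
    and lt: "limitin profile.mtopology t \<sigma> (net_filter I le)"
    using pa \<rho> unfolding perfect_along_def completely_mixed_def profile_topology_def by blast+
  note ev = eventually_net_filter[OF dir]
  show ?thesis
    unfolding trembling_def
  proof (intro CollectI conjI allI impI \<sigma>)
    fix \<epsilon> :: real assume \<epsilon>: "\<epsilon> > 0"
    have "\<forall>\<^sub>F b in net_filter I le. prohorov (s b) \<sigma> < \<epsilon>" "\<forall>\<^sub>F b in net_filter I le. prohorov (t b) \<sigma> < \<epsilon>"
      using ls lt \<epsilon> unfolding profile.limitin_metric by (auto elim: eventually_mono)
    moreover have "\<forall>\<^sub>F b in net_filter I le. profile_carrier \<rho> \<subseteq> profile_carrier (s b)"
      unfolding ev by (rule mixed)
    ultimately have "\<forall>\<^sub>F b in net_filter I le. prohorov (s b) \<sigma> < \<epsilon> \<and> prohorov (t b) \<sigma> < \<epsilon> \<and>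
        profile_carrier \<rho> \<subseteq> profile_carrier (s b)" by eventually_elim simp
    then obtain a where a: "a \<in> I" "\<forall>b\<in>I. le a b \<longrightarrow> prohorov (s b) \<sigma> < \<epsilon> \<and> prohorov (t b) \<sigma> < \<epsilon> \<and>
        profile_carrier \<rho> \<subseteq> profile_carrier (s b)" unfolding ev by blast
    \<comment> \<open>Reflexivity puts \<open>a\<close> into its own tail, so this one index
      supplies both \<open>s\<close> and \<open>t\<close>.\<close>
    moreover have "le a a" using dir a(1) unfolding directed_set_def reflp_on_def by blast
    ultimately show "\<exists>s t. s \<in> profiles \<and> profile_carrier \<rho> \<subseteq> profile_carrier s \<and>
        best_response t s \<and> prohorov s \<sigma> < \<epsilon> \<and> prohorov t \<sigma> < \<epsilon>"
      using sp br by blast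
  qed
qed

lemma trembling_imp_perfect:
  assumes tr: "\<And>\<rho>. \<rho> \<in> profiles \<Longrightarrow> \<sigma> \<in> trembling \<rho>"
  shows "perfect \<sigma>"
proof -
  obtain \<rho>0 where \<rho>0: "\<rho>0 \<in> profiles" using profiles_nonempty by blast
  have \<sigma>: "\<sigma> \<in> profiles" using tr[OF \<rho>0] by (simp add: trembling_def)
  define I where "I = profiles \<times> (UNIV :: nat set)"
  \<comment> \<open>The first component prescribes the carrier to be dominated, the second the
    closeness to \<sigma>. Raising the number also yields a different index above any given one, so
    no index is maximal.\<close>
  define le where "le p q \<longleftrightarrow> profile_carrier (fst p) \<subseteq> profile_carrier (fst q) \<and> snd p \<le> snd q"
    for p q :: "('p \<Rightarrow> 'a measure) \<times> nat"
  have "\<exists>s t. s \<in> profiles \<and> profile_carrier (fst p) \<subseteq> profile_carrier s \<and> best_response t s \<and>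
      prohorov s \<sigma> < 1 / real (Suc (snd p)) \<and> prohorov t \<sigma> < 1 / real (Suc (snd p))" if "p \<in> I" for p
  proof -
    have "\<sigma> \<in> trembling (fst p)" using that tr by (auto simp: I_def)
    moreover have "1 / real (Suc (snd p)) > 0" by simp
    ultimately show ?thesis unfolding trembling_def by blast
  qed
  then obtain s t where st: "\<And>p. p \<in> I \<Longrightarrow> s p \<in> profiles \<and> profile_carrier (fst p) \<subseteq> profile_carrier (s p) \<and>
      best_response (t p) (s p) \<and>
      prohorov (s p) \<sigma> < 1 / real (Suc (snd p)) \<and> prohorov (t p) \<sigma> < 1 / real (Suc (snd p))"
    by metis
  have tp: "t p \<in> profiles" if "p \<in> I" for p using st[OF that] by (simp add: best_response_def)
  have dir: "directed_set I le"
    unfolding directed_set_def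
  proof (intro conjI ballI)
    show "I \<noteq> {}" using \<rho>0 by (auto simp: I_def)
    show "reflp_on I le" by (auto simp: reflp_on_def le_def)
    show "transp_on I le" unfolding transp_on_def le_def by force
  next
    fix p q assume pq: "p \<in> I" "q \<in> I"
    then have "finite {fst p, fst q}" "{fst p, fst q} \<subseteq> profiles" by (auto simp: I_def)
    then obtain \<rho> where \<rho>: "\<rho> \<in> profiles"
      "\<And>\<tau>. \<tau> \<in> {fst p, fst q} \<Longrightarrow> profile_carrier \<tau> \<subseteq> profile_carrier \<rho>"
      using dominating_profile by metis
    show "\<exists>z\<in>I. le p z \<and> le q z"
      by (rule bexI[of _ "(\<rho>, max (snd p) (snd q))"]) (use \<rho> in \<open>auto simp: I_def le_def\<close>)
  next
    fix p assume "p \<in> I"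
    then show "\<exists>q\<in>I. le p q \<and> q \<noteq> p"
      by (intro bexI[of _ "(fst p, Suc (snd p))"]) (auto simp: I_def le_def prod_eq_iff)
  qed
  note ev = eventually_net_filter[OF dir]
  have lim: "limitin profile.mtopology x \<sigma> (net_filter I le)"
    if x: "\<And>p. p \<in> I \<Longrightarrow> x p \<in> profiles" "\<And>p. p \<in> I \<Longrightarrow> prohorov (x p) \<sigma> < 1 / real (Suc (snd p))" for x
    unfolding profile.limitin_metric
  proof (intro conjI allI impI \<sigma>)
    fix \<epsilon> :: real assume "\<epsilon> > 0"
    then obtain n where n: "1 / real (Suc n) < \<epsilon>" using nat_approx_posE by blast
    have "prohorov (x p) \<sigma> < \<epsilon>" if "p \<in> I" "le (\<rho>0, n) p" for p
    proof -
      have "1 / real (Suc (snd p)) \<le> 1 / real (Suc n)" using that(2) by (simp add: le_def frac_le)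
      then show ?thesis using x(2)[OF that(1)] n by linarith
    qed
    then show "\<forall>\<^sub>F p in net_filter I le. x p \<in> profiles \<and> prohorov (x p) \<sigma> < \<epsilon>"
      unfolding ev using \<rho>0 x(1) by (intro bexI[of _ "(\<rho>0, n)"]) (auto simp: I_def)
  qed
  have "perfect_along I le s t \<sigma>"
    unfolding perfect_along_def completely_mixed_def profile_topology_def
  proof (intro conjI ballI dir lim)
    fix C assume "C \<in> profile_carrier ` profiles"
    then obtain \<rho> where \<rho>: "\<rho> \<in> profiles" "C = profile_carrier \<rho>" by blast
    show "\<exists>a\<in>I. \<forall>b\<in>I. le a b \<longrightarrow> C \<subseteq> profile_carrier (s b)"
    proof (intro bexI[of _ "(\<rho>, 0)"] ballI impI)
      fix b assume b: "b \<in> I" "le (\<rho>, 0) b"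
      then have "C \<subseteq> profile_carrier (fst b)" by (simp add: le_def \<rho>(2))
      then show "C \<subseteq> profile_carrier (s b)" using st[OF b(1)] by blast
    qed (use \<rho> in \<open>simp add: I_def\<close>)
  qed (use st tp in blast)+
  \<comment> \<open>\<open>perfectI\<close> moves the net to the index type fixed in the definition
    of \<open>perfect\<close>.\<close>
  then show ?thesis by (rule perfectI[OF \<sigma>])
qed

lemma perfect_iff: "perfect \<sigma> \<longleftrightarrow> \<sigma> \<in> \<Inter>(trembling ` profiles)"
  using perfect_imp_trembling trembling_imp_perfect by blast

text \<open>Membership in a trembling set provides sequences \<open>s\<close> and \<open>t\<close>
  with common limit \<sigma>, each \<open>t n\<close> a best response to \<open>s n\<close>.
  Closedness of the best-response relation then makes \<sigma> a best response to itself.\<close>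

lemma perfect_imp_nash:
  assumes "perfect \<sigma>"
  shows "nash_equilibrium \<sigma>"
proof -
  have \<sigma>: "\<sigma> \<in> profiles" using assms by (simp add: perfect_def)
  have "\<sigma> \<in> trembling \<sigma>" by (rule perfect_imp_trembling[OF assms \<sigma>])
  have "\<forall>n. \<exists>s t. s \<in> profiles \<and> best_response t s \<and>
      prohorov s \<sigma> < 1 / real (Suc n) \<and> prohorov t \<sigma> < 1 / real (Suc n)"
  proof (intro allI)
    fix n :: nat
    have "1 / real (Suc n) > 0" by simp
    with \<open>\<sigma> \<in> trembling \<sigma>\<close> show "\<exists>s t. s \<in> profiles \<and> best_response t s \<and>
        prohorov s \<sigma> < 1 / real (Suc n) \<and> prohorov t \<sigma> < 1 / real (Suc n)"
      unfolding trembling_def by blast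
  qed
  then obtain s t where st: "\<And>n. s n \<in> profiles" "\<And>n. best_response (t n) (s n)"
    "\<And>n. prohorov (s n) \<sigma> < 1 / real (Suc n)" "\<And>n. prohorov (t n) \<sigma> < 1 / real (Suc n)"
    by metis
  have t: "t n \<in> profiles" for n using st(2)[of n] by (simp add: best_response_def)
  have "(\<lambda>n. prohorov (x n) \<sigma>) \<longlonglongrightarrow> 0"
    if x: "\<And>n. prohorov (x n) \<sigma> < 1 / real (Suc n)" for x
  proof (rule tendsto_sandwich)
    show "\<forall>\<^sub>F n in sequentially. 0 \<le> prohorov (x n) \<sigma>" by simp
    show "\<forall>\<^sub>F n in sequentially. prohorov (x n) \<sigma> \<le> 1 / real (Suc n)"
      using x by (intro always_eventually allI less_imp_le)
    show "(\<lambda>n. 1 / real (Suc n)) \<longlonglongrightarrow> 0"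
      using LIMSEQ_inverse_real_of_nat by (simp add: inverse_eq_divide)
  qed simp
  then have "(\<lambda>n. prohorov (s n) \<sigma>) \<longlonglongrightarrow> 0" "(\<lambda>n. prohorov (t n) \<sigma>) \<longlonglongrightarrow> 0" using st(3,4) by blast+
  then have "weakly_tendsto (action_topology i) (\<lambda>n. s n i) (\<sigma> i)"
    "weakly_tendsto (action_topology i) (\<lambda>n. t n i) (\<sigma> i)" for i
    using prohorov_tendsto_iff[of s \<sigma>, OF st(1) \<sigma>] prohorov_tendsto_iff[of t \<sigma>, OF t \<sigma>] by simp_all
  then have "best_response \<sigma> \<sigma>"
    by (rule best_response_limit[OF st(1) \<sigma> \<sigma> st(2)])
  then show ?thesis using \<sigma> by (simp add: nash_equilibrium_def)
qed

lemma perfect_equilibria_eq: "perfect_equilibria = \<Inter>(trembling ` profiles)"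
  unfolding perfect_equilibria_def using perfect_iff perfect_imp_nash by blast

lemma perfect_equilibria_nonempty_compact:
  "perfect_equilibria \<noteq> {} \<and> compactin profile_topology perfect_equilibria"
proof
  show "perfect_equilibria \<noteq> {}" unfolding perfect_equilibria_eq by (rule Inter_trembling_nonempty)
  have "closedin profile.mtopology (\<Inter>(trembling ` profiles))"
    using trembling_closed profiles_nonempty by (intro closedin_Inter) auto
  then show "compactin profile_topology perfect_equilibria"
    unfolding perfect_equilibria_eq profile_topology_def
    by (rule closedin_compact_space[OF compact_profiles])
qed

end

theorem theorem15:
  fixes A :: "'p::finite \<Rightarrow> 'a set"
    and d :: "'p \<Rightarrow> 'a \<Rightarrow> 'a \<Rightarrow> real"
    and u :: "'p \<Rightarrow> ('p \<Rightarrow> 'a) \<Rightarrow> real"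
  assumes "strategic_form_game A d u"
  shows "strategic_form_game.perfect_equilibria A d u \<noteq> {} \<and>
    compactin (strategic_form_game.profile_topology A d)
      (strategic_form_game.perfect_equilibria A d u)"
  by (rule strategic_form_game.perfect_equilibria_nonempty_compact[OF assms])

end
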